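(* Let $(T_1,\ldots, T_n)$ be a commuting tuple of contractions on a complex Hilbert space $\mathcal{H}$ and let $T=\prod_{i=1}^nT_i$. Suppose there are projections $P_1,\ldots ,P_n\in \mathcal{B}(\mathcal{D}_{T^*})$ and commuting unitaries $U_1,\ldots ,U_n\in \mathcal{B}(\mathcal{D}_{T^*})$ such that for all $i,j\in\{1, \dots, n\}$: (1) $D_{T^*}T_i^*=P_i^{\perp}U_i^*D_{T^*}+P_iU_i^*D_{T^*}T^*$, (2) $P_i^{\perp}U_i^*P_j^{\perp}U_j^*=P_j^{\perp}U_j^*P_i^{\perp}U_i^*$, (3) $U_iP_iU_jP_j=U_jP_jU_iP_i$, (4) $D_{T^*}U_iP_iU_i^*D_{T^*}=D_{T_i^*}^2$. Let $Z_1,\ldots ,Z_n$ on $\mathcal{K}=\mathcal{H}\oplus l^2(\mathcal{D}_{T^*})=\mathcal H\oplus\mathcal D_{T^*}\oplus\mathcal D_{T^*}\oplus\cdots$ be defined as follows: $$ Z_i=\begin{bmatrix} T_i&D_{T^*}U_iP_i&0&0&\ldots \\ 0&U_iP_i^{\perp}&U_iP_i&0&\ldots \\ 0&0&U_iP_i^{\perp}&U_iP_i&\ldots \\ 0&0&0&U_iP_i^{\perp}&\ldots \\ \ldots & \ldots & \ldots & \ldots & \ldots \end{bmatrix} , \qquad (1\leq i \leq n),$$ and let $Z=\prod_{i=1}^nZ_i$. Then: (i) $(Z_1,\ldots ,Z_n)$ is a commuting $n$-tuple of co-isometries, $\mathcal{H}$ is a common invariant subspace of $Z_1,\ldots ,Z_n$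 and $Z_i|_{\mathcal{H}}=T_i$. (ii) There is an orthogonal decomposition $\mathcal{K}=\mathcal{K}_1\oplus \mathcal{K}_2$ into common reducing subspaces of $Z_1,\ldots ,Z_n$ such that $(Z_1|_{\mathcal{K}_1},\ldots ,Z_n|_{\mathcal{K}_1})$ is a pure co-isometric tuple, that is, $Z|_{\mathcal{K}_1}=\prod_{i=1}^nZ_i|_{\mathcal{K}_1}$ is a pure co-isometry, and $(Z_1|_{\mathcal{K}_2},\ldots ,Z_n|_{\mathcal{K}_2})$ is a unitary tuple. Additionally, if (5) $P_1+U_1^*P_2U_1+U_1^*U_2^*P_3U_2U_1+\ldots +U_1^*U_2^*\ldots U_{n-1}^*P_nU_{n-1}\ldots U_2U_1=I_{\mathcal{D}_{T^*}}$, then: (iii) $\mathcal{K}_1$ can be identified with $H^2(\mathcal{D}_{Z})$, where $\mathcal{D}_Z$ has the same dimension as that of $\mathcal{D}_T$. Also, there are projections $\widehat{P_1},\ldots ,\widehat{P_n}$ and commuting unitaries $ \widehat{U_1},\ldots ,\widehat{U_n}$ in $\mathcal B(\mathcal D_T)$ such that the operator tuple $(Z_1|_{\mathcal{K}_1},\ldots, Z_n|_{\mathcal{K}_1})$ is unitarily equivalent to the multiplication operator tuple $$\left( M_{\widehat{U_1}\widehat{P_1}^{\perp}+\widehat{U_1}\widehat{P_1}\bar{z}},\ldots ,M_{\widehat{U_n}\widehat{P_n}^{\perp}+\widehat{U_n}\widehat{P_n}\bar{z}} \right)$$ acting on $H^2(\mathcal{D}_{T})$.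
   Context: All operators are bounded operators on complex Hilbert spaces. A contraction is an operator of norm at most $1$. For a contraction $A$, $D_A=(I-A^*A)^{1/2}$ and $\mathcal D_A=\overline{\mathrm{Ran}}\,D_A$ (so $D_{T^*}=(I-TT^* )^{1/2}$, $D_{T_i^*}=(I-T_iT_i^* )^{1/2}$, $\mathcal D_Z=\overline{\mathrm{Ran}}(I-Z^*Z)^{1/2}$). Projections are orthogonal; $P^\perp=I-P$. A co-isometry is an operator whose adjoint is an isometry; a pure isometry is an isometry $V$ with ${V^*}^k\to0$ strongly (no unitary part), and a pure co-isometry is the adjoint of a pure isometry. A unitary tuple is a commuting tuple of unitaries. $H^2(E)$ is the Hardy space of $E$-valued analytic functions on the unit disk with square summable power series coefficients. For a symbol $\phi(z)=A+B\bar z$ with $A,B\in\mathcal B(E)$, $M_\phi$ on $H^2(E)$ is the (Toeplitz) operator $f\mapsto P_{H^2(E)}(\phi f)$, where $H^2(E)$ is viewed inside $L^2(E)$ on the unit circle; i.e. $M_{A+B\bar z}f=Af+B\,M_z^*f$. Unitary equivalence of tuples means that a single unitary intertwines them entrywise. *)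

theory Defs
  imports "HOL-Complex_Analysis.Complex_Analysis" "HOL-Library.Equipollence"
begin

section \<open>Complex Hilbert spaces\<close>

text \<open>
  The norm and topology of a complex inner product space are those of the underlying
  real inner product space, whose inner product is the real part of \<open>cinner\<close>.
  The form \<open>cinner\<close> is linear in its first argument.
\<close>

class complex_inner = real_inner +
  fixes scaleC :: "complex \<Rightarrow> 'a \<Rightarrow> 'a" (infixr "*\<^sub>C" 75)
    and cinner :: "'a \<Rightarrow> 'a \<Rightarrow> complex"
  assumes scaleC_add_right: "a *\<^sub>C (x + y) = a *\<^sub>C x + a *\<^sub>C y"
    and scaleC_add_left: "(a + b) *\<^sub>C x = a *\<^sub>C x + b *\<^sub>C x"
    and scaleC_scaleC: "a *\<^sub>C (b *\<^sub>C x) = (a * b) *\<^sub>C x"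
    and scaleC_of_real: "complex_of_real r *\<^sub>C x = r *\<^sub>R x"
    and cinner_commute: "cinner x y = cnj (cinner y x)"
    and cinner_add_left: "cinner (x + y) z = cinner x z + cinner y z"
    and cinner_scaleC_left: "cinner (a *\<^sub>C x) y = a * cinner x y"
    and Re_cinner: "Re (cinner x y) = inner x y"

class complex_hilbert = complex_inner + complete_space

subclass (in complex_hilbert) banach ..

lemma cinner_self: "cinner x x = complex_of_real ((norm x)\<^sup>2)" for x :: "'a::complex_inner"
proof -
  have "Im (cinner x x) = 0"
    using arg_cong[OF cinner_commute[of x x], of Im] by simp
  then show ?thesis
    by (simp add: complex_eq_iff Re_cinner power2_norm_eq_inner)
qed

lemma norm_scaleC: "norm (a *\<^sub>C x) = cmod a * norm x" for x :: "'a::complex_inner"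
proof -
  have "cinner (a *\<^sub>C x) (a *\<^sub>C x) = a * cnj (a * cinner x x)"
    by (metis cinner_commute cinner_scaleC_left)
  also have "\<dots> = (a * cnj a) * complex_of_real ((norm x)\<^sup>2)"
    by (simp add: cinner_self)
  also have "\<dots> = complex_of_real ((cmod a * norm x)\<^sup>2)"
    by (simp add: complex_norm_square[symmetric] power_mult_distrib)
  finally have "(norm (a *\<^sub>C x))\<^sup>2 = (cmod a * norm x)\<^sup>2"
    unfolding cinner_self by (metis of_real_eq_iff)
  then show ?thesis
    by (simp add: power2_eq_iff_nonneg)
qed

lemma norm_cinner_le: "cmod (cinner x y) \<le> norm x * norm y" for x :: "'a::complex_inner"
proof -
  define a where "a = cnj (sgn (cinner x y))"
  have "a * cinner x y = complex_of_real (cmod (cinner x y))"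
    by (cases "cinner x y = 0")
       (auto simp: a_def sgn_eq complex_norm_square[symmetric] power2_eq_square
          field_simps)
  then have "cmod (cinner x y) = Re (cinner (a *\<^sub>C x) y)"
    by (simp add: cinner_scaleC_left)
  also have "\<dots> \<le> norm (a *\<^sub>C x) * norm y"
    by (simp add: Re_cinner norm_cauchy_schwarz)
  also have "\<dots> \<le> norm x * norm y"
    by (rule mult_right_mono) (auto simp: norm_scaleC a_def norm_sgn)
  finally show ?thesis .
qed

lemma scaleC_one: "1 *\<^sub>C x = x" for x :: "'a::complex_inner"
  using scaleC_of_real[of 1 x] by simp

lemma scaleR_scaleC_commute: "r *\<^sub>R (a *\<^sub>C x) = a *\<^sub>C (r *\<^sub>R x)" for x :: "'a::complex_inner"
  by (simp add: scaleC_of_real[symmetric] scaleC_scaleC mult.commute)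

lemma bounded_linear_scaleC: "bounded_linear (\<lambda>x::'a::complex_inner. a *\<^sub>C x)"
  by (rule bounded_linear_intro[where K="cmod a"])
     (auto simp: scaleC_add_right scaleR_scaleC_commute norm_scaleC)

lemma bounded_linear_cinner_left: "bounded_linear (\<lambda>x::'a::complex_inner. cinner x y)"
proof (rule bounded_linear_intro[where K="norm y"])
  show "cinner (r *\<^sub>R x) y = r *\<^sub>R cinner x y" for r and x :: 'a
    by (simp add: scaleC_of_real[symmetric] cinner_scaleC_left scaleR_conv_of_real)
qed (auto simp: cinner_add_left norm_cinner_le)

lemma scaleC_zero_right: "a *\<^sub>C 0 = (0 :: 'a::complex_inner)"
  using scaleC_add_right[of a "0 :: 'a" 0] by simp

lemma scaleC_diff_right: "a *\<^sub>C (x - y) = a *\<^sub>C x - a *\<^sub>C y" for x :: "'a::complex_inner"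
  using scaleC_add_right[of a "x - y" y] by (simp add: eq_diff_eq)

lemma cinner_zero_left: "cinner 0 y = 0" for y :: "'a::complex_inner"
  using cinner_add_left[of 0 0 y] by simp

lemma cinner_eq_zero_all: "(\<And>v. cinner x v = 0) \<Longrightarrow> x = 0" for x :: "'a::complex_inner"
  using cinner_self[of x] by simp

instantiation complex :: complex_hilbert
begin

definition "a *\<^sub>C x = a * x" for a x :: complex
definition "cinner x y = x * cnj y" for x y :: complex

instance
  by standard
     (simp_all add: scaleC_complex_def cinner_complex_def algebra_simps scaleR_conv_of_real
       inner_complex_def)

end

instantiation prod :: (complex_inner, complex_inner) complex_inner
begin

definition "a *\<^sub>C x = (a *\<^sub>C fst x, a *\<^sub>C snd x)"
definition "cinner x y = cinner (fst x) (fst y) + cinner (snd x) (snd y)"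

instance
proof
  fix a b :: complex and r :: real and x y z :: "'a \<times> 'b"
  show "cinner x y = cnj (cinner y x)"
    unfolding cinner_prod_def complex_cnj_add
    by (rule arg_cong2[where f="(+)"]; rule cinner_commute)
  show "cinner (x + y) z = cinner x z + cinner y z"
    by (simp add: cinner_prod_def cinner_add_left)
  show "cinner (a *\<^sub>C x) y = a * cinner x y"
    by (simp add: cinner_prod_def scaleC_prod_def cinner_scaleC_left distrib_left)
  show "Re (cinner x y) = inner x y"
    by (simp add: cinner_prod_def Re_cinner inner_prod_def)
qed (simp_all add: scaleC_prod_def scaleC_add_right scaleC_add_left scaleC_scaleC
       scaleC_of_real prod_eq_iff)

end

instance prod :: (complex_hilbert, complex_hilbert) complex_hilbert ..


section \<open>Square-summable sequences\<close>

definition square_summable :: "(nat \<Rightarrow> 'a::complex_inner) \<Rightarrow> bool" where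
  "square_summable x \<longleftrightarrow> summable (\<lambda>n. (norm (x n))\<^sup>2)"

lemma square_summable_add:
  assumes "square_summable x" "square_summable y"
  shows "square_summable (\<lambda>n. x n + y n)"
  unfolding square_summable_def
proof (rule summable_comparison_test')
  show "summable (\<lambda>n. 2 * (norm (x n))\<^sup>2 + 2 * (norm (y n))\<^sup>2)"
    using assms unfolding square_summable_def by (intro summable_add summable_mult)
  fix n
  have "(norm (x n + y n))\<^sup>2 \<le> (norm (x n) + norm (y n))\<^sup>2"
    by (simp add: norm_triangle_ineq power_mono)
  also have "\<dots> \<le> 2 * (norm (x n))\<^sup>2 + 2 * (norm (y n))\<^sup>2"
    using sum_squares_bound[of "norm (x n)" "norm (y n)"] by (simp add: power2_sum)
  finally show "norm ((norm (x n + y n))\<^sup>2) \<le> 2 * (norm (x n))\<^sup>2 + 2 * (norm (y n))\<^sup>2"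
    by simp
qed

lemma square_summable_scaleC:
  "square_summable x \<Longrightarrow> square_summable (\<lambda>n. a *\<^sub>C x n)"
  unfolding square_summable_def by (simp add: norm_scaleC power_mult_distrib summable_mult)

lemma square_summable_scaleR:
  "square_summable x \<Longrightarrow> square_summable (\<lambda>n. r *\<^sub>R x n)"
  using square_summable_scaleC[of x "complex_of_real r"] by (simp add: scaleC_of_real)

lemma summable_norm_mult:
  assumes "square_summable x" "square_summable y"
  shows "summable (\<lambda>n. norm (x n) * norm (y n))"
proof (rule summable_comparison_test')
  show "summable (\<lambda>n. (norm (x n))\<^sup>2 + (norm (y n))\<^sup>2)"
    using assms unfolding square_summable_def by (rule summable_add)
  fix n
  define c where "c = norm (x n) * norm (y n)"
  have "0 \<le> c" "2 * c \<le> (norm (x n))\<^sup>2 + (norm (y n))\<^sup>2"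
    using sum_squares_bound[of "norm (x n)" "norm (y n)"] by (simp_all add: c_def)
  then show "norm (norm (x n) * norm (y n)) \<le> (norm (x n))\<^sup>2 + (norm (y n))\<^sup>2"
    unfolding c_def[symmetric] real_norm_def by arith
qed

lemma summable_cinner:
  assumes "square_summable x" "square_summable y"
  shows "summable (\<lambda>n. cinner (x n) (y n))"
  by (rule summable_comparison_test'[OF summable_norm_mult[OF assms]]) (rule norm_cinner_le)

lemma summable_inner:
  assumes "square_summable x" "square_summable y"
  shows "summable (\<lambda>n. inner (x n) (y n))"
  by (rule summable_comparison_test'[OF summable_norm_mult[OF assms]])
     (simp add: Cauchy_Schwarz_ineq2)

typedef (overloaded) 'a ell2 = "{x :: nat \<Rightarrow> 'a::complex_inner. square_summable x}"
  morphisms seq Abs_ell2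
  by (rule exI[of _ "\<lambda>n. 0"]) (simp add: square_summable_def)

setup_lifting type_definition_ell2

lemma square_summable_seq: "square_summable (seq x)"
  using seq[of x] by simp

instantiation ell2 :: (complex_inner) complex_inner
begin

lift_definition zero_ell2 :: "'a ell2" is "\<lambda>n. 0"
  by (simp add: square_summable_def)
lift_definition plus_ell2 :: "'a ell2 \<Rightarrow> 'a ell2 \<Rightarrow> 'a ell2" is "\<lambda>x y n. x n + y n"
  by (rule square_summable_add)
lift_definition uminus_ell2 :: "'a ell2 \<Rightarrow> 'a ell2" is "\<lambda>x n. - x n"
  by (simp add: square_summable_def)
lift_definition minus_ell2 :: "'a ell2 \<Rightarrow> 'a ell2 \<Rightarrow> 'a ell2" is "\<lambda>x y n. x n - y n"
  using square_summable_add[of _ "\<lambda>n. - _ n"] by (simp add: square_summable_def)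
lift_definition scaleR_ell2 :: "real \<Rightarrow> 'a ell2 \<Rightarrow> 'a ell2" is "\<lambda>r x n. r *\<^sub>R x n"
  by (rule square_summable_scaleR)
lift_definition scaleC_ell2 :: "complex \<Rightarrow> 'a ell2 \<Rightarrow> 'a ell2" is "\<lambda>a x n. a *\<^sub>C x n"
  by (rule square_summable_scaleC)

definition cinner_ell2 :: "'a ell2 \<Rightarrow> 'a ell2 \<Rightarrow> complex" where
  "cinner_ell2 x y = (\<Sum>n. cinner (seq x n) (seq y n))"
definition inner_ell2 :: "'a ell2 \<Rightarrow> 'a ell2 \<Rightarrow> real" where
  "inner_ell2 x y = (\<Sum>n. inner (seq x n) (seq y n))"
definition norm_ell2 :: "'a ell2 \<Rightarrow> real" where
  "norm_ell2 x = sqrt (inner x x)"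
definition dist_ell2 :: "'a ell2 \<Rightarrow> 'a ell2 \<Rightarrow> real" where
  "dist_ell2 x y = norm (x - y)"
definition sgn_ell2 :: "'a ell2 \<Rightarrow> 'a ell2" where
  "sgn_ell2 x = inverse (norm x) *\<^sub>R x"
definition uniformity_ell2 :: "('a ell2 \<times> 'a ell2) filter" where
  "uniformity_ell2 = (INF e\<in>{0<..}. principal {(x, y). dist x y < e})"
definition open_ell2 :: "'a ell2 set \<Rightarrow> bool" where
  "open_ell2 S \<longleftrightarrow> (\<forall>x\<in>S. \<forall>\<^sub>F (x', y) in uniformity. x' = x \<longrightarrow> y \<in> S)"

instance
proof
  fix a b :: complex and r s :: real and x y z :: "'a ell2"
  note sums = summable_inner[OF square_summable_seq square_summable_seq]
    summable_cinner[OF square_summable_seq square_summable_seq]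
  show "x + y + z = x + (y + z)" by transfer (simp add: add.assoc)
  show "x + y = y + x" by transfer (simp add: add.commute)
  show "0 + x = x" by transfer simp
  show "- x + x = 0" by transfer simp
  show "x - y = x + - y" by transfer simp
  show "r *\<^sub>R (x + y) = r *\<^sub>R x + r *\<^sub>R y" by transfer (simp add: scaleR_add_right)
  show "(r + s) *\<^sub>R x = r *\<^sub>R x + s *\<^sub>R x" by transfer (simp add: scaleR_add_left)
  show "r *\<^sub>R s *\<^sub>R x = (r * s) *\<^sub>R x" by transfer simp
  show "1 *\<^sub>R x = x" by transfer simp
  show "dist x y = norm (x - y)" by (rule dist_ell2_def)
  show "sgn x = inverse (norm x) *\<^sub>R x" by (rule sgn_ell2_def)
  show "uniformity = (INF e\<in>{0<..}. principal {(x, y :: 'a ell2). dist x y < e})"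
    by (rule uniformity_ell2_def)
  show "open S \<longleftrightarrow> (\<forall>x\<in>S. \<forall>\<^sub>F (x', y) in uniformity. x' = x \<longrightarrow> y \<in> S)" for S :: "'a ell2 set"
    by (rule open_ell2_def)
  show "norm x = sqrt (inner x x)" by (rule norm_ell2_def)
  show "inner x y = inner y x"
    by (simp add: inner_ell2_def inner_commute)
  show "inner (x + y) z = inner x z + inner y z"
    by (simp add: inner_ell2_def plus_ell2.rep_eq inner_add_left suminf_add sums)
  show "inner (r *\<^sub>R x) y = r * inner x y"
    by (simp add: inner_ell2_def scaleR_ell2.rep_eq suminf_mult sums)
  show "0 \<le> inner x x"
    by (simp add: inner_ell2_def suminf_nonneg sums)
  show "inner x x = 0 \<longleftrightarrow> x = 0"
  proof -
    have "inner x x = 0 \<longleftrightarrow> (\<forall>n. inner (seq x n) (seq x n) = 0)"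
      unfolding inner_ell2_def by (rule suminf_eq_zero_iff) (auto simp: sums)
    also have "\<dots> \<longleftrightarrow> x = 0"
      by (auto simp: seq_inject[symmetric] zero_ell2.rep_eq fun_eq_iff)
    finally show ?thesis .
  qed
  show "a *\<^sub>C (x + y) = a *\<^sub>C x + a *\<^sub>C y" by transfer (simp add: scaleC_add_right)
  show "(a + b) *\<^sub>C x = a *\<^sub>C x + b *\<^sub>C x" by transfer (simp add: scaleC_add_left)
  show "a *\<^sub>C (b *\<^sub>C x) = (a * b) *\<^sub>C x" by transfer (simp add: scaleC_scaleC)
  show "complex_of_real r *\<^sub>C x = r *\<^sub>R x" by transfer (simp add: scaleC_of_real)
  show "cinner x y = cnj (cinner y x)"
  proof -
    have "(\<lambda>n. cnj (cinner (seq y n) (seq x n))) sums cnj (cinner y x)"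
      unfolding cinner_ell2_def sums_cnj by (rule summable_sums) (rule sums)
    then show ?thesis
      unfolding cinner_commute[symmetric] by (simp add: cinner_ell2_def sums_iff)
  qed
  show "cinner (x + y) z = cinner x z + cinner y z"
    by (simp add: cinner_ell2_def plus_ell2.rep_eq cinner_add_left suminf_add sums)
  show "cinner (a *\<^sub>C x) y = a * cinner x y"
    by (simp add: cinner_ell2_def scaleC_ell2.rep_eq cinner_scaleC_left suminf_mult sums)
  show "Re (cinner x y) = inner x y"
    unfolding cinner_ell2_def inner_ell2_def
    by (subst Re_suminf) (simp_all add: sums Re_cinner)
qed

end

lemma power2_norm_ell2: "(norm x)\<^sup>2 = (\<Sum>n. (norm (seq x n))\<^sup>2)"
  by (simp add: power2_norm_eq_inner inner_ell2_def)

lemma sum_norm_seq_le: "(\<Sum>n<m. (norm (seq x n))\<^sup>2) \<le> (norm x)\<^sup>2"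
  unfolding power2_norm_ell2
  using square_summable_seq[of x] by (intro sum_le_suminf) (auto simp: square_summable_def)

lemma norm_seq_le: "norm (seq x n) \<le> norm x"
proof -
  have "(norm (seq x n))\<^sup>2 \<le> (\<Sum>k<Suc n. (norm (seq x k))\<^sup>2)"
    by (simp add: sum_nonneg)
  also have "\<dots> \<le> (norm x)\<^sup>2" by (rule sum_norm_seq_le)
  finally show ?thesis by (simp add: power2_le_iff_abs_le)
qed

instance ell2 :: (complex_hilbert) complex_hilbert
proof
  fix X :: "nat \<Rightarrow> 'a ell2"
  assume X: "Cauchy X"
  have "Cauchy (\<lambda>m. seq (X m) n)" for n
  proof (rule CauchyI)
    fix e :: real assume "0 < e"
    then obtain M where M: "\<And>m k. m \<ge> M \<Longrightarrow> k \<ge> M \<Longrightarrow> norm (X m - X k) < e"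
      using CauchyD[OF X] by blast
    have "norm (seq (X m) n - seq (X k) n) < e" if "m \<ge> M" "k \<ge> M" for m k
      using norm_seq_le[of "X m - X k" n] M[OF that] by (simp add: minus_ell2.rep_eq)
    then show "\<exists>M. \<forall>m\<ge>M. \<forall>k\<ge>M. norm (seq (X m) n - seq (X k) n) < e" by blast
  qed
  then obtain L where L: "\<And>n. (\<lambda>m. seq (X m) n) \<longlonglongrightarrow> L n"
    unfolding Cauchy_convergent_iff convergent_def by metis
  have tail: "\<exists>M. \<forall>m\<ge>M. square_summable (\<lambda>n. seq (X m) n - L n) \<and>
      (\<Sum>n. (norm (seq (X m) n - L n))\<^sup>2) \<le> e\<^sup>2" if e: "0 < e" for e
  proof -
    obtain M where M: "\<And>m k. m \<ge> M \<Longrightarrow> k \<ge> M \<Longrightarrow> norm (X m - X k) < e"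
      using CauchyD[OF X e] by blast
    have part: "(\<Sum>n<j. (norm (seq (X m) n - L n))\<^sup>2) \<le> e\<^sup>2" if "m \<ge> M" for m j
    proof (rule tendsto_upperbound)
      show "(\<lambda>k. \<Sum>n<j. (norm (seq (X m) n - seq (X k) n))\<^sup>2) \<longlonglongrightarrow>
          (\<Sum>n<j. (norm (seq (X m) n - L n))\<^sup>2)"
        by (intro tendsto_intros L)
      have "(\<Sum>n<j. (norm (seq (X m) n - seq (X k) n))\<^sup>2) \<le> e\<^sup>2" if "k \<ge> M" for k
      proof -
        have "(\<Sum>n<j. (norm (seq (X m) n - seq (X k) n))\<^sup>2) \<le> (norm (X m - X k))\<^sup>2"
          using sum_norm_seq_le[of "X m - X k" j] by (simp add: minus_ell2.rep_eq)
        also have "\<dots> \<le> e\<^sup>2"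
          using M[OF \<open>m \<ge> M\<close> \<open>k \<ge> M\<close>] by (intro power_mono) auto
        finally show ?thesis .
      qed
      then show "\<forall>\<^sub>F k in sequentially. (\<Sum>n<j. (norm (seq (X m) n - seq (X k) n))\<^sup>2) \<le> e\<^sup>2"
        using eventually_sequentially by blast
    qed simp
    have "square_summable (\<lambda>n. seq (X m) n - L n)" if "m \<ge> M" for m
      unfolding square_summable_def
      by (rule summableI_nonneg_bounded[where x="e\<^sup>2"]) (use part[OF that] in auto)
    moreover from this have "(\<Sum>n. (norm (seq (X m) n - L n))\<^sup>2) \<le> e\<^sup>2" if "m \<ge> M" for m
      using part[OF that] that by (intro suminf_le_const) (auto simp: square_summable_def)
    ultimately show ?thesis by blast
  qed
  obtain M where "square_summable (\<lambda>n. seq (X M) n - L n)"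
    using tail[of 1] by auto
  then have "square_summable (\<lambda>n. (-1) *\<^sub>C (seq (X M) n - L n) + seq (X M) n)"
    by (intro square_summable_add square_summable_scaleC square_summable_seq)
  moreover have "(-1) *\<^sub>C v = - v" for v :: 'a
    using scaleC_of_real[of "-1" v] by simp
  ultimately have "square_summable L" by simp
  then have seqL: "seq (Abs_ell2 L) = L" by (simp add: Abs_ell2_inverse)
  have "X \<longlonglongrightarrow> Abs_ell2 L"
  proof (rule LIMSEQ_I)
    fix r :: real assume "0 < r"
    then obtain M where M: "\<forall>m\<ge>M. (\<Sum>n. (norm (seq (X m) n - L n))\<^sup>2) \<le> (r/2)\<^sup>2"
      using tail[of "r/2"] by auto
    have "norm (X m - Abs_ell2 L) < r" if "m \<ge> M" for m
    proof -
      have "(norm (X m - Abs_ell2 L))\<^sup>2 \<le> (r/2)\<^sup>2"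
        using M that by (simp add: power2_norm_ell2 minus_ell2.rep_eq seqL)
      then have "norm (X m - Abs_ell2 L) \<le> r/2"
        using \<open>0 < r\<close> power2_le_imp_le by fastforce
      then show ?thesis using \<open>0 < r\<close> by simp
    qed
    then show "\<exists>M. \<forall>m\<ge>M. norm (X m - Abs_ell2 L) < r" by blast
  qed
  then show "convergent X" by (rule convergentI)
qed


section \<open>The vector-valued Hardy space on the unit disc\<close>

text \<open>
  Elements are functions on the open unit disc, extended by \<open>0\<close> so that
  equality of functions on the disc is equality in the type.
\<close>

definition has_powser :: "(complex \<Rightarrow> 'a::complex_hilbert) \<Rightarrow> (nat \<Rightarrow> 'a) \<Rightarrow> bool" where
  "has_powser f a \<longleftrightarrow> (\<forall>z. cmod z < 1 \<longrightarrow> (\<lambda>n. z ^ n *\<^sub>C a n) sums f z)"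

typedef (overloaded) 'a hardy =
  "{f :: complex \<Rightarrow> 'a::complex_hilbert.
      (\<exists>a. square_summable a \<and> has_powser f a) \<and> (\<forall>z. cmod z \<ge> 1 \<longrightarrow> f z = 0)}"
  morphisms hardy_fun Abs_hardy
  by (rule exI[of _ "\<lambda>z. 0"])
     (auto simp: square_summable_def has_powser_def scaleC_zero_right
       intro!: exI[of _ "\<lambda>n. 0"])

setup_lifting type_definition_hardy

definition hardy_coeff :: "'a::complex_hilbert hardy \<Rightarrow> nat \<Rightarrow> 'a" where
  "hardy_coeff f = (THE a. has_powser (hardy_fun f) a)"

lemma has_powser_unique:
  assumes "has_powser f a" "has_powser f b"
  shows "a = b"
proof
  fix m
  have "cinner (a m - b m) v = 0" for v
  proof (rule ccontr)
    define c where "c n = cinner (a n - b n) v" for n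
    have c: "(\<lambda>n. c n * z ^ n) sums 0" if "cmod z < 1" for z
    proof -
      have "(\<lambda>n. z ^ n *\<^sub>C a n - z ^ n *\<^sub>C b n) sums (f z - f z)"
        using assms that unfolding has_powser_def by (intro sums_diff) auto
      then have "(\<lambda>n. z ^ n *\<^sub>C (a n - b n)) sums 0"
        by (simp add: scaleC_diff_right)
      from bounded_linear.sums[OF bounded_linear_cinner_left this, of v] show ?thesis
        by (simp add: c_def cinner_scaleC_left mult.commute cinner_zero_left)
    qed
    assume "cinner (a m - b m) v \<noteq> 0"
    then have cm: "c m \<noteq> 0" by (simp add: c_def)
    show False
    proof (cases "m > 0")
      case True
      obtain s where "0 < s" "\<And>z::complex. z \<in> cball 0 s - {0} \<Longrightarrow> (0::complex) \<noteq> 0"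
        by (rule powser_0_nonzero[of 1 0 c "\<lambda>z. 0" m]) (use c cm True in auto)
      from this(2)[of "of_real s"] \<open>0 < s\<close> show False by simp
    next
      case False
      have "(\<lambda>n. c n * 0 ^ n) sums c 0" by simp
      then show False using c[of 0] cm False sums_unique2 by fastforce
    qed
  qed
  then have "a m - b m = 0" by (rule cinner_eq_zero_all)
  then show "a m = b m" by simp
qed

lemma hardy_coeff_eqI: "has_powser (hardy_fun f) a \<Longrightarrow> hardy_coeff f = a"
  unfolding hardy_coeff_def using has_powser_unique by blast

lemma has_powser_hardy: "has_powser (hardy_fun f) (hardy_coeff f)"
  and square_summable_hardy_coeff: "square_summable (hardy_coeff f)"
proof -
  obtain a where "square_summable a" "has_powser (hardy_fun f) a"
    using hardy_fun[of f] by blast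
  moreover from this(2) have "hardy_coeff f = a" by (rule hardy_coeff_eqI)
  ultimately show "has_powser (hardy_fun f) (hardy_coeff f)" "square_summable (hardy_coeff f)"
    by simp_all
qed

lemma hardy_fun_outside: "cmod z \<ge> 1 \<Longrightarrow> hardy_fun f z = 0"
  using hardy_fun[of f] by blast

lemma hardy_coeff_inject: "hardy_coeff f = hardy_coeff g \<longleftrightarrow> f = g"
proof
  assume eq: "hardy_coeff f = hardy_coeff g"
  have "hardy_fun f z = hardy_fun g z" for z
  proof (cases "cmod z < 1")
    case True
    then show ?thesis
      using has_powser_hardy[of f] has_powser_hardy[of g] eq sums_unique2
      unfolding has_powser_def by metis
  qed (simp add: hardy_fun_outside)
  then show "f = g" by (simp add: hardy_fun_inject[symmetric] fun_eq_iff)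
qed simp

lemma ex_hardy_coeff:
  assumes "square_summable a"
  shows "\<exists>f. hardy_coeff f = a"
proof -
  define f where "f z = (if cmod z < 1 then \<Sum>n. z ^ n *\<^sub>C a n else 0)" for z
  have "(\<lambda>n. (norm (a n))\<^sup>2) \<longlonglongrightarrow> 0"
    using assms unfolding square_summable_def by (rule summable_LIMSEQ_zero)
  then have "Bseq (\<lambda>n. (norm (a n))\<^sup>2)" by (rule convergent_imp_Bseq[OF convergentI])
  then obtain K where K: "\<And>n. (norm (a n))\<^sup>2 \<le> K" "K > 0"
    unfolding Bseq_def by auto
  have bound: "norm (a n) \<le> K + 1" for n
  proof (rule power2_le_imp_le)
    show "(norm (a n))\<^sup>2 \<le> (K + 1)\<^sup>2"
      using K(1)[of n] K(2) by (simp add: power2_sum) (smt (verit) zero_le_power2)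
  qed (use K in simp)
  have "summable (\<lambda>n. z ^ n *\<^sub>C a n)" if "cmod z < 1" for z
  proof (rule summable_comparison_test')
    show "summable (\<lambda>n. cmod z ^ n * (K + 1))"
      using that by (intro summable_mult2 summable_geometric) simp
    show "norm (z ^ n *\<^sub>C a n) \<le> cmod z ^ n * (K + 1)" for n
      unfolding norm_scaleC norm_power by (intro mult_left_mono bound) simp
  qed
  then have "has_powser f a"
    unfolding has_powser_def f_def by (simp add: summable_sums)
  moreover from this assms have "hardy_fun (Abs_hardy f) = f"
    by (intro Abs_hardy_inverse) (auto simp: f_def)
  ultimately show ?thesis using hardy_coeff_eqI by metis
qed

lemma has_powser_zero: "has_powser (\<lambda>z. 0) (\<lambda>n. 0)"
  by (simp add: has_powser_def scaleC_zero_right)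

lemma has_powser_add:
  "has_powser f a \<Longrightarrow> has_powser g b \<Longrightarrow> has_powser (\<lambda>z. f z + g z) (\<lambda>n. a n + b n)"
  by (simp add: has_powser_def scaleC_add_right sums_add)

lemma has_powser_scaleC: "has_powser f a \<Longrightarrow> has_powser (\<lambda>z. c *\<^sub>C f z) (\<lambda>n. c *\<^sub>C a n)"
  unfolding has_powser_def
proof (intro allI impI)
  fix z assume "\<forall>z. cmod z < 1 \<longrightarrow> (\<lambda>n. z ^ n *\<^sub>C a n) sums f z" "cmod z < 1"
  then have "(\<lambda>n. c *\<^sub>C (z ^ n *\<^sub>C a n)) sums (c *\<^sub>C f z)"
    by (intro bounded_linear.sums[OF bounded_linear_scaleC]) auto
  then show "(\<lambda>n. z ^ n *\<^sub>C c *\<^sub>C a n) sums (c *\<^sub>C f z)"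
    by (simp add: scaleC_scaleC mult.commute)
qed

lemma has_powser_scaleR: "has_powser f a \<Longrightarrow> has_powser (\<lambda>z. r *\<^sub>R f z) (\<lambda>n. r *\<^sub>R a n)"
  using has_powser_scaleC[of f a "complex_of_real r"] by (simp add: scaleC_of_real)

instantiation hardy :: (complex_hilbert) complex_inner
begin

lift_definition zero_hardy :: "'a hardy" is "\<lambda>z. 0"
  using has_powser_zero by (auto intro!: exI[of _ "\<lambda>n. 0"] simp: square_summable_def)
lift_definition plus_hardy :: "'a hardy \<Rightarrow> 'a hardy \<Rightarrow> 'a hardy" is "\<lambda>f g z. f z + g z"
  by (elim conjE exE, intro conjI exI, rule square_summable_add, assumption+,
      rule has_powser_add, assumption+, simp)
lift_definition scaleC_hardy :: "complex \<Rightarrow> 'a hardy \<Rightarrow> 'a hardy" is "\<lambda>c f z. c *\<^sub>C f z"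
  by (elim conjE exE, intro conjI exI, rule square_summable_scaleC, assumption+,
      rule has_powser_scaleC, assumption+, simp add: scaleC_zero_right)
lift_definition scaleR_hardy :: "real \<Rightarrow> 'a hardy \<Rightarrow> 'a hardy" is "\<lambda>r f z. r *\<^sub>R f z"
  by (elim conjE exE, intro conjI exI, rule square_summable_scaleR, assumption+,
      rule has_powser_scaleR, assumption+, simp)
definition uminus_hardy :: "'a hardy \<Rightarrow> 'a hardy" where
  "uminus_hardy f = (-1) *\<^sub>R f"
definition minus_hardy :: "'a hardy \<Rightarrow> 'a hardy \<Rightarrow> 'a hardy" where
  "minus_hardy f g = f + (-1) *\<^sub>R g"

definition cinner_hardy :: "'a hardy \<Rightarrow> 'a hardy \<Rightarrow> complex" where
  "cinner_hardy f g = (\<Sum>n. cinner (hardy_coeff f n) (hardy_coeff g n))"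
definition inner_hardy :: "'a hardy \<Rightarrow> 'a hardy \<Rightarrow> real" where
  "inner_hardy f g = (\<Sum>n. inner (hardy_coeff f n) (hardy_coeff g n))"
definition norm_hardy :: "'a hardy \<Rightarrow> real" where
  "norm_hardy f = sqrt (inner f f)"
definition dist_hardy :: "'a hardy \<Rightarrow> 'a hardy \<Rightarrow> real" where
  "dist_hardy f g = norm (f - g)"
definition sgn_hardy :: "'a hardy \<Rightarrow> 'a hardy" where
  "sgn_hardy f = inverse (norm f) *\<^sub>R f"
definition uniformity_hardy :: "('a hardy \<times> 'a hardy) filter" where
  "uniformity_hardy = (INF e\<in>{0<..}. principal {(f, g). dist f g < e})"
definition open_hardy :: "'a hardy set \<Rightarrow> bool" where
  "open_hardy S \<longleftrightarrow> (\<forall>f\<in>S. \<forall>\<^sub>F (f', g) in uniformity. f' = f \<longrightarrow> g \<in> S)"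

lemma hardy_coeff_linear:
  "hardy_coeff 0 = (\<lambda>n. 0 :: 'a)"
  "hardy_coeff (f + g) = (\<lambda>n. hardy_coeff f n + hardy_coeff g n)"
  "hardy_coeff (c *\<^sub>C f) = (\<lambda>n. c *\<^sub>C hardy_coeff f n)"
  "hardy_coeff (r *\<^sub>R f) = (\<lambda>n. r *\<^sub>R hardy_coeff f n)"
  for f g :: "'a hardy"
  by (auto intro!: hardy_coeff_eqI has_powser_zero has_powser_add has_powser_scaleC
      has_powser_scaleR has_powser_hardy
      simp: zero_hardy.rep_eq plus_hardy.rep_eq scaleC_hardy.rep_eq scaleR_hardy.rep_eq)

instance
proof
  fix a b :: complex and r s :: real and x y z :: "'a hardy"
  define c where "c f = Abs_ell2 (hardy_coeff f)" for f :: "'a hardy"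
  have seq_c: "seq (c f) = hardy_coeff f" for f
    by (simp add: c_def Abs_ell2_inverse square_summable_hardy_coeff)
  have c_inject: "c f = c g \<longleftrightarrow> f = g" for f g
    by (metis seq_c hardy_coeff_inject)
  have c_add: "c (f + g) = c f + c g" for f g
    by (simp add: seq_inject[symmetric] seq_c plus_ell2.rep_eq hardy_coeff_linear)
  have c_zero: "c 0 = 0"
    by (simp add: seq_inject[symmetric] seq_c zero_ell2.rep_eq hardy_coeff_linear)
  have c_scaleC: "c (d *\<^sub>C f) = d *\<^sub>C c f" for d f
    by (simp add: seq_inject[symmetric] seq_c scaleC_ell2.rep_eq hardy_coeff_linear)
  have c_scaleR: "c (t *\<^sub>R f) = t *\<^sub>R c f" for t f
    by (simp add: seq_inject[symmetric] seq_c scaleR_ell2.rep_eq hardy_coeff_linear)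
  have c_inner: "inner f g = inner (c f) (c g)" for f g
    by (simp add: inner_hardy_def inner_ell2_def seq_c)
  have c_cinner: "cinner f g = cinner (c f) (c g)" for f g
    by (simp add: cinner_hardy_def cinner_ell2_def seq_c)
  note c = c_add c_zero c_scaleC c_scaleR
  note eq = c_inject[symmetric]
  show "x + y + z = x + (y + z)" by (simp add: eq c add.assoc)
  show "x + y = y + x" by (simp add: eq c add.commute)
  show "0 + x = x" by (simp add: eq c)
  show "- x + x = 0" by (simp add: uminus_hardy_def eq c)
  show "x - y = x + - y" by (simp add: minus_hardy_def uminus_hardy_def)
  show "r *\<^sub>R (x + y) = r *\<^sub>R x + r *\<^sub>R y" by (simp add: eq c scaleR_add_right)
  show "(r + s) *\<^sub>R x = r *\<^sub>R x + s *\<^sub>R x" by (simp add: eq c scaleR_add_left)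
  show "r *\<^sub>R s *\<^sub>R x = (r * s) *\<^sub>R x" by (simp add: eq c)
  show "1 *\<^sub>R x = x" by (simp add: eq c)
  show "dist x y = norm (x - y)" by (rule dist_hardy_def)
  show "sgn x = inverse (norm x) *\<^sub>R x" by (rule sgn_hardy_def)
  show "uniformity = (INF e\<in>{0<..}. principal {(x, y :: 'a hardy). dist x y < e})"
    by (rule uniformity_hardy_def)
  show "open S \<longleftrightarrow> (\<forall>x\<in>S. \<forall>\<^sub>F (x', y) in uniformity. x' = x \<longrightarrow> y \<in> S)" for S :: "'a hardy set"
    by (rule open_hardy_def)
  show "norm x = sqrt (inner x x)" by (rule norm_hardy_def)
  show "inner x y = inner y x" by (simp only: c_inner inner_commute)
  show "inner (x + y) z = inner x z + inner y z" by (simp add: c_inner c inner_add_left)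
  show "inner (r *\<^sub>R x) y = r * inner x y" by (simp add: c_inner c)
  show "0 \<le> inner x x" by (simp add: c_inner)
  show "inner x x = 0 \<longleftrightarrow> x = 0" using c_inject[of x 0] by (simp add: c_inner c)
  show "a *\<^sub>C (x + y) = a *\<^sub>C x + a *\<^sub>C y" by (simp add: eq c scaleC_add_right)
  show "(a + b) *\<^sub>C x = a *\<^sub>C x + b *\<^sub>C x" by (simp add: eq c scaleC_add_left)
  show "a *\<^sub>C (b *\<^sub>C x) = (a * b) *\<^sub>C x" by (simp add: eq c scaleC_scaleC)
  show "complex_of_real r *\<^sub>C x = r *\<^sub>R x" by (simp add: eq c scaleC_of_real)
  show "cinner x y = cnj (cinner y x)" unfolding c_cinner by (rule cinner_commute)
  show "cinner (x + y) z = cinner x z + cinner y z" by (simp add: c_cinner c cinner_add_left)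
  show "cinner (a *\<^sub>C x) y = a * cinner x y" by (simp add: c_cinner c cinner_scaleC_left)
  show "Re (cinner x y) = inner x y" by (simp add: c_cinner c_inner Re_cinner)
qed

end

instance hardy :: (complex_hilbert) complex_hilbert
proof
  fix X :: "nat \<Rightarrow> 'a hardy"
  assume X: "Cauchy X"
  define c where "c f = Abs_ell2 (hardy_coeff f)" for f :: "'a hardy"
  have seq_c: "seq (c f) = hardy_coeff f" for f
    by (simp add: c_def Abs_ell2_inverse square_summable_hardy_coeff)
  have norm_c: "norm (c f - c g) = norm (f - g)" for f g
  proof -
    have "hardy_coeff (f - g) = (\<lambda>n. hardy_coeff f n - hardy_coeff g n)"
      unfolding minus_hardy_def hardy_coeff_linear by simp
    then have "c f - c g = c (f - g)"
      by (simp add: seq_inject[symmetric] seq_c minus_ell2.rep_eq)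
    then show ?thesis
      by (simp add: norm_ell2_def norm_hardy_def inner_ell2_def inner_hardy_def seq_c)
  qed
  have "Cauchy (\<lambda>n. c (X n))"
    using X by (simp add: Cauchy_iff norm_c)
  then obtain L where L: "(\<lambda>n. c (X n)) \<longlonglongrightarrow> L"
    unfolding Cauchy_convergent_iff convergent_def by blast
  obtain f where "hardy_coeff f = seq L"
    using ex_hardy_coeff[OF square_summable_seq] by blast
  then have "c f = L" by (simp add: seq_inject[symmetric] seq_c)
  from L[folded this] have "X \<longlonglongrightarrow> f" by (simp add: LIMSEQ_iff norm_c)
  then show "convergent X" by (rule convergentI)
qed


section \<open>Operators on closed subspaces\<close>

text \<open>
  A Hilbert space is a closed complex subspace \<open>S\<close> of a type of class \<open>complex_hilbert\<close>
  (possibly \<open>UNIV\<close>). An operator from \<open>S\<close> to \<open>R\<close> is a function on the ambient types of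
  which only the values on \<open>S\<close> matter; equality of operators is equality on \<open>S\<close>, and
  restriction to a subspace needs no notation.
\<close>

definition csubspace :: "'a::complex_inner set \<Rightarrow> bool" where
  "csubspace S \<longleftrightarrow> 0 \<in> S \<and> (\<forall>x\<in>S. \<forall>y\<in>S. x + y \<in> S) \<and> (\<forall>a. \<forall>x\<in>S. a *\<^sub>C x \<in> S)"

definition closed_csubspace :: "'a::complex_hilbert set \<Rightarrow> bool" where
  "closed_csubspace S \<longleftrightarrow> csubspace S \<and> closed S"

definition bounded_op ::
  "'a::complex_hilbert set \<Rightarrow> 'b::complex_hilbert set \<Rightarrow> ('a \<Rightarrow> 'b) \<Rightarrow> bool" where
  "bounded_op S R A \<longleftrightarrow>
     (\<forall>x\<in>S. A x \<in> R) \<and>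
     (\<forall>x\<in>S. \<forall>y\<in>S. A (x + y) = A x + A y) \<and>
     (\<forall>a. \<forall>x\<in>S. A (a *\<^sub>C x) = a *\<^sub>C A x) \<and>
     (\<exists>K. \<forall>x\<in>S. norm (A x) \<le> K * norm x)"

text \<open>
  For a bounded operator \<open>A\<close> from \<open>S\<close> to \<open>R\<close> and \<open>y \<in> R\<close>, the vector \<open>adj S A y\<close> is the
  value of the Hilbert space adjoint at \<open>y\<close>; the codomain \<open>R\<close> does not enter the formula.
\<close>

definition adj ::
  "'a::complex_hilbert set \<Rightarrow> ('a \<Rightarrow> 'b::complex_hilbert) \<Rightarrow> 'b \<Rightarrow> 'a" where
  "adj S A y = (THE x. x \<in> S \<and> (\<forall>u\<in>S. cinner (A u) y = cinner u x))"

definition contraction_op :: "'a::complex_hilbert set \<Rightarrow> ('a \<Rightarrow> 'a) \<Rightarrow> bool" where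
  "contraction_op S A \<longleftrightarrow> bounded_op S S A \<and> (\<forall>x\<in>S. norm (A x) \<le> norm x)"

definition isometry_op ::
  "'a::complex_hilbert set \<Rightarrow> 'b::complex_hilbert set \<Rightarrow> ('a \<Rightarrow> 'b) \<Rightarrow> bool" where
  "isometry_op S R V \<longleftrightarrow> bounded_op S R V \<and> (\<forall>x\<in>S. norm (V x) = norm x)"

definition coisometry_op ::
  "'a::complex_hilbert set \<Rightarrow> 'b::complex_hilbert set \<Rightarrow> ('a \<Rightarrow> 'b) \<Rightarrow> bool" where
  "coisometry_op S R A \<longleftrightarrow> bounded_op S R A \<and> isometry_op R S (adj S A)"

definition unitary_op ::
  "'a::complex_hilbert set \<Rightarrow> 'b::complex_hilbert set \<Rightarrow> ('a \<Rightarrow> 'b) \<Rightarrow> bool" where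
  "unitary_op S R U \<longleftrightarrow> bounded_op S R U \<and>
     (\<forall>x\<in>S. adj S U (U x) = x) \<and> (\<forall>y\<in>R. U (adj S U y) = y)"

definition projection_op :: "'a::complex_hilbert set \<Rightarrow> ('a \<Rightarrow> 'a) \<Rightarrow> bool" where
  "projection_op S P \<longleftrightarrow> bounded_op S S P \<and> (\<forall>x\<in>S. P (P x) = P x \<and> adj S P x = P x)"

definition perp :: "('a::complex_hilbert \<Rightarrow> 'a) \<Rightarrow> 'a \<Rightarrow> 'a" where
  "perp P x = x - P x"

definition positive_op :: "'a::complex_hilbert set \<Rightarrow> ('a \<Rightarrow> 'a) \<Rightarrow> bool" where
  "positive_op S Q \<longleftrightarrow> bounded_op S S Q \<and> (\<forall>x\<in>S. cinner (Q x) x \<in> \<real>\<^sub>\<ge>\<^sub>0)"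

text \<open>The choice is unique on \<open>S\<close>; \<open>SOME\<close> absorbs the arbitrary values off \<open>S\<close>.\<close>

definition op_sqrt :: "'a::complex_hilbert set \<Rightarrow> ('a \<Rightarrow> 'a) \<Rightarrow> 'a \<Rightarrow> 'a" where
  "op_sqrt S Q = (SOME R. positive_op S R \<and> (\<forall>x\<in>S. R (R x) = Q x))"

definition defect_op :: "'a::complex_hilbert set \<Rightarrow> ('a \<Rightarrow> 'a) \<Rightarrow> 'a \<Rightarrow> 'a" where
  "defect_op S A = op_sqrt S (\<lambda>x. x - adj S A (A x))"

definition defect_space :: "'a::complex_hilbert set \<Rightarrow> ('a \<Rightarrow> 'a) \<Rightarrow> 'a set" where
  "defect_space S A = closure (defect_op S A ` S)"

definition pure_isometry :: "'a::complex_hilbert set \<Rightarrow> ('a \<Rightarrow> 'a) \<Rightarrow> bool" where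
  "pure_isometry S V \<longleftrightarrow> isometry_op S S V \<and>
     (\<forall>x\<in>S. (\<lambda>k. (adj S V ^^ k) x) \<longlonglongrightarrow> 0)"

definition pure_coisometry :: "'a::complex_hilbert set \<Rightarrow> ('a \<Rightarrow> 'a) \<Rightarrow> bool" where
  "pure_coisometry S A \<longleftrightarrow> bounded_op S S A \<and> pure_isometry S (adj S A)"

definition reducing_subspace ::
  "'a::complex_hilbert set \<Rightarrow> 'a set \<Rightarrow> ('a \<Rightarrow> 'a) \<Rightarrow> bool" where
  "reducing_subspace S M A \<longleftrightarrow> closed_csubspace M \<and> M \<subseteq> S \<and>
     (\<forall>x\<in>M. A x \<in> M \<and> adj S A x \<in> M)"

definition orthogonal_decomposition ::
  "'a::complex_hilbert set \<Rightarrow> 'a set \<Rightarrow> 'a set \<Rightarrow> bool" where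
  "orthogonal_decomposition S M N \<longleftrightarrow> closed_csubspace M \<and> closed_csubspace N \<and>
     (\<forall>x\<in>M. \<forall>y\<in>N. cinner x y = 0) \<and> S = {x + y | x y. x \<in> M \<and> y \<in> N}"

definition orthonormal_basis :: "'a::complex_hilbert set \<Rightarrow> 'a set \<Rightarrow> bool" where
  "orthonormal_basis S B \<longleftrightarrow> B \<subseteq> S \<and> (\<forall>b\<in>B. norm b = 1) \<and>
     (\<forall>b\<in>B. \<forall>c\<in>B. b \<noteq> c \<longrightarrow> cinner b c = 0) \<and> closure (csubspace hull B) = S"

definition same_hilbert_dim ::
  "'a::complex_hilbert set \<Rightarrow> 'b::complex_hilbert set \<Rightarrow> bool" where
  "same_hilbert_dim S R \<longleftrightarrow>
     (\<exists>B C. orthonormal_basis S B \<and> orthonormal_basis R C \<and> B \<approx> C)"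

section \<open>Operator tuples\<close>

text \<open>An \<open>n\<close>-tuple is a function on \<open>nat\<close> of which the values at \<open>1, \<dots>, n\<close> matter.\<close>

text \<open>\<open>op_prod A n = A 1 \<circ> \<dots> \<circ> A n\<close> and \<open>op_prod_rev A n = A n \<circ> \<dots> \<circ> A 1\<close>.\<close>

primrec op_prod :: "(nat \<Rightarrow> 'a \<Rightarrow> 'a) \<Rightarrow> nat \<Rightarrow> 'a \<Rightarrow> 'a" where
  "op_prod A 0 = id"
| "op_prod A (Suc n) = op_prod A n \<circ> A (Suc n)"

primrec op_prod_rev :: "(nat \<Rightarrow> 'a \<Rightarrow> 'a) \<Rightarrow> nat \<Rightarrow> 'a \<Rightarrow> 'a" where
  "op_prod_rev A 0 = id"
| "op_prod_rev A (Suc n) = A (Suc n) \<circ> op_prod_rev A n"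

definition commuting_tuple :: "'a set \<Rightarrow> nat \<Rightarrow> (nat \<Rightarrow> 'a \<Rightarrow> 'a) \<Rightarrow> bool" where
  "commuting_tuple S n A \<longleftrightarrow>
     (\<forall>i\<in>{1..n}. \<forall>j\<in>{1..n}. \<forall>x\<in>S. A i (A j x) = A j (A i x))"

definition coisometric_tuple ::
  "'a::complex_hilbert set \<Rightarrow> nat \<Rightarrow> (nat \<Rightarrow> 'a \<Rightarrow> 'a) \<Rightarrow> bool" where
  "coisometric_tuple S n A \<longleftrightarrow>
     (\<forall>i\<in>{1..n}. coisometry_op S S (A i)) \<and> commuting_tuple S n A"

definition pure_coisometric_tuple ::
  "'a::complex_hilbert set \<Rightarrow> nat \<Rightarrow> (nat \<Rightarrow> 'a \<Rightarrow> 'a) \<Rightarrow> bool" where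
  "pure_coisometric_tuple S n A \<longleftrightarrow>
     coisometric_tuple S n A \<and> pure_coisometry S (op_prod A n)"

definition unitary_tuple ::
  "'a::complex_hilbert set \<Rightarrow> nat \<Rightarrow> (nat \<Rightarrow> 'a \<Rightarrow> 'a) \<Rightarrow> bool" where
  "unitary_tuple S n A \<longleftrightarrow> (\<forall>i\<in>{1..n}. unitary_op S S (A i)) \<and> commuting_tuple S n A"

definition unitarily_equivalent ::
  "nat \<Rightarrow> 'a::complex_hilbert set \<Rightarrow> (nat \<Rightarrow> 'a \<Rightarrow> 'a) \<Rightarrow>
   'b::complex_hilbert set \<Rightarrow> (nat \<Rightarrow> 'b \<Rightarrow> 'b) \<Rightarrow> bool" where
  "unitarily_equivalent n S A R B \<longleftrightarrow>
     (\<exists>W. unitary_op S R W \<and> (\<forall>i\<in>{1..n}. \<forall>x\<in>S. W (A i x) = B i (W x)))"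

section \<open>Hardy space operators\<close>

definition H2 :: "'a::complex_hilbert set \<Rightarrow> 'a hardy set" where
  "H2 E = {f. \<forall>z. hardy_fun f z \<in> E}"

definition mult_z :: "'a::complex_hilbert hardy \<Rightarrow> 'a hardy" where
  "mult_z f = Abs_hardy (\<lambda>z. z *\<^sub>C hardy_fun f z)"

definition pointwise_op :: "('a::complex_hilbert \<Rightarrow> 'a) \<Rightarrow> 'a hardy \<Rightarrow> 'a hardy" where
  "pointwise_op A f = Abs_hardy (\<lambda>z. A (hardy_fun f z))"

text \<open>
  The operator on \<open>H2 E\<close> with symbol \<open>A + B * cnj z\<close>, for bounded operators \<open>A\<close> and \<open>B\<close> on
  \<open>E\<close>: multiplication by \<open>cnj z\<close> followed by projection onto \<open>H2 E\<close> is the adjoint of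
  \<open>mult_z\<close> on \<open>H2 E\<close>.
\<close>

definition toeplitz ::
  "'a::complex_hilbert set \<Rightarrow> ('a \<Rightarrow> 'a) \<Rightarrow> ('a \<Rightarrow> 'a) \<Rightarrow> 'a hardy \<Rightarrow> 'a hardy" where
  "toeplitz E A B f = pointwise_op A f + pointwise_op B (adj (H2 E) mult_z f)"

section \<open>The block operator matrices\<close>

definition ell2_in :: "'a::complex_hilbert set \<Rightarrow> 'a ell2 set" where
  "ell2_in E = {x. \<forall>k. seq x k \<in> E}"

text \<open>
  The matrix acts on \<open>H \<oplus> E \<oplus> E \<oplus> \<dots>\<close>, where \<open>E\<close> is the space on which \<open>U\<close> and \<open>P\<close> act
  and \<open>D\<close> maps \<open>E\<close> to \<open>H\<close>. Its first row is \<open>T, D U P, 0, \<dots>\<close>; every later row has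
  \<open>U (I - P)\<close> on the diagonal and \<open>U P\<close> right of it.
\<close>

definition block_op ::
  "('a::complex_hilbert \<Rightarrow> 'a) \<Rightarrow> ('a \<Rightarrow> 'a) \<Rightarrow> ('a \<Rightarrow> 'a) \<Rightarrow> ('a \<Rightarrow> 'a) \<Rightarrow>
   'a \<times> 'a ell2 \<Rightarrow> 'a \<times> 'a ell2" where
  "block_op D T U P = (\<lambda>(h, x).
     (T h + D (U (P (seq x 0))),
      Abs_ell2 (\<lambda>k. U (perp P (seq x k)) + U (P (seq x (Suc k))))))"

end

theory Submission
  imports Defs
begin

text \<open>
  Let \<open>V\<^sub>i\<close> be the adjoint of \<open>Z\<^sub>i\<close>, and write \<open>D\<close> for the defect operator of \<open>T\<^sup>*\<close>. The
  formula for \<open>D U\<^sub>i P\<^sub>i U\<^sub>i\<^sup>* D\<close> says that \<open>Z\<^sub>i V\<^sub>i\<close> is the identity in the first component; in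
  the others it is so because \<open>U\<^sub>i\<close> is unitary and \<open>P\<^sub>i\<close> is a projection. Hence the \<open>V\<^sub>i\<close> are
  isometries. To see that they commute, prolong a vector \<open>(h, x)\<close> to a two-sided sequence by
  putting \<open>D h, D T\<^sup>* h, D T\<^sup>*\<^sup>2 h, \<dots>\<close> to the left of \<open>x\<close>. The formula for \<open>D T\<^sub>i\<^sup>*\<close> says that
  \<open>V\<^sub>i\<close> then acts as the operator pencil \<open>A\<^sub>i + B\<^sub>i s\<close> in the bilateral shift \<open>s\<close>, where
  \<open>A\<^sub>i = (I - P\<^sub>i) U\<^sub>i\<^sup>*\<close> and \<open>B\<^sub>i = P\<^sub>i U\<^sub>i\<^sup>*\<close> (\<open>extension_V\<close>). The \<open>A\<^sub>i\<close> commute, the \<open>B\<^sub>i\<close> commute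
  and the sums \<open>A\<^sub>i + B\<^sub>i = U\<^sub>i\<^sup>*\<close> commute, so the pencils commute.

  The decomposition and the model exist for every commuting tuple of isometries \<open>V\<^sub>i\<close> with
  adjoints \<open>Z\<^sub>i\<close>. Let \<open>V\<close> and \<open>Z\<close> be the products, \<open>L\<close> the kernel of \<open>Z\<close>, and \<open>Q = I - V Z\<close> the
  projection onto \<open>L\<close>. The pure part is the closure of the set of all vectors annihilated by
  a power of \<open>Z\<close>; on its orthogonal complement \<open>V\<^sub>i Z\<^sub>i = I\<close>. Sending \<open>x\<close> to the power series
  with the coefficients \<open>Q Z\<^sup>k x\<close> is a unitary from the pure part onto \<open>H\<^sup>2(L)\<close>
  (\<open>model_unitary\<close>), and takes \<open>Z\<close> to the backward shift. For \<open>l\<close> in \<open>L\<close> the vector \<open>V\<^sub>i l\<close> lies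
  in \<open>L + V L\<close>, which leads to the unitaries and projections on \<open>L\<close> found by Berger, Coburn
  and Lebow, and to the Toeplitz operators in the statement (\<open>bcl_model\<close>). As \<open>Q\<close> is a
  projection, \<open>L\<close> is also the defect space of \<open>Z\<close> (\<open>defect_space_ZZ\<close>).

  It remains to identify \<open>L\<close> with the defect space of \<open>T\<close>. The summation condition says that
  certain projections, conjugates of the \<open>P\<^sub>i\<close>, add up to the identity. They are then mutually
  orthogonal, and the product of all pencils collapses to \<open>U\<^sup>* s\<close>, where \<open>U\<close> is the product of
  the \<open>U\<^sub>i\<close> (\<open>pencil_product\<close>). So \<open>V (h, x) = (T\<^sup>* h, U\<^sup>* D h, U\<^sup>* x\<^sub>0, U\<^sup>* x\<^sub>1, \<dots>)\<close>; the range
  of \<open>V\<close> together with the vectors \<open>(h, 0)\<close> spans a dense subspace, and the vectors \<open>Q (h, 0)\<close>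
  are dense in \<open>L\<close>. Because \<open>\<parallel>Q (h, 0)\<parallel>\<^sup>2 = \<parallel>h\<parallel>\<^sup>2 - \<parallel>T h\<parallel>\<^sup>2 = \<parallel>D\<^sub>T h\<parallel>\<^sup>2\<close>, the map
  \<open>Q (h, 0) \<mapsto> D\<^sub>T h\<close> extends to a unitary from \<open>L\<close> onto the defect space of \<open>T\<close>
  (\<open>ex_unitary_L_defect_space\<close>), along which dimension and model are transported.

  The operator theory underneath consists of the projection theorem, the Riesz representation
  of functionals (for the existence of adjoints), the binomial series for the square root of
  a positive operator (for the existence of defect operators), and Zorn's lemma (for
  orthonormal bases).
\<close>

section \<open>Inner products and closed subspaces\<close>

lemma cinner_add_right: "cinner x (y + z) = cinner x y + cinner x z"
  for x :: "'a::complex_inner"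
  by (metis cinner_add_left cinner_commute complex_cnj_add)

lemma cinner_scaleC_right: "cinner x (a *\<^sub>C y) = cnj a * cinner x y"
  for x :: "'a::complex_inner"
  by (metis cinner_scaleC_left cinner_commute complex_cnj_mult)

lemma cinner_diff_left: "cinner (x - y) z = cinner x z - cinner y z"
  for x :: "'a::complex_inner"
  using cinner_add_left[of "x - y" y z] by simp

lemma cinner_diff_right: "cinner x (y - z) = cinner x y - cinner x z"
  for x :: "'a::complex_inner"
  using cinner_add_right[of x "y - z" z] by simp

lemma cinner_zero_right: "cinner x 0 = 0" for x :: "'a::complex_inner"
  using cinner_diff_right[of x x x] by simp

lemma cinner_self_eq_0: "cinner x x = 0 \<longleftrightarrow> x = 0" for x :: "'a::complex_inner"
  by (simp add: cinner_self)

lemma cinner_eq_0_commute: "cinner x y = 0 \<longleftrightarrow> cinner y x = 0" for x :: "'a::complex_inner"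
  by (metis cinner_commute complex_cnj_zero)

lemma norm_eq_cinner: "cinner x x = cinner y y \<Longrightarrow> norm x = norm y"
  for x :: "'a::complex_inner" and y :: "'b::complex_inner"
  unfolding cinner_self of_real_eq_iff by (simp add: power2_eq_iff_nonneg)

lemma scaleC_zero_left: "0 *\<^sub>C x = 0" for x :: "'a::complex_inner"
  using scaleC_of_real[of 0 x] by simp

lemma bounded_linear_cinner_right: "bounded_linear (\<lambda>y::'a::complex_inner. cinner x y)"
proof -
  have "bounded_linear (\<lambda>y. cnj (cinner y x))"
    using bounded_linear_compose[OF bounded_linear_cnj bounded_linear_cinner_left] .
  then show ?thesis
    by (simp add: cinner_commute[symmetric])
qed

lemmas tendsto_scaleC = bounded_linear.tendsto[OF bounded_linear_scaleC]

text \<open>Polarization: the quadratic form determines the sesquilinear form.\<close>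

lemma polarization_eq:
  fixes f :: "'a::complex_inner \<Rightarrow> 'a \<Rightarrow> complex"
  assumes add: "\<And>x y z. f (x + y) z = f x z + f y z" "\<And>x y z. f x (y + z) = f x y + f x z"
    and scale: "\<And>a x y. f (a *\<^sub>C x) y = a * f x y" "\<And>a x y. f x (a *\<^sub>C y) = cnj a * f x y"
  shows "4 * f x y = f (x + y) (x + y) - f (x + (-1) *\<^sub>C y) (x + (-1) *\<^sub>C y)
    + \<i> * f (x + \<i> *\<^sub>C y) (x + \<i> *\<^sub>C y) - \<i> * f (x + (-\<i>) *\<^sub>C y) (x + (-\<i>) *\<^sub>C y)"
  unfolding add scale by (simp add: algebra_simps)

lemma csubspace_zero: "csubspace S \<Longrightarrow> 0 \<in> S"
  and csubspace_add: "csubspace S \<Longrightarrow> x \<in> S \<Longrightarrow> y \<in> S \<Longrightarrow> x + y \<in> S"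
  and csubspace_scaleC: "csubspace S \<Longrightarrow> x \<in> S \<Longrightarrow> a *\<^sub>C x \<in> S"
  by (simp_all add: csubspace_def)

lemma csubspace_scaleR: "csubspace S \<Longrightarrow> x \<in> S \<Longrightarrow> r *\<^sub>R x \<in> S"
  by (metis csubspace_scaleC scaleC_of_real)

lemma csubspace_uminus: "csubspace S \<Longrightarrow> x \<in> S \<Longrightarrow> - x \<in> S"
  using csubspace_scaleR[of S x "-1"] by simp

lemma csubspace_diff: "csubspace S \<Longrightarrow> x \<in> S \<Longrightarrow> y \<in> S \<Longrightarrow> x - y \<in> S"
  using csubspace_add[of S x "- y"] csubspace_uminus[of S y] by simp

lemma csubspace_sum: "csubspace S \<Longrightarrow> (\<And>i. i \<in> I \<Longrightarrow> f i \<in> S) \<Longrightarrow> sum f I \<in> S"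
  by (induction I rule: infinite_finite_induct) (auto simp: csubspace_zero csubspace_add)

lemma csubspace_UNIV [simp]: "csubspace UNIV"
  by (simp add: csubspace_def)

lemma csubspace_closure: "csubspace S \<Longrightarrow> csubspace (closure S)"
proof -
  assume S: "csubspace S"
  show ?thesis
    unfolding csubspace_def
  proof (intro conjI ballI allI)
    show "0 \<in> closure S" using csubspace_zero[OF S] closure_subset by blast
  next
    fix x y assume "x \<in> closure S" "y \<in> closure S"
    then obtain f g where "\<forall>n. f n \<in> S" "f \<longlonglongrightarrow> x" "\<forall>n. g n \<in> S" "g \<longlonglongrightarrow> y"
      unfolding closure_sequential by blast
    then show "x + y \<in> closure S"
      unfolding closure_sequential
      by (intro exI[of _ "\<lambda>n. f n + g n"]) (auto intro: csubspace_add[OF S] tendsto_add)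
  next
    fix a x assume "x \<in> closure S"
    then obtain f where "\<forall>n. f n \<in> S" "f \<longlonglongrightarrow> x"
      unfolding closure_sequential by blast
    then show "a *\<^sub>C x \<in> closure S"
      unfolding closure_sequential
      by (intro exI[of _ "\<lambda>n. a *\<^sub>C f n"]) (auto intro: csubspace_scaleC[OF S] tendsto_scaleC)
  qed
qed

lemma closed_csubspace_closure: "csubspace S \<Longrightarrow> closed_csubspace (closure S)"
  by (simp add: closed_csubspace_def csubspace_closure)

lemma closed_csubspace_UNIV [simp]: "closed_csubspace UNIV"
  by (simp add: closed_csubspace_def)

lemma closed_csubspaceD: "closed_csubspace S \<Longrightarrow> csubspace S" "closed_csubspace S \<Longrightarrow> closed S"
  by (simp_all add: closed_csubspace_def)

lemma closed_limit:
  "closed S \<Longrightarrow> (\<And>n. f n \<in> S) \<Longrightarrow> f \<longlonglongrightarrow> x \<Longrightarrow> x \<in> S"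
  for f :: "nat \<Rightarrow> 'a::metric_space"
  using closed_sequentially by blast

lemma closed_sums:
  assumes "closed_csubspace S" "\<And>n. f n \<in> S" "f sums x"
  shows "x \<in> S"
  using assms(3) unfolding sums_def
  by (rule closed_limit[rotated 2])
     (use assms(1,2) in \<open>auto simp: closed_csubspace_def intro!: csubspace_sum\<close>)

text \<open>
  A sequence in \<open>M\<close> whose distance to \<open>x\<close> tends to the infimum is Cauchy by the parallelogram
  law; its limit is the orthogonal projection of \<open>x\<close>.
\<close>

theorem ex_orthogonal_projection:
  fixes x :: "'a::complex_hilbert"
  assumes M: "closed_csubspace M"
  shows "\<exists>y\<in>M. \<forall>m\<in>M. cinner (x - y) m = 0"
proof -
  note Ms = closed_csubspaceD(1)[OF M]
  define d where "d = (INF y\<in>M. (norm (x - y))\<^sup>2)"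
  have ne: "M \<noteq> {}" using csubspace_zero[OF Ms] by blast
  have bdd: "bdd_below ((\<lambda>y. (norm (x - y))\<^sup>2) ` M)"
    by (rule bdd_belowI[of _ 0]) auto
  have lower: "d \<le> (norm (x - y))\<^sup>2" if "y \<in> M" for y
    unfolding d_def by (rule cINF_lower[OF bdd that])
  have "\<exists>y\<in>M. (norm (x - y))\<^sup>2 < d + 1 / Suc k" for k
    using cInf_lessD[of "(\<lambda>y. (norm (x - y))\<^sup>2) ` M" "d + 1 / Suc k"] ne
    unfolding d_def by auto
  then obtain f where fM: "\<And>k. f k \<in> M" and f: "\<And>k. (norm (x - f k))\<^sup>2 < d + 1 / Suc k"
    by metis
  have close: "(norm (f j - f k))\<^sup>2 \<le> 2 / Suc j + 2 / Suc k" for j k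
  proof -
    have mid: "(1/2) *\<^sub>R (f j + f k) \<in> M"
      by (intro csubspace_scaleR csubspace_add Ms fM)
    have "(norm (f j - f k))\<^sup>2 =
        2 * (norm (x - f j))\<^sup>2 + 2 * (norm (x - f k))\<^sup>2 - 4 * (norm (x - (1/2) *\<^sub>R (f j + f k)))\<^sup>2"
      unfolding power2_norm_eq_inner
      by (simp add: inner_diff_left inner_diff_right inner_add_left inner_add_right inner_commute
          algebra_simps)
    moreover have "2 / real (Suc i) = 2 * (1 / real (Suc i))" for i by simp
    ultimately show ?thesis using lower[OF mid] f[of j] f[of k] by (smt (verit))
  qed
  have "Cauchy f"
  proof (rule CauchyI)
    fix e :: real assume e: "0 < e"
    obtain N where N: "4 / e\<^sup>2 < real N" using reals_Archimedean2 by blast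
    have "norm (f j - f k) < e" if "j \<ge> N" "k \<ge> N" for j k
    proof -
      have "N > 0" using N e by (metis gr0I of_nat_0 not_less_iff_gr_or_eq divide_pos_pos zero_less_numeral zero_less_power order.strict_trans)
      have "2 / real (Suc j) < 2 / real N" "2 / real (Suc k) < 2 / real N"
        using that \<open>N > 0\<close> by (auto intro!: divide_strict_left_mono)
      moreover have "4 / real N < e\<^sup>2"
        using N e \<open>N > 0\<close> by (simp add: field_simps)
      ultimately have "(norm (f j - f k))\<^sup>2 < e\<^sup>2"
        using close[of j k] by simp
      then show ?thesis using e power2_less_imp_less by fastforce
    qed
    then show "\<exists>N. \<forall>m\<ge>N. \<forall>n\<ge>N. norm (f m - f n) < e" by blast
  qed
  then obtain y where y: "f \<longlonglongrightarrow> y"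
    unfolding Cauchy_convergent_iff convergent_def by blast
  have yM: "y \<in> M" using closed_limit[OF closed_csubspaceD(2)[OF M] fM y] .
  have "(\<lambda>k. (norm (x - f k))\<^sup>2) \<longlonglongrightarrow> (norm (x - y))\<^sup>2"
    by (intro tendsto_intros y)
  moreover have "(\<lambda>k. d + 1 / real (Suc k)) \<longlonglongrightarrow> d"
    using tendsto_add[OF tendsto_const[of d] LIMSEQ_Suc[OF lim_1_over_n]] by simp
  ultimately have yd: "(norm (x - y))\<^sup>2 \<le> d"
    by (rule LIMSEQ_le) (use f less_imp_le in blast)
  have "cinner (x - y) m = 0" if m: "m \<in> M" for m
  proof (rule ccontr)
    define c where "c = cinner (x - y) m"
    assume "cinner (x - y) m \<noteq> 0"
    then have c: "c \<noteq> 0" and m0: "m \<noteq> 0" by (auto simp: c_def cinner_zero_right)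
    \<comment> \<open>Moving from \<open>y\<close> in the direction \<open>m\<close> by this amount decreases the distance to \<open>x\<close>.\<close>
    define t where "t = c / complex_of_real ((norm m)\<^sup>2)"
    define w where "w = x - y"
    have "y + t *\<^sub>C m \<in> M" by (intro csubspace_add csubspace_scaleC Ms yM m)
    from lower[OF this] yd have le: "(norm w)\<^sup>2 \<le> (norm (w - t *\<^sub>C m))\<^sup>2"
      unfolding w_def diff_diff_eq by (rule order_trans[rotated])
    have "complex_of_real ((norm (w - t *\<^sub>C m))\<^sup>2) = cinner (w - t *\<^sub>C m) (w - t *\<^sub>C m)"
      by (simp add: cinner_self)
    also have "\<dots> = cinner w w - cnj t * c - t * cnj c + t * cnj t * cinner m m"
      unfolding c_def w_def[symmetric] cinner_commute[of w m, symmetric]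
      by (simp add: cinner_diff_left cinner_diff_right cinner_scaleC_left cinner_scaleC_right
          algebra_simps cinner_commute[of m w])
    also have "\<dots> = complex_of_real ((norm w)\<^sup>2 - (cmod c)\<^sup>2 / (norm m)\<^sup>2)"
      using m0 by (simp add: t_def cinner_self complex_norm_square[symmetric] field_simps
          del: of_real_power)
    finally have "(norm (w - t *\<^sub>C m))\<^sup>2 = (norm w)\<^sup>2 - (cmod c)\<^sup>2 / (norm m)\<^sup>2"
      unfolding of_real_eq_iff .
    moreover have "0 < (cmod c)\<^sup>2 / (norm m)\<^sup>2" using c m0 by simp
    ultimately show False using le by linarith
  qed
  then show ?thesis using yM by blast
qed

text \<open>Every bounded linear functional vanishes on the complement of a line, hence is an inner
  product with a vector of that line.\<close>

theorem riesz_representation: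
  fixes \<phi> :: "'a::complex_hilbert \<Rightarrow> complex"
  assumes S: "closed_csubspace S"
    and add: "\<And>x y. x \<in> S \<Longrightarrow> y \<in> S \<Longrightarrow> \<phi> (x + y) = \<phi> x + \<phi> y"
    and scale: "\<And>a x. x \<in> S \<Longrightarrow> \<phi> (a *\<^sub>C x) = a * \<phi> x"
    and bound: "\<And>x. x \<in> S \<Longrightarrow> cmod (\<phi> x) \<le> c * norm x"
  shows "\<exists>y\<in>S. \<forall>x\<in>S. \<phi> x = cinner x y"
proof -
  note Ss = closed_csubspaceD(1)[OF S]
  have diff: "\<phi> (x - y) = \<phi> x - \<phi> y" if "x \<in> S" "y \<in> S" for x y
    using add[of "x - y" y] that csubspace_diff[OF Ss] by simp
  have zero: "\<phi> 0 = 0" using scale[OF csubspace_zero[OF Ss], of 0] by (simp add: scaleC_zero_left)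
  define N where "N = {x\<in>S. \<phi> x = 0}"
  have "closed N"
    unfolding closed_sequential_limits
  proof (intro allI impI, elim conjE)
    fix f x assume f: "\<forall>n. f n \<in> N" "f \<longlonglongrightarrow> x"
    then have xS: "x \<in> S"
      using closed_limit[OF closed_csubspaceD(2)[OF S], of f x] by (auto simp: N_def)
    have "cmod (\<phi> x) \<le> c * norm (x - f n)" for n
      using f(1) bound[of "x - f n"] diff[of x "f n"] xS csubspace_diff[OF Ss] by (auto simp: N_def)
    moreover have "(\<lambda>n. c * norm (x - f n)) \<longlonglongrightarrow> c * norm (x - x)"
      by (intro tendsto_intros f(2))
    ultimately have "cmod (\<phi> x) \<le> 0"
      by (intro tendsto_lowerbound[of "\<lambda>n. c * norm (x - f n)" 0 sequentially]) auto
    then show "x \<in> N" using xS by (simp add: N_def)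
  qed
  moreover have "csubspace N"
    using Ss zero by (auto simp: csubspace_def N_def add scale)
  ultimately have N: "closed_csubspace N" by (simp add: closed_csubspace_def)
  show ?thesis
  proof (cases "N = S")
    case True
    then show ?thesis
      using csubspace_zero[OF Ss] by (intro bexI[of _ 0]) (auto simp: N_def cinner_zero_right)
  next
    case False
    then obtain u where u: "u \<in> S" "\<phi> u \<noteq> 0" by (auto simp: N_def)
    obtain p where p: "p \<in> N" "\<forall>m\<in>N. cinner (u - p) m = 0"
      using ex_orthogonal_projection[OF N] by blast
    define e where "e = u - p"
    have e: "e \<in> S" "\<phi> e \<noteq> 0" "\<And>m. m \<in> N \<Longrightarrow> cinner m e = 0"
      using u p csubspace_diff[OF Ss]
      by (auto simp: e_def N_def diff cinner_eq_0_commute[of _ "u - p"])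
    have e0: "cinner e e \<noteq> 0" using e(2) zero by (auto simp: cinner_self_eq_0)
    define y where "y = cnj (\<phi> e / cinner e e) *\<^sub>C e"
    have "\<phi> x = cinner x y" if x: "x \<in> S" for x
    proof -
      have "x - (\<phi> x / \<phi> e) *\<^sub>C e \<in> N"
        using x e by (simp add: N_def diff scale csubspace_scaleC[OF Ss] csubspace_diff[OF Ss])
      from e(3)[OF this] have "cinner x e = \<phi> x / \<phi> e * cinner e e"
        by (simp add: cinner_diff_left cinner_scaleC_left)
      then show ?thesis using e(2) e0 by (simp add: y_def cinner_scaleC_right)
    qed
    moreover have "y \<in> S" by (simp add: y_def csubspace_scaleC[OF Ss] e)
    ultimately show ?thesis by blast
  qed
qed

section \<open>Adjoint pairs of operators\<close>

text \<open>
  Between closed subspaces, two maps in this relation are bounded operators adjoint to each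
  other; linearity and uniqueness come for free, and all adjoints below are computed by
  exhibiting such a pair.
\<close>

definition adjoint_pair ::
  "'a::complex_hilbert set \<Rightarrow> 'b::complex_hilbert set \<Rightarrow> ('a \<Rightarrow> 'b) \<Rightarrow> ('b \<Rightarrow> 'a) \<Rightarrow> bool" where
  "adjoint_pair S R A B \<longleftrightarrow> (\<forall>x\<in>S. A x \<in> R) \<and> (\<forall>y\<in>R. B y \<in> S) \<and>
     (\<forall>x\<in>S. \<forall>y\<in>R. cinner (A x) y = cinner x (B y))"

lemma adjoint_pairI:
  "(\<And>x. x \<in> S \<Longrightarrow> A x \<in> R) \<Longrightarrow> (\<And>y. y \<in> R \<Longrightarrow> B y \<in> S) \<Longrightarrow>
    (\<And>x y. x \<in> S \<Longrightarrow> y \<in> R \<Longrightarrow> cinner (A x) y = cinner x (B y)) \<Longrightarrow> adjoint_pair S R A B"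
  by (simp add: adjoint_pair_def)

lemma adjoint_pair_in1: "adjoint_pair S R A B \<Longrightarrow> x \<in> S \<Longrightarrow> A x \<in> R"
  and adjoint_pair_in2: "adjoint_pair S R A B \<Longrightarrow> y \<in> R \<Longrightarrow> B y \<in> S"
  and adjoint_pair_eq: "adjoint_pair S R A B \<Longrightarrow> x \<in> S \<Longrightarrow> y \<in> R \<Longrightarrow> cinner (A x) y = cinner x (B y)"
  by (simp_all add: adjoint_pair_def)

lemma adjoint_pair_sym: "adjoint_pair S R A B \<Longrightarrow> adjoint_pair R S B A"
  unfolding adjoint_pair_def by (metis cinner_commute)

lemma adjoint_pair_comp:
  "adjoint_pair S R A B \<Longrightarrow> adjoint_pair R Q C D \<Longrightarrow> adjoint_pair S Q (\<lambda>x. C (A x)) (\<lambda>x. B (D x))"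
  by (simp add: adjoint_pair_def)

lemma adjoint_pair_cong:
  "(\<And>x. x \<in> S \<Longrightarrow> A x = A' x) \<Longrightarrow> (\<And>y. y \<in> R \<Longrightarrow> B y = B' y) \<Longrightarrow>
    adjoint_pair S R A B \<longleftrightarrow> adjoint_pair S R A' B'"
  by (simp add: adjoint_pair_def)

lemma adjoint_pair_subset:
  assumes "adjoint_pair S R A B" "S' \<subseteq> S" "R' \<subseteq> R"
    "\<And>x. x \<in> S' \<Longrightarrow> A x \<in> R'" "\<And>y. y \<in> R' \<Longrightarrow> B y \<in> S'"
  shows "adjoint_pair S' R' A B"
  using assms unfolding adjoint_pair_def by blast

lemma adjoint_pair_diff_maps:
  assumes "csubspace S" "csubspace R" "adjoint_pair S R A B" "adjoint_pair S R C D"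
  shows "adjoint_pair S R (\<lambda>x. A x - C x) (\<lambda>y. B y - D y)"
  using assms
  by (auto simp: adjoint_pair_def csubspace_diff cinner_diff_left cinner_diff_right)

lemma adjoint_pair_id: "adjoint_pair S S (\<lambda>x. x) (\<lambda>x. x)"
  by (simp add: adjoint_pair_def)

lemma cinner_eqI:
  assumes "csubspace S" "x \<in> S" "y \<in> S" "\<And>z. z \<in> S \<Longrightarrow> cinner x z = cinner y z"
  shows "x = y"
proof -
  have "cinner (x - y) (x - y) = 0"
    using assms by (simp add: cinner_diff_left csubspace_diff)
  then show ?thesis by (simp add: cinner_self_eq_0)
qed

lemma adjoint_pair_linear:
  assumes R: "csubspace R" and S: "csubspace S" and p: "adjoint_pair S R A B"
  shows adjoint_pair_add: "x \<in> S \<Longrightarrow> y \<in> S \<Longrightarrow> A (x + y) = A x + A y"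
    and adjoint_pair_diff: "x \<in> S \<Longrightarrow> y \<in> S \<Longrightarrow> A (x - y) = A x - A y"
    and adjoint_pair_scaleC: "x \<in> S \<Longrightarrow> A (a *\<^sub>C x) = a *\<^sub>C A x"
    and adjoint_pair_zero: "A 0 = 0"
proof -
  note e = adjoint_pair_eq[OF p] adjoint_pair_in1[OF p] adjoint_pair_in2[OF p]
  show "A (x + y) = A x + A y" if "x \<in> S" "y \<in> S"
    using that by (intro cinner_eqI[OF R])
      (auto simp: e cinner_add_left csubspace_add R S)
  show diff: "A (x - y) = A x - A y" if "x \<in> S" "y \<in> S" for x y
    using that by (intro cinner_eqI[OF R])
      (auto simp: e cinner_diff_left csubspace_diff R S)
  show "A (a *\<^sub>C x) = a *\<^sub>C A x" if "x \<in> S"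
    using that by (intro cinner_eqI[OF R])
      (auto simp: e cinner_scaleC_left csubspace_scaleC R S)
  show "A 0 = 0" using diff[of 0 0] csubspace_zero[OF S] by simp
qed

lemma adj_eqI:
  assumes "csubspace S" "x \<in> S" "\<And>u. u \<in> S \<Longrightarrow> cinner (A u) y = cinner u x"
  shows "adj S A y = x"
  unfolding adj_def
proof (rule the_equality)
  fix x' assume x': "x' \<in> S \<and> (\<forall>u\<in>S. cinner (A u) y = cinner u x')"
  show "x' = x"
  proof (rule cinner_eqI[OF assms(1)])
    fix z assume "z \<in> S"
    then have "cinner z x' = cinner z x" using x' assms(3) by auto
    then show "cinner x' z = cinner x z" by (metis cinner_commute)
  qed (use x' assms in auto)
qed (use assms in auto)

lemma adj_adjoint_pair:
  "csubspace S \<Longrightarrow> adjoint_pair S R A B \<Longrightarrow> y \<in> R \<Longrightarrow> adj S A y = B y"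
  by (intro adj_eqI) (auto simp: adjoint_pair_def)

lemma adj_adjoint_pair':
  "csubspace R \<Longrightarrow> adjoint_pair S R A B \<Longrightarrow> x \<in> S \<Longrightarrow> adj R B x = A x"
  by (rule adj_adjoint_pair[OF _ adjoint_pair_sym])

lemma adj_cong: "(\<And>x. x \<in> S \<Longrightarrow> A x = A' x) \<Longrightarrow> adj S A y = adj S A' y"
  unfolding adj_def by (rule arg_cong[where f=The]) auto

lemma adjoint_pair_adj:
  assumes S: "closed_csubspace S" and A: "bounded_op S R A"
  shows "adjoint_pair S R A (adj S A)"
proof -
  have "adj S A y \<in> S \<and> (\<forall>u\<in>S. cinner (A u) y = cinner u (adj S A y))" if "y \<in> R" for y
  proof -
    obtain c where c: "\<And>x. x \<in> S \<Longrightarrow> norm (A x) \<le> c * norm x"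
      using A unfolding bounded_op_def by blast
    have "\<exists>x\<in>S. \<forall>u\<in>S. cinner (A u) y = cinner u x"
    proof (rule riesz_representation[OF S])
      fix x assume "x \<in> S"
      have "cmod (cinner (A x) y) \<le> norm (A x) * norm y" by (rule norm_cinner_le)
      also have "\<dots> \<le> (c * norm x) * norm y" using c[OF \<open>x \<in> S\<close>] by (intro mult_right_mono) auto
      finally show "cmod (cinner (A x) y) \<le> (c * norm y) * norm x" by (simp add: mult_ac)
    qed (use A in \<open>auto simp: bounded_op_def cinner_add_left cinner_scaleC_left\<close>)
    then obtain x where "x \<in> S" "\<And>u. u \<in> S \<Longrightarrow> cinner (A u) y = cinner u x" by blast
    then show ?thesis using adj_eqI[OF closed_csubspaceD(1)[OF S]] by metis
  qed
  then show ?thesis using A unfolding adjoint_pair_def bounded_op_def by blast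
qed

lemma bounded_op_adjoint_pairI:
  assumes "csubspace S" "csubspace R" "adjoint_pair S R A B"
    "\<And>x. x \<in> S \<Longrightarrow> norm (A x) \<le> c * norm x"
  shows "bounded_op S R A"
  using assms adjoint_pair_add[OF assms(2,1,3)] adjoint_pair_scaleC[OF assms(2,1,3)]
    adjoint_pair_in1[OF assms(3)]
  unfolding bounded_op_def by blast

lemma norm_le_if_cinner_le:
  assumes "cmod (cinner x x) \<le> norm x * c" "0 \<le> c" shows "norm (x::'a::complex_inner) \<le> c"
proof (cases "x = 0")
  case False
  have "norm x * norm x \<le> norm x * c"
    using assms by (simp add: cinner_self power2_eq_square norm_mult)
  then show ?thesis using False by simp
qed (use assms in simp)

section \<open>Isometries, unitaries and projections\<close>

text \<open>Isometric linear maps preserve inner products, by polarization.\<close>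

lemma cinner_eq_if_norm_eq:
  fixes A :: "'a::complex_inner \<Rightarrow> 'b::complex_inner"
  assumes S: "csubspace S"
    and add: "\<And>x y. x \<in> S \<Longrightarrow> y \<in> S \<Longrightarrow> A (x + y) = A x + A y"
    and scale: "\<And>a x. x \<in> S \<Longrightarrow> A (a *\<^sub>C x) = a *\<^sub>C A x"
    and norm: "\<And>x. x \<in> S \<Longrightarrow> norm (A x) = norm x"
    and "x \<in> S" "y \<in> S"
  shows "cinner (A x) (A y) = cinner x y"
proof -
  have sq: "cinner (A x + a *\<^sub>C A y) (A x + a *\<^sub>C A y) = cinner (x + a *\<^sub>C y) (x + a *\<^sub>C y)" for a
  proof -
    have "x + a *\<^sub>C y \<in> S" using assms by (simp add: csubspace_add csubspace_scaleC)
    from norm[OF this] show ?thesis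
      using assms by (simp add: cinner_self csubspace_scaleC)
  qed
  have "4 * cinner (A x) (A y) = 4 * cinner x y"
    using sq[of 1] sq[of "-1"] sq[of "\<i>"] sq[of "-\<i>"]
    by (subst (1 2) polarization_eq)
      (simp_all add: cinner_add_left cinner_add_right cinner_scaleC_left cinner_scaleC_right scaleC_one)
  then show ?thesis by simp
qed

lemma isometry_op_cinner:
  "csubspace S \<Longrightarrow> isometry_op S R V \<Longrightarrow> x \<in> S \<Longrightarrow> y \<in> S \<Longrightarrow> cinner (V x) (V y) = cinner x y"
  by (rule cinner_eq_if_norm_eq) (auto simp: isometry_op_def bounded_op_def)

lemma isometry_op_adjoint_pairI:
  assumes S: "csubspace S" and R: "csubspace R" and p: "adjoint_pair S R A B"
    and BA: "\<And>x. x \<in> S \<Longrightarrow> B (A x) = x"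
  shows "isometry_op S R A"
proof -
  have n: "norm (A x) = norm x" if "x \<in> S" for x
    using adjoint_pair_eq[OF p that adjoint_pair_in1[OF p that]] BA[OF that]
    by (intro norm_eq_cinner) simp
  then show ?thesis
    unfolding isometry_op_def using bounded_op_adjoint_pairI[OF S R p, of 1] by auto
qed

lemma contractive_if_adjoint_isometric:
  assumes p: "adjoint_pair S R A B" and AB: "\<And>y. y \<in> R \<Longrightarrow> A (B y) = y" and x: "x \<in> S"
  shows "norm (A x) \<le> norm x"
proof (rule norm_le_if_cinner_le)
  have y: "A x \<in> R" using adjoint_pair_in1[OF p x] .
  have "norm (B (A x)) = norm (A x)"
    using adjoint_pair_eq[OF p adjoint_pair_in2[OF p y] y] AB[OF y] by (intro norm_eq_cinner) simp
  then have "cmod (cinner x (B (A x))) \<le> norm x * norm (A x)"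
    using norm_cinner_le by metis
  then show "cmod (cinner (A x) (A x)) \<le> norm (A x) * norm x"
    using adjoint_pair_eq[OF p x y] by (simp add: mult.commute)
qed simp

lemma bounded_op_if_adjoint_isometric:
  assumes "csubspace S" "csubspace R" "adjoint_pair S R A B" "\<And>y. y \<in> R \<Longrightarrow> A (B y) = y"
  shows "bounded_op S R A"
  using bounded_op_adjoint_pairI[OF assms(1-3), of 1] contractive_if_adjoint_isometric[OF assms(3,4)]
  by auto

lemma bounded_op_cong:
  "bounded_op S R A" if "bounded_op S R A'" "csubspace S" "\<And>x. x \<in> S \<Longrightarrow> A x = A' x"
  using that by (simp add: bounded_op_def csubspace_add csubspace_scaleC)

lemma isometry_op_cong:
  "isometry_op S R A" if "isometry_op S R A'" "csubspace S" "\<And>x. x \<in> S \<Longrightarrow> A x = A' x"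
  using bounded_op_cong[of S R A' A] that by (simp add: isometry_op_def)

lemma coisometry_op_adjoint_pairI:
  assumes S: "csubspace S" and R: "csubspace R" and p: "adjoint_pair S R A B"
    and AB: "\<And>y. y \<in> R \<Longrightarrow> A (B y) = y"
  shows "coisometry_op S R A"
  unfolding coisometry_op_def
  using bounded_op_if_adjoint_isometric[OF assms]
    isometry_op_cong[OF isometry_op_adjoint_pairI[OF R S adjoint_pair_sym[OF p] AB] R]
    adj_adjoint_pair[OF S p]
  by blast

lemma unitary_op_adjoint_pairI:
  assumes S: "csubspace S" and R: "csubspace R" and p: "adjoint_pair S R A B"
    and BA: "\<And>x. x \<in> S \<Longrightarrow> B (A x) = x" and AB: "\<And>y. y \<in> R \<Longrightarrow> A (B y) = y"
  shows "unitary_op S R A"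
  unfolding unitary_op_def
  using bounded_op_if_adjoint_isometric[OF S R p AB] adj_adjoint_pair[OF S p]
    adjoint_pair_in1[OF p] BA AB by simp

lemma unitary_opD:
  assumes S: "closed_csubspace S" and U: "unitary_op S R U"
  shows "adjoint_pair S R U (adj S U)"
    and "x \<in> S \<Longrightarrow> adj S U (U x) = x" and "y \<in> R \<Longrightarrow> U (adj S U y) = y"
  using assms by (auto simp: unitary_op_def intro!: adjoint_pair_adj)

lemma projection_op_adjoint_pairI:
  assumes S: "csubspace S" and p: "adjoint_pair S S P P" and PP: "\<And>x. x \<in> S \<Longrightarrow> P (P x) = P x"
  shows "projection_op S P"
proof -
  have "norm (P x) \<le> norm x" if "x \<in> S" for x
  proof (rule norm_le_if_cinner_le)
    show "cmod (cinner (P x) (P x)) \<le> norm (P x) * norm x"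
      using adjoint_pair_eq[OF p that adjoint_pair_in1[OF p that]] PP[OF that]
        norm_cinner_le[of x "P x"] by (simp add: mult.commute)
  qed simp
  then have "bounded_op S S P" using bounded_op_adjoint_pairI[OF S S p, of 1] by auto
  then show ?thesis
    unfolding projection_op_def using PP adj_adjoint_pair[OF S p] by blast
qed

lemma projection_opD:
  assumes S: "closed_csubspace S" and P: "projection_op S P"
  shows "adjoint_pair S S P P" and "x \<in> S \<Longrightarrow> P (P x) = P x"
  using assms adjoint_pair_adj[OF S, of S P]
  by (auto simp: projection_op_def adjoint_pair_def)

lemma adjoint_pair_perp:
  "csubspace S \<Longrightarrow> adjoint_pair S S P P \<Longrightarrow> adjoint_pair S S (perp P) (perp P)"
  unfolding perp_def[abs_def] by (intro adjoint_pair_diff_maps adjoint_pair_id)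

text \<open>If \<open>W\<close> is isometric then \<open>f - W (W\<^sup>* f)\<close> is orthogonal to the range of \<open>W\<close>.\<close>

lemma unitary_op_if_dense_range:
  assumes S: "closed_csubspace S" and R: "csubspace R" and W: "isometry_op S R W"
    and dense: "\<And>f. f \<in> R \<Longrightarrow> (\<And>x. x \<in> S \<Longrightarrow> cinner (W x) f = 0) \<Longrightarrow> f = 0"
  shows "unitary_op S R W"
proof -
  note Ss = closed_csubspaceD(1)[OF S]
  have p: "adjoint_pair S R W (adj S W)"
    using W by (intro adjoint_pair_adj[OF S]) (simp add: isometry_op_def)
  have 1: "adj S W (W x) = x" if "x \<in> S" for x
    using that isometry_op_cinner[OF Ss W] by (intro adj_eqI[OF Ss])
  have "W (adj S W f) = f" if f: "f \<in> R" for f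
  proof -
    have "cinner (W x) (f - W (adj S W f)) = 0" if x: "x \<in> S" for x
      using adjoint_pair_eq[OF p x f] isometry_op_cinner[OF Ss W x adjoint_pair_in2[OF p f]]
      by (simp add: cinner_diff_right)
    then show ?thesis
      using dense[of "f - W (adj S W f)"] f adjoint_pair_in1[OF p] adjoint_pair_in2[OF p]
      by (simp add: csubspace_diff[OF R])
  qed
  with 1 p Ss R show ?thesis by (intro unitary_op_adjoint_pairI)
qed

lemma bounded_op_comp:
  assumes A: "bounded_op S R A" and B: "bounded_op R Q B"
  shows "bounded_op S Q (B \<circ> A)"
proof -
  obtain a where a: "\<And>x. x \<in> S \<Longrightarrow> norm (A x) \<le> a * norm x"
    using A unfolding bounded_op_def by blast
  obtain b where b: "\<And>y. y \<in> R \<Longrightarrow> norm (B y) \<le> b * norm y"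
    using B unfolding bounded_op_def by blast
  have "norm ((B \<circ> A) x) \<le> (\<bar>b\<bar> * \<bar>a\<bar>) * norm x" if x: "x \<in> S" for x
  proof -
    have "A x \<in> R" using A x by (simp add: bounded_op_def)
    then have "norm (B (A x)) \<le> b * norm (A x)" by (rule b)
    also have "\<dots> \<le> \<bar>b\<bar> * norm (A x)" by (intro mult_right_mono) auto
    also have "\<dots> \<le> \<bar>b\<bar> * (\<bar>a\<bar> * norm x)"
      using order_trans[OF a[OF x] mult_right_mono[OF abs_ge_self norm_ge_zero]]
      by (intro mult_left_mono) auto
    finally show ?thesis by (simp add: mult.assoc)
  qed
  then have "\<exists>K. \<forall>x\<in>S. norm ((B \<circ> A) x) \<le> K * norm x" by blast
  then show ?thesis using A B unfolding bounded_op_def by simp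
qed

lemma projection_op_perp:
  assumes S: "closed_csubspace S" and P: "projection_op S P"
  shows "projection_op S (perp P)"
proof (rule projection_op_adjoint_pairI)
  note Ss = closed_csubspaceD(1)[OF S] and p = projection_opD[OF S P]
  show "csubspace S" by (rule Ss)
  show "adjoint_pair S S (perp P) (perp P)" by (rule adjoint_pair_perp[OF Ss p(1)])
  show "perp P (perp P x) = perp P x" if "x \<in> S" for x
    using that p(2)[OF that] adjoint_pair_in1[OF p(1) that]
      adjoint_pair_diff[OF Ss Ss p(1), of x "P x"] by (simp add: perp_def)
qed

lemma adjoint_contractive:
  assumes p: "adjoint_pair S R A B" and contr: "\<And>x. x \<in> S \<Longrightarrow> norm (A x) \<le> norm x" and y: "y \<in> R"
  shows "norm (B y) \<le> norm y"
proof (rule norm_le_if_cinner_le)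
  have "cmod (cinner (B y) (B y)) = cmod (cinner (A (B y)) y)"
    using adjoint_pair_eq[OF p adjoint_pair_in2[OF p y] y] by simp
  also have "\<dots> \<le> norm (A (B y)) * norm y" by (rule norm_cinner_le)
  also have "\<dots> \<le> norm (B y) * norm y"
    using contr[OF adjoint_pair_in2[OF p y]] by (intro mult_right_mono) auto
  finally show "cmod (cinner (B y) (B y)) \<le> norm (B y) * norm y" .
qed simp

text \<open>
  For \<open>y\<close> in the range of \<open>Q j\<close> the squared norms of all the \<open>Q i y\<close> add up to that of \<open>y = Q j y\<close>,
  so the other summands vanish.
\<close>

lemma projections_orthogonal_if_sum_id:
  assumes S: "csubspace S" and I: "finite I" "i \<in> I" "j \<in> I" "i \<noteq> j" and x: "x \<in> S"
    and p: "\<And>i. i \<in> I \<Longrightarrow> adjoint_pair S S (Q i) (Q i)"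
    and idem: "\<And>i x. i \<in> I \<Longrightarrow> x \<in> S \<Longrightarrow> Q i (Q i x) = Q i x"
    and sum: "\<And>x. x \<in> S \<Longrightarrow> (\<Sum>i\<in>I. Q i x) = x"
  shows "Q i (Q j x) = 0"
proof -
  define y where "y = Q j x"
  have y: "y \<in> S" "Q j y = y"
    using adjoint_pair_in1[OF p[OF I(3)] x] idem[OF I(3) x] by (simp_all add: y_def)
  have Q: "inner (Q k y) y = (norm (Q k y))\<^sup>2" if k: "k \<in> I" for k
  proof -
    have "cinner (Q k y) y = cinner (Q k (Q k y)) y" using idem[OF k y(1)] by simp
    also have "\<dots> = cinner (Q k y) (Q k y)"
      using adjoint_pair_eq[OF p[OF k] adjoint_pair_in1[OF p[OF k] y(1)] y(1)] .
    finally show ?thesis by (simp add: Re_cinner[symmetric] cinner_self del: of_real_power)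
  qed
  have "(\<Sum>k\<in>I. (norm (Q k y))\<^sup>2) = inner (\<Sum>k\<in>I. Q k y) y"
    using Q by (simp add: inner_sum_left)
  also have "\<dots> = (norm (Q j y))\<^sup>2" using sum[OF y(1)] y(2) by (simp add: power2_norm_eq_inner)
  finally have "(\<Sum>k\<in>I - {j}. (norm (Q k y))\<^sup>2) = 0"
    using I by (simp add: sum.remove[of I j])
  then have "(norm (Q i y))\<^sup>2 = 0"
    using I by (subst (asm) sum_nonneg_eq_0_iff) auto
  then show ?thesis by (simp add: y_def)
qed

section \<open>Square roots and defect operators\<close>

lemma positive_op_selfadjoint:
  assumes S: "csubspace S" and Q: "positive_op S Q"
  shows "adjoint_pair S S Q Q"
proof (rule adjoint_pairI)
  have lin: "\<And>x y. x \<in> S \<Longrightarrow> y \<in> S \<Longrightarrow> Q (x + y) = Q x + Q y"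
      "\<And>a x. x \<in> S \<Longrightarrow> Q (a *\<^sub>C x) = a *\<^sub>C Q x"
    and in_S: "\<And>x. x \<in> S \<Longrightarrow> Q x \<in> S"
    using Q by (auto simp: positive_op_def bounded_op_def)
  show "Q x \<in> S" "Q x \<in> S" if "x \<in> S" for x using in_S that by auto
  fix x y assume xy: "x \<in> S" "y \<in> S"
  \<comment> \<open>The quadratic form has real values on the line \<open>x + a y\<close>; the claim follows by comparing
    \<open>a = 1, -1\<close> and \<open>a = \<i>, -\<i>\<close>.\<close>
  define g where "g a = cinner (Q (x + a *\<^sub>C y)) (x + a *\<^sub>C y)" for a
  have real: "cnj (g a) = g a" for a
  proof -
    have "x + a *\<^sub>C y \<in> S" using xy by (simp add: csubspace_add csubspace_scaleC S)
    then have "g a \<in> \<real>\<^sub>\<ge>\<^sub>0" using Q by (auto simp: positive_op_def g_def)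
    then have "g a \<in> \<real>" by (rule set_mp[OF nonneg_Reals_subset_Reals])
    then show ?thesis by (simp add: Reals_cnj_iff)
  qed
  define p q where "p = cinner (Q x) y" and "q = cinner (Q y) x"
  have g: "g a = cinner (Q x) x + cnj a * p + a * q + a * cnj a * cinner (Q y) y" for a
    using xy by (simp add: g_def p_def q_def lin csubspace_scaleC S cinner_add_left cinner_add_right
        cinner_scaleC_left cinner_scaleC_right algebra_simps)
  have "cnj (g 1 - g (-1)) = g 1 - g (-1)" "cnj (g \<i> - g (-\<i>)) = g \<i> - g (-\<i>)"
    by (simp_all only: complex_cnj_diff real)
  then have "2 * (cnj p + cnj q) = 2 * (p + q)" "2 * (\<i> * cnj p - \<i> * cnj q) = 2 * (- \<i> * p + \<i> * q)"
    unfolding g by (simp_all add: algebra_simps)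
  then have "cnj p = q"
    by (auto simp: complex_eq_iff)
  then show "cinner (Q x) y = cinner x (Q y)"
    unfolding p_def q_def by (metis cinner_commute)
qed

text \<open>The coefficients of the power series of \<open>sqrt (1 - x)\<close>.\<close>

definition sqrt_coeff :: "nat \<Rightarrow> real" where
  "sqrt_coeff n = ((1/2) gchoose n) * (-1) ^ n"

lemma sqrt_coeff_0: "sqrt_coeff 0 = 1"
  by (simp add: sqrt_coeff_def)

text \<open>
  The partial sums are the values at \<open>m\<close> of \<open>(-1)\<^sup>m (-1/2 gchoose m)\<close>. Their nonnegativity bounds
  the sum of all \<open>|sqrt_coeff k|\<close>, as only the first coefficient is positive.
\<close>

lemma sum_sqrt_coeff_nonneg: "0 \<le> (\<Sum>k\<le>m. sqrt_coeff k)"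
proof -
  have "(\<Sum>k\<le>m. sqrt_coeff k) = (- 1) ^ m * (- (1/2) gchoose m)"
    using gbinomial_sum_lower_neg[of "1/2 :: real" m] by (simp add: sqrt_coeff_def)
  also have "\<dots> = (-1) ^ m * (-1) ^ m * ((1/2 + real m - 1) gchoose m)"
    using gbinomial_minus[of "1/2 :: real" m] by simp
  also have "\<dots> = (\<Prod>i = 0..<m. 1/2 + real m - 1 - real i) / fact m"
    by (simp add: gbinomial_prod_rev power_add[symmetric])
  also have "\<dots> \<ge> 0"
  proof (intro divide_nonneg_nonneg prod_nonneg)
    fix i assume "i \<in> {0..<m}"
    then have "real i + 1 \<le> real m" by simp
    then show "0 \<le> 1/2 + real m - 1 - real i" by simp
  qed simp
  finally show ?thesis .
qed

lemma sqrt_coeff_Suc_le_0: "sqrt_coeff (Suc m) \<le> 0"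
proof -
  have "sqrt_coeff (Suc m) = - (1/2 / real (Suc m)) * ((-1) ^ m * (- (1/2) gchoose m))"
    using gbinomial_absorption'[of "Suc m" "1/2 :: real"] by (simp add: sqrt_coeff_def)
  also have "(-1) ^ m * (- (1/2) gchoose m) = (\<Sum>k\<le>m. sqrt_coeff k)"
    using gbinomial_sum_lower_neg[of "1/2 :: real" m] by (simp add: sqrt_coeff_def)
  also have "- (1/2 / real (Suc m)) * (\<Sum>k\<le>m. sqrt_coeff k) \<le> 0"
    using sum_sqrt_coeff_nonneg[of m] by (intro mult_nonpos_nonneg) auto
  finally show ?thesis .
qed

lemma sum_sqrt_coeff_Suc_ge: "(\<Sum>k<m. - sqrt_coeff (Suc k)) \<le> 1"
proof -
  have "(\<Sum>k\<le>m. sqrt_coeff k) = 1 + (\<Sum>k<m. sqrt_coeff (Suc k))"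
    by (simp only: sum.atMost_shift sqrt_coeff_0)
  then show ?thesis using sum_sqrt_coeff_nonneg[of m] by (simp add: sum_negf)
qed

lemma summable_sqrt_coeff_Suc: "summable (\<lambda>n. - sqrt_coeff (Suc n))"
  by (rule summableI_nonneg_bounded[where x=1])
    (use sqrt_coeff_Suc_le_0 sum_sqrt_coeff_Suc_ge in auto)

lemma summable_abs_sqrt_coeff: "summable (\<lambda>n. \<bar>sqrt_coeff n\<bar>)"
proof -
  have "\<bar>sqrt_coeff (Suc n)\<bar> = - sqrt_coeff (Suc n)" for n
    using sqrt_coeff_Suc_le_0[of n] by simp
  then show ?thesis using summable_sqrt_coeff_Suc by (subst summable_Suc_iff[symmetric]) simp
qed

lemma sqrt_coeff_convolution:
  "(\<Sum>i\<le>n. sqrt_coeff i * sqrt_coeff (n - i)) = (if n = 0 then 1 else if n = 1 then -1 else 0)"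
proof -
  have "(\<Sum>i\<le>n. sqrt_coeff i * sqrt_coeff (n - i)) =
      (\<Sum>i\<le>n. (((1/2) gchoose i) * ((1/2) gchoose (n - i))) * (-1) ^ n)"
    by (intro sum.cong) (auto simp: sqrt_coeff_def power_add[symmetric] simp flip: mult.assoc)
  also have "\<dots> = ((1::real) gchoose n) * (-1) ^ n"
    using gbinomial_Vandermonde[of "1/2 :: real" "1/2" n]
    by (simp add: sum_distrib_right[symmetric] atLeast0AtMost)
  also have "(1::real) gchoose n = of_nat (1 choose n)"
    using binomial_gbinomial[of 1 n, where ?'a=real] by simp
  finally show ?thesis by (cases n) (auto simp: binomial_eq_0)
qed

lemma bounded_op_sums:
  assumes S: "closed_csubspace S" and A: "bounded_op S R A"
    and f: "\<And>n. f n \<in> S" "f sums s"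
  shows "(\<lambda>n. A (f n)) sums A s"
proof -
  note Ss = closed_csubspaceD(1)[OF S]
  have sS: "s \<in> S" using closed_sums[OF S f] .
  obtain c where c: "\<And>x. x \<in> S \<Longrightarrow> norm (A x) \<le> c * norm x"
    using A unfolding bounded_op_def by blast
  have add: "\<And>x y. x \<in> S \<Longrightarrow> y \<in> S \<Longrightarrow> A (x + y) = A x + A y"
    using A unfolding bounded_op_def by blast
  have diff: "A (x - y) = A x - A y" if "x \<in> S" "y \<in> S" for x y
    using add[of "x - y" y] that csubspace_diff[OF Ss] by simp
  have zero: "A 0 = 0" using diff[of 0 0] csubspace_zero[OF Ss] by simp
  have psum: "(\<Sum>n<m. f n) \<in> S \<and> A (\<Sum>n<m. f n) = (\<Sum>n<m. A (f n))" for m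
    by (induction m) (auto simp: zero add f csubspace_zero[OF Ss] csubspace_add[OF Ss])
  have lim: "(\<lambda>m. c * norm ((\<Sum>n<m. f n) - s)) \<longlonglongrightarrow> c * norm (s - s)"
    using f(2) unfolding sums_def by (intro tendsto_intros)
  show ?thesis
    unfolding sums_def
  proof (rule LIM_zero_cancel, rule Lim_null_comparison)
    show "\<forall>\<^sub>F m in sequentially.
        norm ((\<Sum>n<m. A (f n)) - A s) \<le> c * norm ((\<Sum>n<m. f n) - s)"
      using psum sS c[OF csubspace_diff[OF Ss]] by (intro always_eventually allI) (metis diff)
    show "(\<lambda>m. c * norm ((\<Sum>n<m. f n) - s)) \<longlonglongrightarrow> 0" using lim by simp
  qed
qed

text \<open>
  The square root of \<open>I - X\<close>, for a selfadjoint contraction \<open>X\<close>, is the binomial series in \<open>X\<close>.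
  It is positive because all coefficients but the first are nonpositive and they sum up
  to at least \<open>-1\<close>.
\<close>

theorem ex_positive_sqrt:
  fixes X :: "'a::complex_hilbert \<Rightarrow> 'a"
  assumes S: "closed_csubspace S" and p: "adjoint_pair S S X X"
    and contr: "\<And>x. x \<in> S \<Longrightarrow> norm (X x) \<le> norm x"
  shows "\<exists>R. positive_op S R \<and> (\<forall>x\<in>S. R (R x) = x - X x)"
proof -
  note Ss = closed_csubspaceD(1)[OF S]
  have XS: "(X ^^ n) x \<in> S" if "x \<in> S" for n x
    using that adjoint_pair_in1[OF p] by (induction n) auto
  have Xn: "norm ((X ^^ n) x) \<le> norm x" if "x \<in> S" for n x
  proof (induction n)
    case (Suc n)
    then show ?case using contr[OF XS[OF that, of n]] by simp
  qed simp
  have Xp: "adjoint_pair S S (X ^^ n) (X ^^ n)" for n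
  proof (induction n)
    case (Suc n)
    have "adjoint_pair S S (\<lambda>x. X ((X ^^ n) x)) (\<lambda>x. (X ^^ n) (X x))"
      using adjoint_pair_comp[OF Suc p] .
    then show ?case by (simp add: o_def funpow_swap1)
  qed (simp add: adjoint_pair_def)
  have Xb: "bounded_op S S (X ^^ n)" for n
    using bounded_op_adjoint_pairI[OF Ss Ss Xp, of n 1] Xn by auto
  define t where "t x n = sqrt_coeff n *\<^sub>R (X ^^ n) x" for x n
  have tS: "t x n \<in> S" if "x \<in> S" for x n
    unfolding t_def using XS[OF that] by (intro csubspace_scaleR[OF Ss])
  have tn: "norm (t x n) \<le> \<bar>sqrt_coeff n\<bar> * norm x" if "x \<in> S" for x n
    unfolding t_def norm_scaleR using Xn[OF that] by (intro mult_left_mono) auto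
  have tsum: "summable (\<lambda>n. norm (t x n))" if "x \<in> S" for x
    by (rule summable_comparison_test'[OF summable_mult2[OF summable_abs_sqrt_coeff]])
      (use tn[OF that] in auto)
  define R where "R x = (\<Sum>n. t x n)" for x
  have Rs: "t x sums R x" if "x \<in> S" for x
    unfolding R_def using summable_norm_cancel[OF tsum[OF that]] by (rule summable_sums)
  have RS: "R x \<in> S" if "x \<in> S" for x
    using closed_sums[OF S tS[OF that] Rs[OF that]] .
  have Rp: "adjoint_pair S S R R"
  proof (rule adjoint_pairI)
    fix x y assume xy: "x \<in> S" "y \<in> S"
    have "cinner (t x n) y = cinner x (t y n)" for n
      using adjoint_pair_eq[OF Xp xy]
      by (simp add: t_def scaleC_of_real[symmetric] cinner_scaleC_left cinner_scaleC_right)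
    moreover have "(\<lambda>n. cinner (t x n) y) sums cinner (R x) y"
      using bounded_linear.sums[OF bounded_linear_cinner_left Rs[OF xy(1)]] .
    moreover have "(\<lambda>n. cinner x (t y n)) sums cinner x (R y)"
      using bounded_linear.sums[OF bounded_linear_cinner_right Rs[OF xy(2)]] .
    ultimately show "cinner (R x) y = cinner x (R y)" using sums_unique2 by force
  qed (use RS in auto)
  have "norm (R x) \<le> (\<Sum>n. \<bar>sqrt_coeff n\<bar>) * norm x" if "x \<in> S" for x
  proof -
    have "norm (R x) \<le> (\<Sum>n. norm (t x n))"
      unfolding R_def by (rule summable_norm[OF tsum[OF that]])
    also have "\<dots> \<le> (\<Sum>n. \<bar>sqrt_coeff n\<bar> * norm x)"
      by (intro suminf_le tn that tsum summable_mult2 summable_abs_sqrt_coeff)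
    also have "\<dots> = (\<Sum>n. \<bar>sqrt_coeff n\<bar>) * norm x"
      by (intro suminf_mult2[symmetric] summable_abs_sqrt_coeff)
    finally show ?thesis .
  qed
  then have Rb: "bounded_op S S R" using bounded_op_adjoint_pairI[OF Ss Ss Rp] by blast
  have Rpos: "cinner (R x) x \<in> \<real>\<^sub>\<ge>\<^sub>0" if x: "x \<in> S" for x
  proof -
    have "cnj (cinner (R x) x) = cinner (R x) x"
      using adjoint_pair_eq[OF Rp x x] by (metis cinner_commute)
    then have Im: "Im (cinner (R x) x) = 0" by (simp add: complex_eq_iff)
    have "(\<lambda>n. inner (t x n) x) sums inner (R x) x"
      using bounded_linear.sums[OF bounded_linear_inner_left Rs[OF x]] .
    moreover have "t x 0 = x" by (simp add: t_def sqrt_coeff_0)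
    ultimately have "(\<lambda>n. inner (t x (Suc n)) x) sums (inner (R x) x - (norm x)\<^sup>2)"
      using sums_Suc_iff[of "\<lambda>n. inner (t x n) x" "inner (R x) x - (norm x)\<^sup>2"]
      by (simp add: power2_norm_eq_inner)
    then have 1: "(\<lambda>n. - inner (t x (Suc n)) x) sums ((norm x)\<^sup>2 - inner (R x) x)"
      using sums_minus[of "\<lambda>n. inner (t x (Suc n)) x"] by fastforce
    have 2: "(\<lambda>n. - sqrt_coeff (Suc n) * (norm x)\<^sup>2) sums ((\<Sum>n. - sqrt_coeff (Suc n)) * (norm x)\<^sup>2)"
      by (intro sums_mult2 summable_sums summable_sqrt_coeff_Suc)
    have 3: "- inner (t x (Suc n)) x \<le> - sqrt_coeff (Suc n) * (norm x)\<^sup>2" for n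
    proof -
      have "inner ((X ^^ Suc n) x) x \<le> norm ((X ^^ Suc n) x) * norm x" by (rule norm_cauchy_schwarz)
      also have "\<dots> \<le> norm x * norm x" by (rule mult_right_mono[OF Xn[OF x] norm_ge_zero])
      finally have "- sqrt_coeff (Suc n) * inner ((X ^^ Suc n) x) x \<le> - sqrt_coeff (Suc n) * (norm x)\<^sup>2"
        using sqrt_coeff_Suc_le_0[of n] unfolding power2_eq_square
        by (intro mult_left_mono) auto
      then show ?thesis by (simp add: t_def)
    qed
    have "(norm x)\<^sup>2 - inner (R x) x \<le> (\<Sum>n. - sqrt_coeff (Suc n)) * (norm x)\<^sup>2"
      by (rule sums_le[OF 3 1 2])
    also have "(\<Sum>n. - sqrt_coeff (Suc n)) * (norm x)\<^sup>2 \<le> 1 * (norm x)\<^sup>2"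
      by (intro mult_right_mono suminf_le_const summable_sqrt_coeff_Suc sum_sqrt_coeff_Suc_ge) simp
    finally have "0 \<le> inner (R x) x" by simp
    then show ?thesis using Im by (simp add: complex_nonneg_Reals_iff Re_cinner)
  qed
  have RR: "R (R x) = x - X x" if x: "x \<in> S" for x
  proof -
    define f where "f = (\<lambda>(n, m). (sqrt_coeff n * sqrt_coeff m) *\<^sub>R (X ^^ (n + m)) x)"
    have has: "((\<lambda>n. t y n) has_sum R y) UNIV" if "y \<in> S" for y
      using norm_summable_imp_has_sum[OF tsum[OF that] Rs[OF that]] .
    have c: "(\<lambda>n. norm \<bar>sqrt_coeff n\<bar>) summable_on UNIV"
      using summable_abs_sqrt_coeff by (intro norm_summable_imp_summable_on) simp
    have "(\<lambda>p. norm (case p of (n, m) \<Rightarrow> \<bar>sqrt_coeff n\<bar> * \<bar>sqrt_coeff m\<bar> * norm x)) summable_on UNIV \<times> UNIV"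
      unfolding Infinite_Sum.abs_summable_on_Sigma_iff
      using c by (auto simp: abs_mult infsum_cmult_left' infsum_cmult_right' mult.assoc
          intro!: summable_on_cmult_left summable_on_cmult_right)
    then have "(\<lambda>p. norm (f p)) summable_on UNIV \<times> UNIV"
    proof (rule Infinite_Sum.abs_summable_on_comparison_test)
      fix nm :: "nat \<times> nat"
      show "norm (f nm) \<le> norm (case nm of (n, m) \<Rightarrow> \<bar>sqrt_coeff n\<bar> * \<bar>sqrt_coeff m\<bar> * norm x)"
        using Xn[OF x] by (cases nm) (auto simp: f_def abs_mult intro!: mult_left_mono)
    qed
    then have fsum: "f summable_on (UNIV \<times> UNIV)" by (rule Infinite_Sum.abs_summable_summable)
    have inner_sum: "(\<Sum>\<^sub>\<infinity>m. f (n, m)) = t (R x) n" for n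
    proof -
      have "(\<lambda>m. (X ^^ n) (t x m)) sums (X ^^ n) (R x)"
        using bounded_op_sums[OF S Xb tS[OF x] Rs[OF x]] .
      then have "(\<lambda>m. sqrt_coeff n *\<^sub>R (X ^^ n) (t x m)) sums t (R x) n"
        unfolding t_def[of "R x"] by (rule sums_scaleR_right)
      moreover have "sqrt_coeff n *\<^sub>R (X ^^ n) (t x m) = f (n, m)" for m
        using adjoint_pair_scaleC[OF Ss Ss Xp XS[OF x]]
        by (simp add: t_def f_def scaleC_of_real[symmetric] scaleC_scaleC funpow_add)
      ultimately have sums: "(\<lambda>m. f (n, m)) sums t (R x) n" by simp
      have "summable (\<lambda>m. norm (f (n, m)))"
      proof (rule summable_comparison_test'[where g="\<lambda>m. \<bar>sqrt_coeff n\<bar> * \<bar>sqrt_coeff m\<bar> * norm x"])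
        show "summable (\<lambda>m. \<bar>sqrt_coeff n\<bar> * \<bar>sqrt_coeff m\<bar> * norm x)"
          by (intro summable_mult2 summable_mult summable_abs_sqrt_coeff)
      qed (use Xn[OF x] in \<open>auto simp: f_def abs_mult intro!: mult_left_mono\<close>)
      then show ?thesis using norm_summable_imp_has_sum[OF _ sums] infsumI by blast
    qed
    have "R (R x) = (\<Sum>\<^sub>\<infinity>n. t (R x) n)"
      using has[OF RS[OF x]] by (simp add: infsumI)
    also have "\<dots> = (\<Sum>\<^sub>\<infinity>n. \<Sum>\<^sub>\<infinity>m. f (n, m))" by (simp add: inner_sum)
    also have "\<dots> = infsum f (UNIV \<times> UNIV)" by (rule infsum_Sigma_banach[OF fsum])
    \<comment> \<open>Summation along the diagonals \<open>n + m = k\<close>.\<close>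
    also have "\<dots> = (\<Sum>\<^sub>\<infinity>(k, i)\<in>Sigma UNIV (\<lambda>k. {..k}). f (i, k - i))"
      by (rule infsum_reindex_bij_witness[of _ "\<lambda>(k, i). (i, k - i)" "\<lambda>(n, m). (n + m, n)"]) auto
    also have "\<dots> = (\<Sum>\<^sub>\<infinity>k. \<Sum>\<^sub>\<infinity>i\<in>{..k}. f (i, k - i))"
    proof (rule infsum_Sigma'_banach[symmetric])
      have "(\<lambda>(k, i). f (i, k - i)) summable_on Sigma UNIV (\<lambda>k. {..k}) \<longleftrightarrow> f summable_on (UNIV \<times> UNIV)"
        by (rule summable_on_reindex_bij_witness[of _ "\<lambda>(n, m). (n + m, n)" "\<lambda>(k, i). (i, k - i)"]) auto
      then show "(\<lambda>(k, i). f (i, k - i)) summable_on Sigma UNIV (\<lambda>k. {..k})" using fsum by simp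
    qed
    also have "\<dots> = (\<Sum>\<^sub>\<infinity>k. (if k = 0 then 1 else if k = 1 then -1 else 0) *\<^sub>R (X ^^ k) x)"
    proof (rule infsum_cong)
      fix k :: nat
      have "(\<Sum>\<^sub>\<infinity>i\<in>{..k}. f (i, k - i)) =
          (\<Sum>i\<le>k. (sqrt_coeff i * sqrt_coeff (k - i)) *\<^sub>R (X ^^ k) x)"
        by (auto simp: f_def intro!: sum.cong)
      also have "\<dots> = (\<Sum>i\<le>k. sqrt_coeff i * sqrt_coeff (k - i)) *\<^sub>R (X ^^ k) x"
        by (simp add: scaleR_sum_left)
      finally show "(\<Sum>\<^sub>\<infinity>i\<in>{..k}. f (i, k - i)) =
          (if k = 0 then 1 else if k = 1 then -1 else 0) *\<^sub>R (X ^^ k) x"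
        unfolding sqrt_coeff_convolution .
    qed
    also have "\<dots> = (\<Sum>\<^sub>\<infinity>k\<in>{0, 1}. (if k = 0 then 1 else if k = 1 then -1 else 0) *\<^sub>R (X ^^ k) x)"
      by (rule infsum_cong_neutral) auto
    also have "\<dots> = x - X x" by simp
    finally show ?thesis .
  qed
  show ?thesis using Rb Rpos RR by (intro exI[of _ R]) (simp add: positive_op_def)
qed

lemma defect_op_positive_sqrt:
  assumes S: "closed_csubspace S" and p: "adjoint_pair S S A B"
    and contr: "\<And>x. x \<in> S \<Longrightarrow> norm (A x) \<le> norm x"
  shows "positive_op S (defect_op S A) \<and> (\<forall>x\<in>S. defect_op S A (defect_op S A x) = x - B (A x))"
proof -
  note Ss = closed_csubspaceD(1)[OF S]
  have B: "norm (B y) \<le> norm y" if "y \<in> S" for y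
    using adjoint_contractive[OF p contr that] .
  have "\<exists>R. positive_op S R \<and> (\<forall>x\<in>S. R (R x) = x - B (A x))"
    using ex_positive_sqrt[OF S adjoint_pair_comp[OF p adjoint_pair_sym[OF p]]] contr B
      adjoint_pair_in1[OF p] order_trans by meson
  moreover have "adj S A (A x) = B (A x)" if "x \<in> S" for x
    using adj_adjoint_pair[OF Ss p] adjoint_pair_in1[OF p that] by simp
  ultimately have "\<exists>R. positive_op S R \<and> (\<forall>x\<in>S. R (R x) = x - adj S A (A x))" by simp
  from someI_ex[OF this] show ?thesis
    unfolding defect_op_def op_sqrt_def using \<open>\<And>x. x \<in> S \<Longrightarrow> adj S A (A x) = B (A x)\<close> by simp
qed

section \<open>Orthonormal bases\<close>

lemma orthogonal_complement_closed:
  assumes "closed_csubspace S"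
  shows "closed_csubspace {x\<in>S. \<forall>y\<in>M. cinner x y = 0}"
proof -
  have "{x\<in>S. \<forall>y\<in>M. cinner x y = 0} = S \<inter> (\<Inter>y\<in>M. {x. cinner x y = 0})" by auto
  moreover have "closed {x. cinner x y = 0}" for y :: 'a
    using linear_continuous_on[OF bounded_linear_cinner_left, of UNIV y]
    by (intro closed_Collect_eq) auto
  ultimately have "closed {x\<in>S. \<forall>y\<in>M. cinner x y = 0}"
    using closed_csubspaceD(2)[OF assms] by (simp add: closed_Int closed_INT)
  moreover have "csubspace {x\<in>S. \<forall>y\<in>M. cinner x y = 0}"
    using closed_csubspaceD(1)[OF assms]
    by (auto simp: csubspace_def cinner_zero_left cinner_add_left cinner_scaleC_left)
  ultimately show ?thesis by (simp add: closed_csubspace_def)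
qed

lemma csubspace_hull: "csubspace (csubspace hull B)"
  by (rule hull_in) (auto simp: csubspace_def)

lemma orthogonal_to_closure_hull:
  fixes x :: "'a::complex_hilbert"
  assumes "\<And>b. b \<in> B \<Longrightarrow> cinner b x = 0" "y \<in> closure (csubspace hull B)"
  shows "cinner y x = 0"
proof -
  have M: "closed_csubspace {y. cinner y x = 0}"
    using orthogonal_complement_closed[of UNIV "{x}"] by simp
  have "csubspace hull B \<subseteq> {y. cinner y x = 0}"
    using assms(1) closed_csubspaceD(1)[OF M] by (intro hull_minimal) auto
  then have "closure (csubspace hull B) \<subseteq> {y. cinner y x = 0}"
    using closed_csubspaceD(2)[OF M] by (rule closure_minimal)
  then show ?thesis using assms(2) by auto
qed

lemma orthonormal_basisI:
  assumes S: "closed_csubspace S" and B: "B \<subseteq> S" "\<And>b. b \<in> B \<Longrightarrow> norm b = 1"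
    "\<And>b c. b \<in> B \<Longrightarrow> c \<in> B \<Longrightarrow> b \<noteq> c \<Longrightarrow> cinner b c = 0"
    and total: "\<And>x. x \<in> S \<Longrightarrow> (\<And>b. b \<in> B \<Longrightarrow> cinner x b = 0) \<Longrightarrow> x = 0"
  shows "orthonormal_basis S B"
proof -
  define M where "M = closure (csubspace hull B)"
  have M: "closed_csubspace M"
    unfolding M_def by (intro closed_csubspace_closure csubspace_hull)
  have BM: "B \<subseteq> M" unfolding M_def using hull_subset closure_subset by (metis order_trans)
  have MS: "M \<subseteq> S" unfolding M_def
    using B(1) S by (intro closure_minimal hull_minimal) (auto simp: closed_csubspace_def)
  moreover have "x \<in> M" if x: "x \<in> S" for x
  proof -
    obtain p where p: "p \<in> M" "\<forall>m\<in>M. cinner (x - p) m = 0"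
      using ex_orthogonal_projection[OF M] by blast
    have "x - p = 0"
      using p x MS BM closed_csubspaceD(1)[OF S] by (intro total csubspace_diff) auto
    then show ?thesis using p by simp
  qed
  ultimately have "M = S" by blast
  then show ?thesis using B unfolding orthonormal_basis_def M_def by blast
qed

lemma orthonormal_basis_total:
  assumes B: "orthonormal_basis S B" and x: "x \<in> S" "\<And>b. b \<in> B \<Longrightarrow> cinner x b = 0"
  shows "x = 0"
proof -
  have "cinner x x = 0"
  proof (rule orthogonal_to_closure_hull[of B])
    show "cinner b x = 0" if "b \<in> B" for b using x(2)[OF that] cinner_eq_0_commute by blast
    show "x \<in> closure (csubspace hull B)" using x(1) B by (simp add: orthonormal_basis_def)
  qed
  then show ?thesis by (simp add: cinner_self_eq_0)
qed

lemma ex_orthonormal_basis: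
  assumes S: "closed_csubspace S"
  shows "\<exists>B. orthonormal_basis S B"
proof -
  define \<A> where "\<A> = {B. B \<subseteq> S \<and> (\<forall>b\<in>B. norm b = 1) \<and> (\<forall>b\<in>B. \<forall>c\<in>B. b \<noteq> c \<longrightarrow> cinner b c = 0)}"
  have "\<exists>M\<in>\<A>. \<forall>X\<in>\<A>. M \<subseteq> X \<longrightarrow> X = M"
  proof (rule subset_Zorn)
    fix \<C> assume \<C>: "subset.chain \<A> \<C>"
    then have sub: "\<C> \<subseteq> \<A>" and chain: "\<And>X Y. X \<in> \<C> \<Longrightarrow> Y \<in> \<C> \<Longrightarrow> X \<subseteq> Y \<or> Y \<subseteq> X"
      by (auto simp: subset_chain_def)
    have "cinner b c = 0" if bc: "b \<in> \<Union>\<C>" "c \<in> \<Union>\<C>" "b \<noteq> c" for b c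
    proof -
      obtain X where "X \<in> \<C>" "b \<in> X" "c \<in> X" using bc chain by blast
      then show ?thesis using sub \<open>b \<noteq> c\<close> unfolding \<A>_def by blast
    qed
    moreover have "\<Union>\<C> \<subseteq> S" "\<forall>b\<in>\<Union>\<C>. norm b = 1" using sub by (auto simp: \<A>_def)
    ultimately have "\<Union>\<C> \<in> \<A>" by (simp add: \<A>_def)
    then show "\<exists>U\<in>\<A>. \<forall>X\<in>\<C>. X \<subseteq> U" by blast
  qed
  then obtain B where B: "B \<in> \<A>" and max: "\<And>X. X \<in> \<A> \<Longrightarrow> B \<subseteq> X \<Longrightarrow> X = B" by blast
  have "orthonormal_basis S B"
  proof (rule orthonormal_basisI[OF S])
    fix x assume x: "x \<in> S" "\<And>b. b \<in> B \<Longrightarrow> cinner x b = 0"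
    show "x = 0"
    proof (rule ccontr)
      assume "x \<noteq> 0"
      define e where "e = (1 / norm x) *\<^sub>R x"
      have e: "e \<in> S" "norm e = 1" "\<And>b. b \<in> B \<Longrightarrow> cinner e b = 0"
      proof -
        show "e \<in> S"
          unfolding e_def using closed_csubspaceD(1)[OF S] x(1) by (rule csubspace_scaleR)
        show "norm e = 1" using \<open>x \<noteq> 0\<close> by (simp add: e_def)
        show "cinner e b = 0" if "b \<in> B" for b
          using x(2)[OF that] by (simp add: e_def scaleC_of_real[symmetric] cinner_scaleC_left)
      qed
      moreover have "cinner b e = 0" if "b \<in> B" for b
        using e(3)[OF that] cinner_eq_0_commute by blast
      ultimately have "insert e B \<in> \<A>"
        using B unfolding \<A>_def by auto
      then have "e \<in> B" using max by blast
      then have "cinner e e = 0" using e by blast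
      then show False using e(2) by (simp add: cinner_self_eq_0)
    qed
  qed (use B in \<open>auto simp: \<A>_def\<close>)
  then show ?thesis by blast
qed

lemma same_hilbert_dim_if_unitary:
  assumes S: "closed_csubspace S" and R: "closed_csubspace R" and J: "unitary_op S R J"
  shows "same_hilbert_dim S R"
proof -
  obtain B where B: "orthonormal_basis S B" using ex_orthonormal_basis[OF S] by blast
  then have BS: "B \<subseteq> S" and B1: "\<And>u. u \<in> B \<Longrightarrow> norm u = 1"
    and B0: "\<And>u v. u \<in> B \<Longrightarrow> v \<in> B \<Longrightarrow> u \<noteq> v \<Longrightarrow> cinner u v = 0"
    by (simp_all add: orthonormal_basis_def)
  note p = unitary_opD[OF S J]
  have c: "cinner (J x) (J y) = cinner x y" if "x \<in> S" "y \<in> S" for x y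
    using adjoint_pair_eq[OF p(1) that(1) adjoint_pair_in1[OF p(1) that(2)]] p(2)[OF that(2)] by simp
  have n: "norm (J x) = norm x" if "x \<in> S" for x
    using c[OF that that] by (rule norm_eq_cinner)
  have inj: "inj_on J B" by (rule inj_on_inverseI[where g="adj S J"]) (use p(2) BS in blast)
  have "orthonormal_basis R (J ` B)"
  proof (rule orthonormal_basisI[OF R])
    show "J ` B \<subseteq> R" using BS adjoint_pair_in1[OF p(1)] by blast
    show "norm b = 1" if "b \<in> J ` B" for b
      using that BS n B1 by auto
    show "cinner b c' = 0" if "b \<in> J ` B" "c' \<in> J ` B" "b \<noteq> c'" for b c'
    proof -
      obtain u v where uv: "u \<in> B" "v \<in> B" "b = J u" "c' = J v" using \<open>b \<in> J ` B\<close> \<open>c' \<in> J ` B\<close> by blast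
      then have "cinner u v = 0" using \<open>b \<noteq> c'\<close> by (intro B0) auto
      then show ?thesis using c[of u v] uv BS by auto
    qed
  next
    fix y assume y: "y \<in> R" "\<And>b. b \<in> J ` B \<Longrightarrow> cinner y b = 0"
    have "adj S J y = 0"
    proof (rule orthonormal_basis_total[OF B])
      fix b assume b: "b \<in> B"
      then have "cinner (J b) y = 0" using y(2) cinner_eq_0_commute by blast
      then show "cinner (adj S J y) b = 0"
        using adjoint_pair_eq[OF p(1) _ y(1), of b] b BS cinner_eq_0_commute by fastforce
    qed (use y adjoint_pair_in2[OF p(1)] in auto)
    then show "y = 0"
      using p(3)[OF y(1)] adjoint_pair_zero[OF closed_csubspaceD(1)[OF R] closed_csubspaceD(1)[OF S] p(1)]
      by simp
  qed
  moreover have "B \<approx> J ` B"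
    using inj by (simp add: eqpoll_sym inj_on_image_eqpoll_self)
  ultimately show ?thesis using B unfolding same_hilbert_dim_def by blast
qed

section \<open>Unitaries between closures of ranges\<close>

lemma closure_imageE:
  assumes "x \<in> closure (f ` H)"
  obtains h where "\<And>n. h n \<in> H" "(\<lambda>n. f (h n)) \<longlonglongrightarrow> (x::'a::metric_space)"
proof -
  obtain p where p: "\<And>n. p n \<in> f ` H" "p \<longlonglongrightarrow> x"
    using assms by (auto simp: closure_sequential)
  define h where "h n = (SOME h. h \<in> H \<and> p n = f h)" for n
  have h: "h n \<in> H \<and> p n = f (h n)" for n
    unfolding h_def by (rule someI_ex) (use p(1)[of n] in auto)
  then have "p = (\<lambda>n. f (h n))" by auto
  then show ?thesis using that[of h] h p(2) by blast
qed

lemma closure_imageI: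
  assumes "\<And>n. h n \<in> H" "(\<lambda>n. f (h n)) \<longlonglongrightarrow> (x::'a::metric_space)"
  shows "x \<in> closure (f ` H)"
  unfolding closure_sequential using assms by (intro exI[of _ "\<lambda>n. f (h n)"]) auto

lemma csubspace_image:
  assumes H: "csubspace H"
    and add: "\<And>x y. x \<in> H \<Longrightarrow> y \<in> H \<Longrightarrow> k (x + y) = k x + k y"
    and scale: "\<And>a x. x \<in> H \<Longrightarrow> k (a *\<^sub>C x) = a *\<^sub>C k x"
  shows "csubspace (k ` H)"
  unfolding csubspace_def
proof (intro conjI ballI allI)
  show "0 \<in> k ` H"
    using scale[of 0 0] csubspace_zero[OF H] by (metis image_eqI scaleC_zero_left)
  show "x + y \<in> k ` H" if "x \<in> k ` H" "y \<in> k ` H" for x y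
    using that by (auto simp: add[symmetric] csubspace_add[OF H])
  show "a *\<^sub>C x \<in> k ` H" if "x \<in> k ` H" for a x
    using that by (auto simp: scale[symmetric] csubspace_scaleC[OF H])
qed

text \<open>
  The closure of the joint graph \<open>{(f h, g h)}\<close> consists of pairs of vectors of equal norm, so
  it is the graph of an isometry; completeness makes its domain all of \<open>closure (f ` H)\<close>.
\<close>

lemma ex_unitary_if_norm_eq:
  fixes f :: "'c::complex_inner \<Rightarrow> 'a::complex_hilbert" and g :: "'c \<Rightarrow> 'b::complex_hilbert"
  assumes H: "csubspace H"
    and f: "\<And>x y. x \<in> H \<Longrightarrow> y \<in> H \<Longrightarrow> f (x + y) = f x + f y" "\<And>a x. x \<in> H \<Longrightarrow> f (a *\<^sub>C x) = a *\<^sub>C f x"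
    and g: "\<And>x y. x \<in> H \<Longrightarrow> y \<in> H \<Longrightarrow> g (x + y) = g x + g y" "\<And>a x. x \<in> H \<Longrightarrow> g (a *\<^sub>C x) = a *\<^sub>C g x"
    and norm: "\<And>x. x \<in> H \<Longrightarrow> norm (f x) = norm (g x)"
  shows "\<exists>J. unitary_op (closure (f ` H)) (closure (g ` H)) J \<and> (\<forall>h\<in>H. J (f h) = g h)"
proof -
  define G where "G = closure ((\<lambda>h. (f h, g h)) ` H)"
  define S R where "S = closure (f ` H)" and "R = closure (g ` H)"
  have G: "csubspace G"
    unfolding G_def by (intro csubspace_closure csubspace_image H) (auto simp: f g scaleC_prod_def)
  have S: "closed_csubspace S" and R: "closed_csubspace R"
    unfolding S_def R_def by (intro closed_csubspace_closure csubspace_image H f g; assumption)+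
  have "G \<subseteq> {p. norm (fst p) = norm (snd p)}"
    unfolding G_def
    by (intro closure_minimal closed_Collect_eq continuous_intros) (auto simp: norm)
  then have Gn: "norm x = norm y" if "(x, y) \<in> G" for x y using that by auto
  have G_unique: "y = y'" if "(x, y) \<in> G" "(x, y') \<in> G" for x y y'
    using Gn[of 0 "y - y'"] csubspace_diff[OF G that] by simp
  have G_in: "x \<in> S \<and> y \<in> R" if xy: "(x, y) \<in> G" for x y
  proof -
    obtain h where h: "\<And>n. h n \<in> H" "(\<lambda>n. (f (h n), g (h n))) \<longlonglongrightarrow> (x, y)"
      by (rule closure_imageE[OF xy[unfolded G_def]]) (rule that)
    have "x \<in> S" unfolding S_def using h(1) tendsto_fst[OF h(2)] by (intro closure_imageI[of h]) auto
    moreover have "y \<in> R" unfolding R_def using h(1) tendsto_snd[OF h(2)] by (intro closure_imageI[of h]) auto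
    ultimately show ?thesis ..
  qed
  have G_limit: "(x, y) \<in> G"
    if h: "\<And>n. h n \<in> H" and x: "(\<lambda>n. f (h n)) \<longlonglongrightarrow> x" and y: "(\<lambda>n. g (h n)) \<longlonglongrightarrow> y" for h x y
    unfolding G_def using h tendsto_Pair[OF x y] by (rule closure_imageI)
  have n_diff: "norm (f x - f y) = norm (g x - g y)" if "x \<in> H" "y \<in> H" for x y
  proof -
    have "f (x - y) = f x - f y" "g (x - y) = g x - g y"
      using f(1)[of "x - y" y] g(1)[of "x - y" y] csubspace_diff[OF H that] that by auto
    then show ?thesis using norm[OF csubspace_diff[OF H that]] by simp
  qed
  have ex1: "\<exists>y. (x, y) \<in> G" if x: "x \<in> S" for x
  proof -
    obtain h where h: "\<And>n. h n \<in> H" "(\<lambda>n. f (h n)) \<longlonglongrightarrow> x"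
      by (rule closure_imageE[OF x[unfolded S_def]]) (rule that)
    then have "Cauchy (\<lambda>n. f (h n))" using convergent_Cauchy convergentI by blast
    then have "Cauchy (\<lambda>n. g (h n))" using n_diff h(1) by (simp add: Cauchy_iff)
    then show ?thesis using G_limit[OF h] by (metis Cauchy_convergent_iff convergent_def)
  qed
  have ex2: "\<exists>x. (x, y) \<in> G" if y: "y \<in> R" for y
  proof -
    obtain h where h: "\<And>n. h n \<in> H" "(\<lambda>n. g (h n)) \<longlonglongrightarrow> y"
      by (rule closure_imageE[OF y[unfolded R_def]]) (rule that)
    then have "Cauchy (\<lambda>n. g (h n))" using convergent_Cauchy convergentI by blast
    then have "Cauchy (\<lambda>n. f (h n))" using n_diff h(1) by (simp add: Cauchy_iff)
    then show ?thesis using G_limit[OF h(1) _ h(2)] by (metis Cauchy_convergent_iff convergent_def)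
  qed
  define J where "J x = (SOME y. (x, y) \<in> G)" for x
  have J: "(x, J x) \<in> G" if "x \<in> S" for x
    unfolding J_def using someI_ex[OF ex1[OF that]] .
  have JI: "J x = y" if "(x, y) \<in> G" for x y
    using G_unique[OF J that] G_in[OF that] by blast
  have "isometry_op S R J"
    unfolding isometry_op_def bounded_op_def
  proof (intro conjI ballI allI exI[of _ 1])
    fix x y assume xy: "x \<in> S" "y \<in> S"
    show "J (x + y) = J x + J y"
      using csubspace_add[OF G J[OF xy(1)] J[OF xy(2)]] by (intro JI) simp
  next
    fix a x assume x: "x \<in> S"
    show "J (a *\<^sub>C x) = a *\<^sub>C J x"
      using csubspace_scaleC[OF G J[OF x]] by (intro JI) (simp add: scaleC_prod_def)
  next
    fix x assume x: "x \<in> S"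
    show "J x \<in> R" using G_in J[OF x] by blast
    show "norm (J x) \<le> 1 * norm x" "norm (J x) = norm x" using Gn J[OF x] by force+
  qed
  then have "unitary_op S R J"
  proof (rule unitary_op_if_dense_range[OF S closed_csubspaceD(1)[OF R]])
    fix y assume y: "y \<in> R" "\<And>x. x \<in> S \<Longrightarrow> cinner (J x) y = 0"
    obtain x where "(x, y) \<in> G" using ex2[OF y(1)] by blast
    then have "cinner y y = 0" using y(2)[of x] JI G_in by metis
    then show "y = 0" by (simp add: cinner_self_eq_0)
  qed
  moreover have "J (f h) = g h" if "h \<in> H" for h
  proof (rule JI)
    have "(f h, g h) \<in> (\<lambda>h. (f h, g h)) ` H" using that by blast
    then show "(f h, g h) \<in> G" unfolding G_def by (rule subsetD[OF closure_subset])
  qed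
  ultimately show ?thesis unfolding S_def R_def by blast
qed

section \<open>Toeplitz operators in terms of Taylor coefficients\<close>

definition hardy_of :: "(nat \<Rightarrow> 'a::complex_hilbert) \<Rightarrow> 'a hardy" where
  "hardy_of a = (SOME f. hardy_coeff f = a)"

lemma hardy_coeff_hardy_of: "square_summable a \<Longrightarrow> hardy_coeff (hardy_of a) = a"
  unfolding hardy_of_def by (rule someI_ex) (rule ex_hardy_coeff)

lemma hardy_coeff_Abs_hardy:
  assumes "has_powser g a" "square_summable a" "\<And>z. cmod z \<ge> 1 \<Longrightarrow> g z = 0"
  shows "hardy_coeff (Abs_hardy g) = a"
proof -
  have "hardy_fun (Abs_hardy g) = g" using assms by (intro Abs_hardy_inverse) auto
  then show ?thesis using assms(1) by (intro hardy_coeff_eqI) simp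
qed

lemma cinner_hardy_sums: "(\<lambda>n. cinner (hardy_coeff f n) (hardy_coeff g n)) sums cinner f g"
  unfolding cinner_hardy_def
  by (intro summable_sums summable_cinner square_summable_hardy_coeff)

lemma norm_hardy_sums: "(\<lambda>n. (norm (hardy_coeff f n))\<^sup>2) sums (norm f)\<^sup>2"
proof -
  have "(\<lambda>n. (norm (hardy_coeff f n))\<^sup>2) sums (\<Sum>n. (norm (hardy_coeff f n))\<^sup>2)"
    using square_summable_hardy_coeff[of f] unfolding square_summable_def by (rule summable_sums)
  then show ?thesis
    unfolding power2_norm_eq_inner inner_hardy_def .
qed

lemma square_summable_bounded_op:
  assumes "bounded_op S R A" "\<And>n. x n \<in> S" "square_summable x"
  shows "square_summable (\<lambda>n. A (x n))"
proof -
  obtain c where c: "\<And>x. x \<in> S \<Longrightarrow> norm (A x) \<le> c * norm x"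
    using assms(1) unfolding bounded_op_def by blast
  show ?thesis
    unfolding square_summable_def
  proof (rule summable_comparison_test')
    show "summable (\<lambda>n. c\<^sup>2 * (norm (x n))\<^sup>2)"
      using assms(3) unfolding square_summable_def by (rule summable_mult)
    show "norm ((norm (A (x n)))\<^sup>2) \<le> c\<^sup>2 * (norm (x n))\<^sup>2" for n
      using power_mono[OF c[OF assms(2)[of n]], of 2] by (simp add: power_mult_distrib)
  qed
qed

lemma bounded_op_zero:
  assumes "csubspace S" "bounded_op S R A"
  shows "A 0 = 0"
proof -
  have "A (0 *\<^sub>C 0) = 0 *\<^sub>C A 0"
    using assms csubspace_zero unfolding bounded_op_def by blast
  then show ?thesis by (simp add: scaleC_zero_left)
qed

lemma has_powser_bounded_op:
  assumes S: "closed_csubspace S" and A: "bounded_op S R A"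
    and a: "\<And>n. a n \<in> S" "has_powser g a"
  shows "has_powser (\<lambda>z. A (g z)) (\<lambda>n. A (a n))"
  unfolding has_powser_def
proof (intro allI impI)
  fix z :: complex assume z: "cmod z < 1"
  have "(\<lambda>n. A (z ^ n *\<^sub>C a n)) sums A (g z)"
    using a z csubspace_scaleC[OF closed_csubspaceD(1)[OF S]]
    by (intro bounded_op_sums[OF S A]) (auto simp: has_powser_def)
  then show "(\<lambda>n. z ^ n *\<^sub>C A (a n)) sums A (g z)"
    using A a(1) by (simp add: bounded_op_def)
qed

text \<open>
  If all values of \<open>f\<close> lie in \<open>E\<close> then \<open>f\<close> does not change when it is composed with the
  projection onto \<open>E\<close>, and by uniqueness neither do its coefficients.
\<close>

lemma H2_iff_coeff:
  assumes E: "closed_csubspace E"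
  shows "f \<in> H2 E \<longleftrightarrow> (\<forall>n. hardy_coeff f n \<in> E)"
proof
  note Es = closed_csubspaceD(1)[OF E]
  assume f: "f \<in> H2 E"
  define p where "p = adj E (\<lambda>x. x)"
  have "bounded_op E UNIV (\<lambda>x. x)"
    by (auto simp: bounded_op_def intro!: exI[of _ 1])
  then have pair: "adjoint_pair UNIV E p (\<lambda>x. x)"
    unfolding p_def by (rule adjoint_pair_sym[OF adjoint_pair_adj[OF E]])
  have p: "p x = x" if "x \<in> E" for x
    unfolding p_def using that by (intro adj_eqI[OF Es]) auto
  have "bounded_op UNIV E p"
    using pair p Es by (intro bounded_op_if_adjoint_isometric[of UNIV E p "\<lambda>x. x"]) auto
  then have "has_powser (\<lambda>z. p (hardy_fun f z)) (\<lambda>n. p (hardy_coeff f n))"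
    by (rule has_powser_bounded_op[OF closed_csubspace_UNIV _ UNIV_I has_powser_hardy])
  moreover have "p (hardy_fun f z) = hardy_fun f z" for z
    using f p by (simp add: H2_def)
  ultimately have "has_powser (hardy_fun f) (\<lambda>n. p (hardy_coeff f n))" by simp
  then have "hardy_coeff f = (\<lambda>n. p (hardy_coeff f n))" by (rule hardy_coeff_eqI)
  then show "\<forall>n. hardy_coeff f n \<in> E"
    using adjoint_pair_in1[OF pair] by (metis UNIV_I)
next
  note Es = closed_csubspaceD(1)[OF E]
  assume a: "\<forall>n. hardy_coeff f n \<in> E"
  have "hardy_fun f z \<in> E" for z
  proof (cases "cmod z < 1")
    case True
    then have "(\<lambda>n. z ^ n *\<^sub>C hardy_coeff f n) sums hardy_fun f z"
      using has_powser_hardy unfolding has_powser_def by blast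
    from closed_sums[OF E _ this] a show ?thesis by (simp add: csubspace_scaleC[OF Es])
  qed (use csubspace_zero[OF Es] in \<open>simp add: hardy_fun_outside\<close>)
  then show "f \<in> H2 E" by (simp add: H2_def)
qed

lemma csubspace_H2: "closed_csubspace E \<Longrightarrow> csubspace (H2 E)"
  using closed_csubspaceD(1)[of E]
  by (auto simp: csubspace_def[of "H2 E"] H2_iff_coeff hardy_coeff_linear csubspace_zero
      csubspace_add csubspace_scaleC)

lemma square_summable_case_nat:
  "square_summable a \<Longrightarrow> square_summable (case_nat c a)"
  unfolding square_summable_def by (subst summable_Suc_iff[symmetric]) simp

lemma square_summable_Suc:
  "square_summable a \<Longrightarrow> square_summable (\<lambda>n. a (Suc n))"
  unfolding square_summable_def by (subst (asm) summable_Suc_iff[symmetric]) simp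

lemma hardy_coeff_mult_z: "hardy_coeff (mult_z f) = case_nat 0 (hardy_coeff f)"
  unfolding mult_z_def
proof (rule hardy_coeff_Abs_hardy)
  show "has_powser (\<lambda>z. z *\<^sub>C hardy_fun f z) (case_nat 0 (hardy_coeff f))"
    unfolding has_powser_def
  proof (intro allI impI)
    fix z :: complex assume "cmod z < 1"
    then have "(\<lambda>n. z ^ n *\<^sub>C hardy_coeff f n) sums hardy_fun f z"
      using has_powser_hardy unfolding has_powser_def by blast
    then have "(\<lambda>n. z *\<^sub>C (z ^ n *\<^sub>C hardy_coeff f n)) sums (z *\<^sub>C hardy_fun f z)"
      by (rule bounded_linear.sums[OF bounded_linear_scaleC])
    then have "(\<lambda>n. z ^ Suc n *\<^sub>C case_nat 0 (hardy_coeff f) (Suc n)) sums (z *\<^sub>C hardy_fun f z)"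
      by (simp add: scaleC_scaleC)
    then have "(\<lambda>n. z ^ n *\<^sub>C case_nat 0 (hardy_coeff f) n) sums
        (z *\<^sub>C hardy_fun f z + z ^ 0 *\<^sub>C case_nat 0 (hardy_coeff f) 0)"
      by (subst (asm) sums_Suc_iff)
    then show "(\<lambda>n. z ^ n *\<^sub>C case_nat 0 (hardy_coeff f) n) sums (z *\<^sub>C hardy_fun f z)"
      by (simp add: scaleC_zero_right)
  qed
qed (auto simp: square_summable_case_nat square_summable_hardy_coeff hardy_fun_outside
      scaleC_zero_right)

lemma hardy_coeff_adj_mult_z:
  assumes E: "closed_csubspace E" and f: "f \<in> H2 E"
  shows "hardy_coeff (adj (H2 E) mult_z f) = (\<lambda>n. hardy_coeff f (Suc n))"
proof -
  define B where "B g = hardy_of (\<lambda>n. hardy_coeff g (Suc n))" for g :: "'a hardy"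
  have B: "hardy_coeff (B g) = (\<lambda>n. hardy_coeff g (Suc n))" for g
    unfolding B_def by (intro hardy_coeff_hardy_of square_summable_Suc square_summable_hardy_coeff)
  have "adjoint_pair (H2 E) (H2 E) mult_z B"
  proof (rule adjoint_pairI)
    fix g h :: "'a hardy"
    have "(\<lambda>n. cinner (hardy_coeff (mult_z g) (Suc n)) (hardy_coeff h (Suc n))) sums
        (cinner (mult_z g) h - cinner (hardy_coeff (mult_z g) 0) (hardy_coeff h 0))"
      using cinner_hardy_sums[of "mult_z g" h]
        sums_Suc_iff[of "\<lambda>n. cinner (hardy_coeff (mult_z g) n) (hardy_coeff h n)"] by simp
    then have "(\<lambda>n. cinner (hardy_coeff g n) (hardy_coeff (B h) n)) sums cinner (mult_z g) h"
      by (simp add: hardy_coeff_mult_z B cinner_zero_left)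
    then show "cinner (mult_z g) h = cinner g (B h)"
      using cinner_hardy_sums sums_unique2 by blast
  next
    fix g assume "g \<in> H2 E"
    then show "mult_z g \<in> H2 E" "B g \<in> H2 E"
      using csubspace_zero[OF closed_csubspaceD(1)[OF E]]
      by (simp_all add: H2_iff_coeff[OF E] B hardy_coeff_mult_z split: nat.split)
  qed
  then show ?thesis
    using adj_adjoint_pair[OF csubspace_H2[OF E] _ f] B by simp
qed

lemma hardy_coeff_pointwise_op:
  assumes E: "closed_csubspace E" and A: "bounded_op E R A" and f: "f \<in> H2 E"
  shows "hardy_coeff (pointwise_op A f) = (\<lambda>n. A (hardy_coeff f n))"
  unfolding pointwise_op_def using f
  by (intro hardy_coeff_Abs_hardy has_powser_bounded_op[OF E A] square_summable_bounded_op[OF A])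
    (auto simp: H2_iff_coeff[OF E] has_powser_hardy square_summable_hardy_coeff hardy_fun_outside
      bounded_op_zero[OF closed_csubspaceD(1)[OF E] A])

lemma hardy_coeff_toeplitz:
  assumes E: "closed_csubspace E" and A: "bounded_op E R A" and B: "bounded_op E R B"
    and f: "f \<in> H2 E"
  shows "hardy_coeff (toeplitz E A B f) n = A (hardy_coeff f n) + B (hardy_coeff f (Suc n))"
proof -
  have "adj (H2 E) mult_z f \<in> H2 E"
    using f by (simp add: H2_iff_coeff[OF E] hardy_coeff_adj_mult_z[OF E f])
  then show ?thesis
    by (simp add: toeplitz_def hardy_coeff_linear hardy_coeff_pointwise_op[OF E A f]
        hardy_coeff_pointwise_op[OF E B] hardy_coeff_adj_mult_z[OF E f])
qed

lemma cinner_hardy_single: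
  assumes "\<And>n. n \<noteq> k \<Longrightarrow> hardy_coeff f n = 0"
  shows "cinner f g = cinner (hardy_coeff f k) (hardy_coeff g k)"
  unfolding cinner_hardy_def
  using suminf_finite[of "{k}" "\<lambda>n. cinner (hardy_coeff f n) (hardy_coeff g n)"] assms
  by (simp add: cinner_zero_left)

section \<open>Spaces of square-summable sequences\<close>

lemma seq_Abs_ell2: "square_summable x \<Longrightarrow> seq (Abs_ell2 x) = x"
  by (simp add: Abs_ell2_inverse)

lemma ell2_eqI: "(\<And>k. seq x k = seq y k) \<Longrightarrow> x = y"
  by (simp add: seq_inject[symmetric] fun_eq_iff)

lemma cinner_ell2_sums: "(\<lambda>n. cinner (seq x n) (seq y n)) sums cinner x y"
  unfolding cinner_ell2_def by (intro summable_sums summable_cinner square_summable_seq)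

lemma bounded_linear_seq: "bounded_linear (\<lambda>x. seq x n)"
  by (rule bounded_linear_intro[where K=1])
    (auto simp: plus_ell2.rep_eq scaleR_ell2.rep_eq norm_seq_le)

lemma closed_csubspace_ell2_in:
  assumes "closed_csubspace E"
  shows "closed_csubspace (ell2_in E)"
proof -
  have "ell2_in E = (\<Inter>k. (\<lambda>x. seq x k) -` E)" by (auto simp: ell2_in_def)
  moreover have "closed ((\<lambda>x. seq x k) -` E)" for k
    using closed_csubspaceD(2)[OF assms]
      linear_continuous_on[OF bounded_linear_seq, of UNIV k]
    by (intro continuous_closed_vimage) (auto simp: continuous_on_eq_continuous_at)
  moreover have "csubspace (ell2_in E)"
    using closed_csubspaceD(1)[OF assms]
    by (auto simp: csubspace_def ell2_in_def zero_ell2.rep_eq plus_ell2.rep_eq scaleC_ell2.rep_eq)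
  ultimately show ?thesis by (simp add: closed_csubspace_def closed_INT)
qed

lemma closed_csubspace_Times:
  assumes "closed_csubspace S" "closed_csubspace R"
  shows "closed_csubspace (S \<times> R)"
  using assms by (auto simp: closed_csubspace_def csubspace_def closed_Times scaleC_prod_def zero_prod_def)

section \<open>Products of commuting operators\<close>

lemma op_prod_cong: "(\<And>i. i \<in> {1..m} \<Longrightarrow> A i = B i) \<Longrightarrow> op_prod A m = op_prod B m"
  by (induction m) auto

lemma op_prod_in:
  "(\<And>i x. i \<in> {1..m} \<Longrightarrow> x \<in> S \<Longrightarrow> A i x \<in> S) \<Longrightarrow> x \<in> S \<Longrightarrow> op_prod A m x \<in> S"
  by (induction m arbitrary: x) auto

lemma op_prod_rev_in:
  "(\<And>i x. i \<in> {1..m} \<Longrightarrow> x \<in> S \<Longrightarrow> A i x \<in> S) \<Longrightarrow> x \<in> S \<Longrightarrow> op_prod_rev A m x \<in> S"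
  by (induction m) auto

lemma op_prod_adjoint_pair:
  assumes "\<And>i. i \<in> {1..m} \<Longrightarrow> adjoint_pair S S (A i) (B i)"
  shows "adjoint_pair S S (op_prod A m) (op_prod_rev B m)"
  using assms
proof (induction m)
  case (Suc m)
  have "adjoint_pair S S (\<lambda>x. op_prod A m (A (Suc m) x)) (\<lambda>x. B (Suc m) (op_prod_rev B m x))"
    by (rule adjoint_pair_comp) (use Suc in auto)
  then show ?case by (simp add: o_def)
qed (simp add: adjoint_pair_def)

lemma op_prod_left_inverse:
  assumes "\<And>i x. i \<in> {1..m} \<Longrightarrow> x \<in> S \<Longrightarrow> B i x \<in> S"
    and "\<And>i x. i \<in> {1..m} \<Longrightarrow> x \<in> S \<Longrightarrow> A i (B i x) = x" and "x \<in> S"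
  shows "op_prod A m (op_prod_rev B m x) = x"
  using assms
proof (induction m)
  case (Suc m)
  have "op_prod_rev B m x \<in> S"
    by (rule op_prod_rev_in) (use Suc.prems in auto)
  then show ?case using Suc by simp
qed simp

lemma op_prod_commutes:
  assumes "\<And>i x. i \<in> {1..m} \<Longrightarrow> x \<in> S \<Longrightarrow> A i x \<in> S"
    and "\<And>i x. i \<in> {1..m} \<Longrightarrow> x \<in> S \<Longrightarrow> C (A i x) = A i (C x)" and "x \<in> S"
  shows "C (op_prod A m x) = op_prod A m (C x)"
  using assms by (induction m arbitrary: x) auto

lemma op_prod_rev_eq_op_prod:
  assumes "\<And>i x. i \<in> {1..m} \<Longrightarrow> x \<in> S \<Longrightarrow> A i x \<in> S" "commuting_tuple S m A" "x \<in> S"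
  shows "op_prod_rev A m x = op_prod A m x"
  using assms
proof (induction m)
  case (Suc m)
  have "A (Suc m) (op_prod A m x) = op_prod A m (A (Suc m) x)"
    by (rule op_prod_commutes) (use Suc.prems in \<open>auto simp: commuting_tuple_def\<close>)
  then show ?case using Suc by (simp add: commuting_tuple_def)
qed simp

lemma op_prod_extract:
  assumes "\<And>i x. i \<in> {1..m} \<Longrightarrow> x \<in> S \<Longrightarrow> A i x \<in> S" "commuting_tuple S m A"
    "x \<in> S" "i \<in> {1..m}"
  shows "op_prod A m x = A i (op_prod (A(i := id)) m x)"
  using assms
proof (induction m arbitrary: x)
  case (Suc m)
  show ?case
  proof (cases "i = Suc m")
    case True
    have skip: "op_prod (A(i := id)) (Suc m) = op_prod A m"
      using op_prod_cong[of m "A(i := id)" A] True by (simp add: fun_eq_iff)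
    have "op_prod A (Suc m) x = A (Suc m) (op_prod A m x)"
      using op_prod_commutes[of m S A "A (Suc m)" x] Suc.prems
      by (auto simp: commuting_tuple_def)
    then show ?thesis unfolding skip unfolding True .
  next
    case False
    then show ?thesis using Suc by (simp add: commuting_tuple_def)
  qed
qed simp

section \<open>Commuting isometries: the Wold decomposition\<close>

text \<open>
  A commuting tuple of co-isometries \<open>Z\<close> on \<open>S\<close>, given together with the isometries \<open>V\<close>
  adjoint to it.
\<close>

locale commuting_isometries =
  fixes S :: "'k::complex_hilbert set" and n :: nat and Z V :: "nat \<Rightarrow> 'k \<Rightarrow> 'k"
  assumes closed_S: "closed_csubspace S"
    and pair: "i \<in> {1..n} \<Longrightarrow> adjoint_pair S S (Z i) (V i)"
    and ZV: "i \<in> {1..n} \<Longrightarrow> x \<in> S \<Longrightarrow> Z i (V i x) = x"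
    and V_commute: "i \<in> {1..n} \<Longrightarrow> j \<in> {1..n} \<Longrightarrow> x \<in> S \<Longrightarrow> V i (V j x) = V j (V i x)"
begin

lemmas Ss = closed_csubspaceD(1)[OF closed_S]

lemma zero_in [simp]: "0 \<in> S"
  and add_in [simp]: "x \<in> S \<Longrightarrow> y \<in> S \<Longrightarrow> x + y \<in> S"
  and diff_in [simp]: "x \<in> S \<Longrightarrow> y \<in> S \<Longrightarrow> x - y \<in> S"
  using Ss by (simp_all add: csubspace_zero csubspace_add csubspace_diff)

lemma V_in [simp]: "i \<in> {1..n} \<Longrightarrow> x \<in> S \<Longrightarrow> V i x \<in> S"
  and Z_in [simp]: "i \<in> {1..n} \<Longrightarrow> x \<in> S \<Longrightarrow> Z i x \<in> S"
  using pair adjoint_pair_in1 adjoint_pair_in2 by metis+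

lemma Z_commute:
  assumes "i \<in> {1..n}" "j \<in> {1..n}" "x \<in> S"
  shows "Z i (Z j x) = Z j (Z i x)"
proof (rule cinner_eqI[OF Ss])
  fix y assume "y \<in> S"
  then show "cinner (Z i (Z j x)) y = cinner (Z j (Z i x)) y"
    using assms by (simp add: adjoint_pair_eq[OF pair] V_commute[of i j])
qed (use assms in auto)

lemma commuting_V: "commuting_tuple S n V" and commuting_Z: "commuting_tuple S n Z"
  using V_commute Z_commute by (auto simp: commuting_tuple_def)

abbreviation VV where "VV \<equiv> op_prod V n"
abbreviation ZZ where "ZZ \<equiv> op_prod Z n"

text \<open>The products in which the factor number \<open>i\<close> is left out.\<close>

definition V' where "V' i = op_prod (V(i := id)) n"
definition Z' where "Z' i = op_prod (Z(i := id)) n"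

lemma VV_pair: "adjoint_pair S S ZZ VV"
  using op_prod_adjoint_pair[of n S Z V] pair
    adjoint_pair_cong[of S ZZ ZZ S "op_prod_rev V n" VV]
    op_prod_rev_eq_op_prod[of n S V] commuting_V V_in by auto

lemma VV_in [simp]: "x \<in> S \<Longrightarrow> VV x \<in> S"
  and ZZ_in [simp]: "x \<in> S \<Longrightarrow> ZZ x \<in> S"
  using adjoint_pair_in1[OF VV_pair] adjoint_pair_in2[OF VV_pair] by auto

lemma ZZVV [simp]: "x \<in> S \<Longrightarrow> ZZ (VV x) = x"
  using op_prod_left_inverse[of n S V Z x] op_prod_rev_eq_op_prod[of n S V x]
    commuting_V V_in ZV by auto

lemma V'_pair:
  assumes "i \<in> {1..n}"
  shows "adjoint_pair S S (Z' i) (V' i)"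
proof -
  have "adjoint_pair S S ((Z(i := id)) j) ((V(i := id)) j)" if "j \<in> {1..n}" for j
    using that pair by (auto simp: adjoint_pair_def)
  then have "adjoint_pair S S (op_prod (Z(i := id)) n) (op_prod_rev (V(i := id)) n)"
    by (rule op_prod_adjoint_pair)
  moreover have "op_prod_rev (V(i := id)) n x = op_prod (V(i := id)) n x" if "x \<in> S" for x
    by (rule op_prod_rev_eq_op_prod[OF _ _ that]) (use V_commute in \<open>auto simp: commuting_tuple_def\<close>)
  ultimately show ?thesis
    unfolding Z'_def V'_def by (simp add: adjoint_pair_def)
qed

lemma V'_in [simp]: "i \<in> {1..n} \<Longrightarrow> x \<in> S \<Longrightarrow> V' i x \<in> S"
  and Z'_in [simp]: "i \<in> {1..n} \<Longrightarrow> x \<in> S \<Longrightarrow> Z' i x \<in> S"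
  using V'_pair adjoint_pair_in1 adjoint_pair_in2 by metis+

lemma V'_V_commute:
  assumes "i \<in> {1..n}" "j \<in> {1..n}" "x \<in> S"
  shows "V j (V' i x) = V' i (V j x)"
  unfolding V'_def
  by (rule op_prod_commutes[where S=S]) (use assms V_commute in auto)

lemma V'_V'_commute:
  assumes "i \<in> {1..n}" "j \<in> {1..n}" "x \<in> S"
  shows "V' j (V' i x) = V' i (V' j x)"
  unfolding V'_def[of i]
  by (rule op_prod_commutes[where S=S]) (use assms V'_V_commute in auto)

lemma VV_eq:
  assumes "i \<in> {1..n}" "x \<in> S"
  shows "V i (V' i x) = VV x" "V' i (V i x) = VV x"
  using op_prod_extract[of n S V x i] V'_V_commute[of i i x] assms commuting_V
  by (auto simp: V'_def)

lemma ZZ_eq: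
  assumes "i \<in> {1..n}" "x \<in> S"
  shows "Z i (Z' i x) = ZZ x" "Z' i (Z i x) = ZZ x"
proof -
  have "Z i (Z' i x) \<in> S" "Z' i (Z i x) \<in> S" using assms by auto
  then show "Z i (Z' i x) = ZZ x" "Z' i (Z i x) = ZZ x"
    using assms
    by (auto intro!: cinner_eqI[OF Ss] simp: adjoint_pair_eq[OF pair] adjoint_pair_eq[OF V'_pair]
        adjoint_pair_eq[OF VV_pair] VV_eq)
qed

lemma Z'V':
  assumes "i \<in> {1..n}" "x \<in> S"
  shows "Z' i (V' i x) = x"
proof -
  have "Z' i (V' i x) = Z' i (Z i (V i (V' i x)))" using assms by (simp add: ZV)
  then show ?thesis using assms by (simp add: ZZ_eq VV_eq)
qed

lemma Z_Z'_commute: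
  assumes "i \<in> {1..n}" "j \<in> {1..n}" "x \<in> S"
  shows "Z j (Z' i x) = Z' i (Z j x)"
  using assms
  by (intro cinner_eqI[OF Ss]) (auto simp: adjoint_pair_eq[OF pair] adjoint_pair_eq[OF V'_pair]
      V'_V_commute)

lemma Z'_Z'_commute:
  assumes "i \<in> {1..n}" "j \<in> {1..n}" "x \<in> S"
  shows "Z' j (Z' i x) = Z' i (Z' j x)"
  using assms
  by (intro cinner_eqI[OF Ss]) (auto simp: adjoint_pair_eq[OF V'_pair] V'_V'_commute)

lemma VV_V_commute: "i \<in> {1..n} \<Longrightarrow> x \<in> S \<Longrightarrow> VV (V i x) = V i (VV x)"
  by (simp add: VV_eq(1)[symmetric] V'_V_commute)

lemma ZZ_Z_commute: "i \<in> {1..n} \<Longrightarrow> x \<in> S \<Longrightarrow> ZZ (Z i x) = Z i (ZZ x)"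
  by (simp add: ZZ_eq(1)[symmetric] Z_Z'_commute)

lemma ZZ_Z'_commute: "i \<in> {1..n} \<Longrightarrow> x \<in> S \<Longrightarrow> ZZ (Z' i x) = Z' i (ZZ x)"
  by (simp add: ZZ_eq(1)[symmetric] Z_Z'_commute[of i i])

lemma ZZ_V: "i \<in> {1..n} \<Longrightarrow> x \<in> S \<Longrightarrow> ZZ (V i x) = Z' i x"
  by (simp add: ZZ_eq(2)[symmetric] ZV)

lemma ZZ_V': "i \<in> {1..n} \<Longrightarrow> x \<in> S \<Longrightarrow> ZZ (V' i x) = Z i x"
  by (simp add: ZZ_eq(1)[symmetric] Z'V')

lemma Z_VV: "i \<in> {1..n} \<Longrightarrow> x \<in> S \<Longrightarrow> Z i (VV x) = V' i x"
  by (simp add: VV_eq(1)[symmetric] ZV)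

lemmas V_linear =
  adjoint_pair_add[OF Ss Ss adjoint_pair_sym[OF pair]] adjoint_pair_diff[OF Ss Ss adjoint_pair_sym[OF pair]]
  adjoint_pair_zero[OF Ss Ss adjoint_pair_sym[OF pair]]
lemmas Z_linear =
  adjoint_pair_add[OF Ss Ss pair] adjoint_pair_diff[OF Ss Ss pair] adjoint_pair_zero[OF Ss Ss pair]
lemmas V'_linear =
  adjoint_pair_add[OF Ss Ss adjoint_pair_sym[OF V'_pair]] adjoint_pair_diff[OF Ss Ss adjoint_pair_sym[OF V'_pair]]
  adjoint_pair_zero[OF Ss Ss adjoint_pair_sym[OF V'_pair]]
lemmas Z'_linear =
  adjoint_pair_add[OF Ss Ss V'_pair] adjoint_pair_diff[OF Ss Ss V'_pair] adjoint_pair_zero[OF Ss Ss V'_pair]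
lemmas VV_linear =
  adjoint_pair_add[OF Ss Ss adjoint_pair_sym[OF VV_pair]] adjoint_pair_diff[OF Ss Ss adjoint_pair_sym[OF VV_pair]]
  adjoint_pair_zero[OF Ss Ss adjoint_pair_sym[OF VV_pair]]
lemmas ZZ_linear =
  adjoint_pair_add[OF Ss Ss VV_pair] adjoint_pair_diff[OF Ss Ss VV_pair] adjoint_pair_zero[OF Ss Ss VV_pair]

lemma ZZ_power_in [simp]: "x \<in> S \<Longrightarrow> (ZZ ^^ k) x \<in> S"
  and VV_power_in [simp]: "x \<in> S \<Longrightarrow> (VV ^^ k) x \<in> S"
  by (induction k) auto

lemma ZZ_power_pair: "adjoint_pair S S (ZZ ^^ k) (VV ^^ k)"
proof (induction k)
  case (Suc k)
  have "adjoint_pair S S (\<lambda>x. (ZZ ^^ k) (ZZ x)) (\<lambda>x. VV ((VV ^^ k) x))"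
    by (rule adjoint_pair_comp[OF VV_pair Suc])
  then show ?case by (simp add: o_def funpow_swap1)
qed (simp add: adjoint_pair_def)

lemmas ZZ_power_linear = adjoint_pair_add[OF Ss Ss ZZ_power_pair]
  adjoint_pair_diff[OF Ss Ss ZZ_power_pair] adjoint_pair_scaleC[OF Ss Ss ZZ_power_pair]
  adjoint_pair_zero[OF Ss Ss ZZ_power_pair]

lemma ZZ_power_VV_power: "x \<in> S \<Longrightarrow> (ZZ ^^ k) ((VV ^^ k) x) = x"
proof (induction k)
  case (Suc k)
  then show ?case by (simp add: funpow_swap1[of ZZ])
qed simp

lemma norm_ZZ_power_le: "x \<in> S \<Longrightarrow> norm ((ZZ ^^ k) x) \<le> norm x"
  by (rule contractive_if_adjoint_isometric[OF ZZ_power_pair ZZ_power_VV_power])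

lemma norm_Z_le: "i \<in> {1..n} \<Longrightarrow> x \<in> S \<Longrightarrow> norm (Z i x) \<le> norm x"
  by (rule contractive_if_adjoint_isometric[OF pair ZV])

lemma norm_V: "i \<in> {1..n} \<Longrightarrow> x \<in> S \<Longrightarrow> norm (V i x) = norm x"
  using adjoint_pair_eq[OF pair, of i "V i x" x] by (intro norm_eq_cinner) (simp add: ZV)

text \<open>
  The vectors annihilated by some power of the product \<open>ZZ\<close> form a subspace that is invariant
  under all \<open>Z i\<close> and \<open>V i\<close>. Its closure is the pure part, its complement the unitary part.
\<close>

definition nil where "nil = {w\<in>S. \<exists>k. (ZZ ^^ k) w = 0}"
definition pure_part where "pure_part = closure nil"
definition unitary_part where "unitary_part = {x\<in>S. \<forall>w\<in>nil. cinner x w = 0}"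

lemma nil_power_mono:
  assumes "x \<in> S" "(ZZ ^^ k) x = 0" "k \<le> m"
  shows "(ZZ ^^ m) x = 0"
proof -
  have "(ZZ ^^ m) x = (ZZ ^^ (m - k)) ((ZZ ^^ k) x)"
    using assms(3) by (simp add: funpow_add[symmetric, THEN fun_cong, simplified])
  then show ?thesis using assms(2) by (simp add: ZZ_power_linear)
qed

lemma csubspace_nil: "csubspace nil"
  unfolding csubspace_def
proof (intro conjI ballI allI)
  show "0 \<in> nil" by (auto simp: nil_def intro!: exI[of _ 0])
next
  fix x y assume "x \<in> nil" "y \<in> nil"
  then obtain j k where xy: "x \<in> S" "y \<in> S" "(ZZ ^^ j) x = 0" "(ZZ ^^ k) y = 0"
    by (auto simp: nil_def)
  then have "(ZZ ^^ (max j k)) (x + y) = 0"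
    using nil_power_mono[of x j "max j k"] nil_power_mono[of y k "max j k"]
    by (simp add: ZZ_power_linear)
  then show "x + y \<in> nil" using xy by (auto simp: nil_def)
next
  fix a x assume "x \<in> nil"
  then obtain k where "x \<in> S" "(ZZ ^^ k) x = 0" by (auto simp: nil_def)
  then show "a *\<^sub>C x \<in> nil"
    by (auto simp: nil_def ZZ_power_linear csubspace_scaleC[OF Ss] scaleC_zero_right intro!: exI[of _ k])
qed

lemma ZZ_power_Z: "i \<in> {1..n} \<Longrightarrow> x \<in> S \<Longrightarrow> (ZZ ^^ k) (Z i x) = Z i ((ZZ ^^ k) x)"
  by (induction k) (simp_all add: ZZ_Z_commute)

lemma ZZ_power_Z': "i \<in> {1..n} \<Longrightarrow> x \<in> S \<Longrightarrow> (ZZ ^^ k) (Z' i x) = Z' i ((ZZ ^^ k) x)"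
  by (induction k) (simp_all add: ZZ_Z'_commute)

lemma Z_nil:
  assumes "i \<in> {1..n}" "x \<in> nil"
  shows "Z i x \<in> nil"
proof -
  obtain k where k: "x \<in> S" "(ZZ ^^ k) x = 0" using assms by (auto simp: nil_def)
  then have "(ZZ ^^ k) (Z i x) = 0" using assms(1) Z_linear(3)[OF assms(1)] by (simp add: ZZ_power_Z)
  then show ?thesis using assms(1) k(1) unfolding nil_def by auto
qed

lemma V_nil:
  assumes "i \<in> {1..n}" "x \<in> nil"
  shows "V i x \<in> nil"
proof -
  obtain k where k: "x \<in> S" "(ZZ ^^ k) x = 0" using assms by (auto simp: nil_def)
  have "(ZZ ^^ Suc k) (V i x) = (ZZ ^^ k) (ZZ (V i x))" by (simp add: funpow_swap1)
  also have "\<dots> = 0"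
    using assms(1) k Z'_linear(3)[OF assms(1)] by (simp add: ZZ_V ZZ_power_Z')
  finally show ?thesis using V_in[OF assms(1) k(1)] unfolding nil_def by blast
qed

lemma pure_part_closed: "closed_csubspace pure_part"
  unfolding pure_part_def by (rule closed_csubspace_closure[OF csubspace_nil])

lemma nil_subset: "nil \<subseteq> pure_part" "pure_part \<subseteq> S"
proof -
  have "nil \<subseteq> S" by (auto simp: nil_def)
  then show "nil \<subseteq> pure_part" "pure_part \<subseteq> S"
    unfolding pure_part_def using closed_csubspaceD(2)[OF closed_S]
    by (auto simp: closure_subset intro: closure_minimal[THEN subsetD])
qed

lemma unitary_part_closed: "closed_csubspace unitary_part"
  unfolding unitary_part_def by (rule orthogonal_complement_closed[OF closed_S])

lemma closure_invariant:
  assumes A: "\<And>x. x \<in> M \<Longrightarrow> A x \<in> M" and M: "M \<subseteq> S"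
    and contr: "\<And>x y. x \<in> S \<Longrightarrow> y \<in> S \<Longrightarrow> norm (A x - A y) \<le> norm (x - y)"
    and x: "x \<in> closure M"
  shows "A x \<in> closure M"
  unfolding closure_approachable
proof (intro allI impI)
  fix e :: real assume "0 < e"
  then obtain y where y: "y \<in> M" "dist y x < e" using x unfolding closure_approachable by blast
  have "x \<in> S" using x M closed_csubspaceD(2)[OF closed_S] closure_minimal by blast
  then have "dist (A y) (A x) < e"
    using y M contr[of y x] by (auto simp: dist_norm)
  then show "\<exists>z\<in>M. dist z (A x) < e" using A y by blast
qed

lemma pure_part_invariant:
  assumes "i \<in> {1..n}" "x \<in> pure_part"
  shows "Z i x \<in> pure_part" "V i x \<in> pure_part"
proof -
  have sub: "nil \<subseteq> S" by (auto simp: nil_def)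
  show "Z i x \<in> pure_part"
    unfolding pure_part_def
    by (rule closure_invariant[OF _ sub, of "Z i"])
      (use assms Z_nil norm_Z_le in \<open>auto simp: Z_linear(2)[symmetric] pure_part_def\<close>)
  show "V i x \<in> pure_part"
    unfolding pure_part_def
    by (rule closure_invariant[OF _ sub, of "V i"])
      (use assms V_nil norm_V in \<open>auto simp: V_linear(2)[symmetric] pure_part_def\<close>)
qed

text \<open>The complement of a subspace invariant under \<open>V i\<close> is invariant under the adjoint \<open>Z i\<close>, and
  vice versa.\<close>

lemma unitary_part_invariant:
  assumes "i \<in> {1..n}" "x \<in> unitary_part"
  shows "Z i x \<in> unitary_part" "V i x \<in> unitary_part"
proof -
  have sub: "nil \<subseteq> S" by (auto simp: nil_def)
  show "Z i x \<in> unitary_part"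
    using assms V_nil sub unfolding unitary_part_def
    by (auto simp: adjoint_pair_eq[OF pair] subset_iff)
  show "V i x \<in> unitary_part"
    using assms Z_nil sub unfolding unitary_part_def
    by (auto simp: adjoint_pair_eq[OF adjoint_pair_sym[OF pair]] subset_iff)
qed

lemma parts_orthogonal:
  assumes "x \<in> pure_part" "y \<in> unitary_part"
  shows "cinner x y = 0"
proof -
  have "closed_csubspace {x. cinner x y = 0}"
    using orthogonal_complement_closed[of UNIV "{y}"] by simp
  moreover have "nil \<subseteq> {x. cinner x y = 0}"
    using assms(2) cinner_eq_0_commute unfolding unitary_part_def by blast
  ultimately have "closure nil \<subseteq> {x. cinner x y = 0}"
    by (intro closure_minimal) (auto simp: closed_csubspace_def)
  then show ?thesis using assms(1) by (auto simp: pure_part_def)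
qed

lemma parts_decomposition: "orthogonal_decomposition S pure_part unitary_part"
proof -
  have "\<exists>p q. x = p + q \<and> p \<in> pure_part \<and> q \<in> unitary_part" if x: "x \<in> S" for x
  proof -
    obtain p where p: "p \<in> pure_part" "\<forall>m\<in>pure_part. cinner (x - p) m = 0"
      using ex_orthogonal_projection[OF pure_part_closed] by blast
    then have "x - p \<in> unitary_part"
      using x nil_subset unfolding unitary_part_def by auto
    then show ?thesis using p(1) by (intro exI[of _ p] exI[of _ "x - p"]) auto
  qed
  moreover have "p + q \<in> S" if "p \<in> pure_part" "q \<in> unitary_part" for p q
    using that nil_subset(2) by (auto simp: unitary_part_def)
  ultimately have "S = {p + q |p q. p \<in> pure_part \<and> q \<in> unitary_part}" by blast
  then show ?thesis
    unfolding orthogonal_decomposition_def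
    using pure_part_closed unitary_part_closed parts_orthogonal by blast
qed

text \<open>On \<open>nil\<close> the powers are eventually zero; as they are contractive, this carries over to
  limits.\<close>

lemma ZZ_power_tendsto_0:
  assumes "x \<in> pure_part"
  shows "(\<lambda>k. (ZZ ^^ k) x) \<longlonglongrightarrow> 0"
proof (rule LIMSEQ_I)
  fix e :: real assume "0 < e"
  then obtain w where w: "w \<in> nil" "norm (x - w) < e"
    using assms unfolding pure_part_def closure_approachable
    by (auto simp: dist_norm norm_minus_commute)
  then obtain m where m: "w \<in> S" "(ZZ ^^ m) w = 0" by (auto simp: nil_def)
  have x: "x \<in> S" using assms nil_subset by blast
  have "norm ((ZZ ^^ k) x - 0) < e" if "k \<ge> m" for k
  proof -
    have "(ZZ ^^ k) x = (ZZ ^^ k) (x - w)"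
      using nil_power_mono[OF m that] x m by (simp add: ZZ_power_linear)
    then show ?thesis
      using norm_ZZ_power_le[of "x - w" k] x m w(2) by simp
  qed
  then show "\<exists>m. \<forall>k\<ge>m. norm ((ZZ ^^ k) x - 0) < e" by blast
qed

text \<open>The vector \<open>x - V i (Z i x)\<close> is annihilated by \<open>Z i\<close>, hence by \<open>ZZ\<close>, and so belongs to both of
  two orthogonal subspaces.\<close>

lemma VZ_unitary_part:
  assumes "i \<in> {1..n}" "x \<in> unitary_part"
  shows "V i (Z i x) = x"
proof -
  define w where "w = x - V i (Z i x)"
  have x: "x \<in> S" using assms(2) by (simp add: unitary_part_def)
  have "Z i w = 0" using assms(1) x by (simp add: w_def Z_linear ZV)
  then have "ZZ w = 0"
    using assms(1) x ZZ_eq(2)[of i w] Z'_linear(3) by (simp add: w_def)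
  then have "w \<in> nil"
    using assms(1) x by (auto simp: nil_def w_def intro!: exI[of _ 1])
  moreover have "w \<in> unitary_part"
    unfolding w_def using assms unitary_part_invariant closed_csubspaceD(1)[OF unitary_part_closed]
    by (intro csubspace_diff) auto
  ultimately have "cinner w w = 0" by (simp add: unitary_part_def)
  then show ?thesis by (simp add: w_def cinner_self_eq_0)
qed

lemma subspace_pair:
  assumes "M \<subseteq> S" "i \<in> {1..n}" "\<And>x. x \<in> M \<Longrightarrow> Z i x \<in> M" "\<And>x. x \<in> M \<Longrightarrow> V i x \<in> M"
  shows "adjoint_pair M M (Z i) (V i)"
  using adjoint_pair_subset[OF pair[OF assms(2)] assms(1,1,3,4)] .

lemma coisometric_tuple_subspace:
  assumes M: "M \<subseteq> S" "csubspace M"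
    "\<And>i x. i \<in> {1..n} \<Longrightarrow> x \<in> M \<Longrightarrow> Z i x \<in> M" "\<And>i x. i \<in> {1..n} \<Longrightarrow> x \<in> M \<Longrightarrow> V i x \<in> M"
  shows "coisometric_tuple M n Z"
proof -
  have "coisometry_op M M (Z i)" if i: "i \<in> {1..n}" for i
    using subspace_pair[OF M(1) i M(3)[OF i] M(4)[OF i]] ZV[OF i] M(1)
    by (intro coisometry_op_adjoint_pairI[OF M(2,2)]) auto
  then show ?thesis
    using Z_commute M(1) unfolding coisometric_tuple_def commuting_tuple_def by blast
qed

theorem coisometric: "coisometric_tuple S n Z"
  by (rule coisometric_tuple_subspace) (use Ss in auto)

lemma reducing_subspaceI:
  assumes "closed_csubspace M" "M \<subseteq> S" "i \<in> {1..n}"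
    "\<And>x. x \<in> M \<Longrightarrow> Z i x \<in> M" "\<And>x. x \<in> M \<Longrightarrow> V i x \<in> M"
  shows "reducing_subspace S M (Z i)"
  using assms adj_adjoint_pair[OF Ss pair] unfolding reducing_subspace_def
  by (metis subsetD)

theorem parts_reducing:
  assumes "i \<in> {1..n}"
  shows "reducing_subspace S pure_part (Z i)" "reducing_subspace S unitary_part (Z i)"
  by (rule reducing_subspaceI; use assms pure_part_closed unitary_part_closed nil_subset
      pure_part_invariant unitary_part_invariant in \<open>auto simp: unitary_part_def\<close>)+

lemma ZZ_pure_pair: "adjoint_pair pure_part pure_part ZZ VV"
proof (rule adjoint_pair_subset[OF VV_pair nil_subset(2) nil_subset(2)])
  show "ZZ x \<in> pure_part" "VV x \<in> pure_part" if "x \<in> pure_part" for x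
    using that pure_part_invariant by (auto intro!: op_prod_in)
qed

theorem pure_part_pure: "pure_coisometric_tuple pure_part n Z"
proof -
  note c = closed_csubspaceD(1)[OF pure_part_closed]
  have ZV: "ZZ (VV x) = x" if "x \<in> pure_part" for x using that nil_subset(2) by auto
  have adj: "adj pure_part ZZ x = VV x" if "x \<in> pure_part" for x
    using adj_adjoint_pair[OF c ZZ_pure_pair that] .
  have adjadj: "adj pure_part (adj pure_part ZZ) x = ZZ x" if "x \<in> pure_part" for x
  proof -
    have "adj pure_part (adj pure_part ZZ) x = adj pure_part VV x" by (rule adj_cong) (rule adj)
    then show ?thesis using adj_adjoint_pair'[OF c ZZ_pure_pair that] by simp
  qed
  have power: "(adj pure_part (adj pure_part ZZ) ^^ k) x = (ZZ ^^ k) x \<and> (ZZ ^^ k) x \<in> pure_part"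
    if "x \<in> pure_part" for x k
    using that by (induction k) (auto simp: adjadj adjoint_pair_in1[OF ZZ_pure_pair])
  have "coisometric_tuple pure_part n Z"
    by (rule coisometric_tuple_subspace) (use c nil_subset pure_part_invariant in auto)
  moreover have "isometry_op pure_part pure_part (adj pure_part ZZ)"
    using coisometry_op_adjoint_pairI[OF c c ZZ_pure_pair ZV] by (simp add: coisometry_op_def)
  moreover have "bounded_op pure_part pure_part ZZ"
    by (rule bounded_op_if_adjoint_isometric[OF c c ZZ_pure_pair ZV])
  ultimately show ?thesis
    unfolding pure_coisometric_tuple_def pure_coisometry_def pure_isometry_def
    using power ZZ_power_tendsto_0 by simp
qed

theorem unitary_part_unitary: "unitary_tuple unitary_part n Z"
proof -
  note c = closed_csubspaceD(1)[OF unitary_part_closed]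
  have sub: "unitary_part \<subseteq> S" by (auto simp: unitary_part_def)
  have "unitary_op unitary_part unitary_part (Z i)" if i: "i \<in> {1..n}" for i
    using subspace_pair[OF sub i] unitary_part_invariant[OF i] VZ_unitary_part[OF i] ZV[OF i] sub
    by (intro unitary_op_adjoint_pairI[OF c c]) auto
  then show ?thesis
    using Z_commute sub unfolding unitary_tuple_def commuting_tuple_def by blast
qed

end

section \<open>The Hardy space model of the pure part\<close>

context commuting_isometries
begin

text \<open>The wandering subspace of the isometry \<open>VV\<close>, and the projection onto it.\<close>

definition L where "L = {x\<in>S. ZZ x = 0}"
definition Q where "Q x = x - VV (ZZ x)"

lemma L_closed: "closed_csubspace L"
proof -
  have "(\<forall>y\<in>VV ` S. cinner x y = 0) \<longleftrightarrow> ZZ x = 0" if x: "x \<in> S" for x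
  proof -
    have "(\<forall>y\<in>VV ` S. cinner x y = 0) \<longleftrightarrow> (\<forall>y\<in>S. cinner (ZZ x) y = 0)"
      using x by (simp add: adjoint_pair_eq[OF VV_pair])
    also have "\<dots> \<longleftrightarrow> ZZ x = 0"
      using ZZ_in[OF x] cinner_self_eq_0[of "ZZ x"] cinner_zero_left by metis
    finally show ?thesis .
  qed
  then have eq: "L = {x\<in>S. \<forall>y\<in>VV ` S. cinner x y = 0}" unfolding L_def by blast
  show ?thesis unfolding eq by (rule orthogonal_complement_closed[OF closed_S])
qed

lemmas Ls = closed_csubspaceD(1)[OF L_closed]

lemma L_S: "l \<in> L \<Longrightarrow> l \<in> S" and ZZ_L: "l \<in> L \<Longrightarrow> ZZ l = 0"
  by (simp_all add: L_def)

lemma L_pure: "l \<in> L \<Longrightarrow> l \<in> pure_part"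
  by (rule subsetD[OF nil_subset(1)]) (auto simp: L_def nil_def intro!: exI[of _ 1])

lemma Q_in_L [simp]: "x \<in> S \<Longrightarrow> Q x \<in> L"
  by (simp add: Q_def L_def ZZ_linear)

lemma Q_in_S [simp]: "x \<in> S \<Longrightarrow> Q x \<in> S"
  by (simp add: Q_def)

lemma Q_L: "l \<in> L \<Longrightarrow> Q l = l"
  by (simp add: Q_def L_def VV_linear)

lemma Q_VV: "x \<in> S \<Longrightarrow> Q (VV x) = 0"
  by (simp add: Q_def)

lemma Q_pair: "adjoint_pair S S Q Q"
  unfolding Q_def[abs_def]
  by (intro adjoint_pair_diff_maps Ss adjoint_pair_id
      adjoint_pair_comp[OF VV_pair adjoint_pair_sym[OF VV_pair]])

lemmas Q_linear = adjoint_pair_add[OF Ss Ss Q_pair] adjoint_pair_diff[OF Ss Ss Q_pair]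
  adjoint_pair_scaleC[OF Ss Ss Q_pair] adjoint_pair_zero[OF Ss Ss Q_pair]

lemma norm_Q: "x \<in> S \<Longrightarrow> (norm (Q x))\<^sup>2 = (norm x)\<^sup>2 - (norm (ZZ x))\<^sup>2"
proof -
  assume x: "x \<in> S"
  have "cinner (Q x) (Q x) = cinner x (Q x)"
    using x by (simp add: adjoint_pair_eq[OF Q_pair] Q_L)
  also have "\<dots> = cinner x x - cinner (ZZ x) (ZZ x)"
    using x adjoint_pair_eq[OF VV_pair x, of "ZZ x"] by (simp add: Q_def cinner_diff_right)
  finally have "complex_of_real ((norm (Q x))\<^sup>2) = complex_of_real ((norm x)\<^sup>2 - (norm (ZZ x))\<^sup>2)"
    by (simp add: cinner_self)
  then show ?thesis unfolding of_real_eq_iff .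
qed

text \<open>
  Since \<open>I - ZZ\<^sup>* ZZ = Q\<close> is a projection, the defect operator of \<open>ZZ\<close> and \<open>Q\<close> have the same
  range.
\<close>

theorem defect_space_ZZ: "defect_space S ZZ = L"
proof -
  define D where "D = defect_op S ZZ"
  have pos: "positive_op S D" and DD: "\<And>x. x \<in> S \<Longrightarrow> D (D x) = Q x"
    using defect_op_positive_sqrt[OF closed_S VV_pair] norm_ZZ_power_le[of _ 1]
    by (auto simp: D_def Q_def)
  note p = positive_op_selfadjoint[OF Ss pos]
  note D_in = adjoint_pair_in1[OF p] and D_diff = adjoint_pair_diff[OF Ss Ss p]
  have "D x \<in> L" if x: "x \<in> S" for x
  proof -
    define w where "w = x - Q x"
    have w: "w \<in> S" "Q w = 0" using x by (simp_all add: w_def Q_linear Q_L)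
    have "cinner (D w) (D w) = 0"
      using adjoint_pair_eq[OF p w(1) D_in[OF w(1)]] DD[OF w(1)] w(2) by (simp add: cinner_zero_right)
    then have "D x - D (Q x) = 0"
      using x D_diff[of x "Q x"] by (simp add: w_def cinner_self_eq_0)
    moreover have "D (Q x) = Q (D x)" using x DD D_in by metis
    ultimately show ?thesis using Q_in_L[OF D_in[OF x]] by simp
  qed
  then have "defect_space S ZZ \<subseteq> L"
    unfolding defect_space_def D_def[symmetric] using closed_csubspaceD(2)[OF L_closed]
    by (intro closure_minimal) auto
  moreover have "l \<in> defect_space S ZZ" if l: "l \<in> L" for l
  proof -
    have "l = D (D l)" using l DD[OF L_S] Q_L by simp
    then have "l \<in> D ` S" using D_in[OF L_S[OF l]] by blast
    then show ?thesis
      unfolding defect_space_def D_def[symmetric] by (rule subsetD[OF closure_subset])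
  qed
  ultimately show ?thesis by blast
qed

text \<open>
  The coefficient number \<open>k\<close> of the model of \<open>x\<close> is the component of \<open>x\<close> in \<open>VV\<^sup>k L\<close>, moved
  to \<open>L\<close> and then along \<open>J\<close>.
\<close>

definition model where "model J x = hardy_of (\<lambda>k. J (Q ((ZZ ^^ k) x)))"

lemma norm_Q_sums:
  assumes "x \<in> pure_part"
  shows "(\<lambda>k. (norm (Q ((ZZ ^^ k) x)))\<^sup>2) sums (norm x)\<^sup>2"
proof -
  have x: "x \<in> S" using assms nil_subset by blast
  have partial: "(\<Sum>k<m. (norm (Q ((ZZ ^^ k) x)))\<^sup>2) = (norm x)\<^sup>2 - (norm ((ZZ ^^ m) x))\<^sup>2" for m
    by (induction m) (use x in \<open>simp_all add: norm_Q\<close>)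
  have "(\<lambda>m. (norm x)\<^sup>2 - (norm ((ZZ ^^ m) x))\<^sup>2) \<longlonglongrightarrow> (norm x)\<^sup>2 - (norm (0::'k))\<^sup>2"
    by (intro tendsto_intros ZZ_power_tendsto_0[OF assms])
  then show ?thesis unfolding sums_def partial by simp
qed

lemma ZZ_power_VV_less: "x \<in> S \<Longrightarrow> j \<le> k \<Longrightarrow> (ZZ ^^ j) ((VV ^^ k) x) = (VV ^^ (k - j)) x"
proof -
  assume x: "x \<in> S" and "j \<le> k"
  then have "(VV ^^ k) x = (VV ^^ j) ((VV ^^ (k - j)) x)"
    by (simp add: funpow_add[symmetric, THEN fun_cong, simplified])
  then show ?thesis using x by (simp add: ZZ_power_VV_power)
qed

lemma VV_power_pure: "x \<in> pure_part \<Longrightarrow> (VV ^^ k) x \<in> pure_part"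
  using adjoint_pair_in2[OF ZZ_pure_pair] by (induction k) auto

lemma Q_ZZ_power_VV_power:
  assumes l: "l \<in> L"
  shows "Q ((ZZ ^^ j) ((VV ^^ k) l)) = (if j = k then l else 0)"
proof -
  have lS: "l \<in> S" using l by (rule L_S)
  consider "j = k" | "j < k" | "k < j" by linarith
  then show ?thesis
  proof cases
    case 1
    then show ?thesis using l lS by (simp add: ZZ_power_VV_power Q_L)
  next
    case 2
    then obtain m where "k - j = Suc m" by (metis Suc_diff_Suc)
    then show ?thesis using 2 lS by (simp add: ZZ_power_VV_less Q_VV)
  next
    case 3
    then have "(ZZ ^^ j) y = (ZZ ^^ (j - k - 1)) (ZZ ((ZZ ^^ k) y))" for y
    proof -
      have "j = (j - k - 1) + Suc k" using 3 by simp
      then have "(ZZ ^^ j) y = (ZZ ^^ ((j - k - 1) + Suc k)) y" by simp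
      then show ?thesis unfolding funpow_add by simp
    qed
    then show ?thesis
      using 3 lS l by (simp add: ZZ_power_VV_power ZZ_L ZZ_power_linear Q_linear)
  qed
qed

context
  fixes J and R :: "'r::complex_hilbert set"
  assumes R: "closed_csubspace R" and J: "unitary_op L R J"
begin

lemmas Rs = closed_csubspaceD(1)[OF R]

abbreviation Ji where "Ji \<equiv> adj L J"

lemmas J_pair = unitary_opD(1)[OF L_closed J]
lemmas J_inv [simp] = unitary_opD(2,3)[OF L_closed J]
lemmas J_linear = adjoint_pair_add[OF Rs Ls J_pair] adjoint_pair_diff[OF Rs Ls J_pair]
  adjoint_pair_scaleC[OF Rs Ls J_pair] adjoint_pair_zero[OF Rs Ls J_pair]

lemma J_in [simp]: "l \<in> L \<Longrightarrow> J l \<in> R" and Ji_in [simp]: "r \<in> R \<Longrightarrow> Ji r \<in> L"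
  using adjoint_pair_in1[OF J_pair] adjoint_pair_in2[OF J_pair] by auto

lemma norm_J: "l \<in> L \<Longrightarrow> norm (J l) = norm l"
  using adjoint_pair_eq[OF J_pair, of l "J l"] by (intro norm_eq_cinner) simp

lemma hardy_coeff_model:
  assumes "x \<in> pure_part"
  shows "hardy_coeff (model J x) = (\<lambda>k. J (Q ((ZZ ^^ k) x)))"
proof -
  have "x \<in> S" using assms nil_subset by blast
  then show ?thesis
    unfolding model_def using sums_summable[OF norm_Q_sums[OF assms]]
    by (intro hardy_coeff_hardy_of) (simp add: square_summable_def norm_J)
qed

text \<open>
  By telescoping, the squared norms of the first \<open>m\<close> coefficients add up to
  \<open>\<parallel>x\<parallel>\<^sup>2 - \<parallel>ZZ\<^sup>m x\<parallel>\<^sup>2\<close>, so the model is isometric on the pure part. The image of \<open>VV\<^sup>k l\<close>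
  is the monomial of degree \<open>k\<close> with coefficient \<open>J l\<close>; hence the range is dense.
\<close>

theorem model_unitary: "unitary_op pure_part (H2 R) (model J)"
proof (rule unitary_op_if_dense_range[OF pure_part_closed csubspace_H2[OF R]])
  note c = closed_csubspaceD(1)[OF pure_part_closed]
  have sub: "x \<in> S" if "x \<in> pure_part" for x using that nil_subset by blast
  show "isometry_op pure_part (H2 R) (model J)"
    unfolding isometry_op_def bounded_op_def
  proof (intro conjI ballI allI exI[of _ 1])
    fix x assume x: "x \<in> pure_part"
    show "model J x \<in> H2 R"
      using x sub by (simp add: H2_iff_coeff[OF R] hardy_coeff_model)
    have "(\<lambda>k. (norm (hardy_coeff (model J x) k))\<^sup>2) sums (norm x)\<^sup>2"
      using norm_Q_sums[OF x] x sub by (simp add: hardy_coeff_model norm_J)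
    then have "(norm (model J x))\<^sup>2 = (norm x)\<^sup>2"
      using norm_hardy_sums sums_unique2 by blast
    then show n: "norm (model J x) = norm x" by (simp add: power2_eq_iff_nonneg)
    then show "norm (model J x) \<le> 1 * norm x" by simp
    show "model J (a *\<^sub>C x) = a *\<^sub>C model J x" for a
      unfolding hardy_coeff_inject[symmetric]
      using x sub csubspace_scaleC[OF c]
      by (simp add: hardy_coeff_linear hardy_coeff_model ZZ_power_linear Q_linear J_linear)
    fix y assume y: "y \<in> pure_part"
    show "model J (x + y) = model J x + model J y"
      unfolding hardy_coeff_inject[symmetric]
      using x y sub csubspace_add[OF c]
      by (simp add: hardy_coeff_linear hardy_coeff_model ZZ_power_linear Q_linear J_linear)
  qed
next
  fix f assume f: "f \<in> H2 R" and orth: "\<And>x. x \<in> pure_part \<Longrightarrow> cinner (model J x) f = 0"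
  have "hardy_coeff f k = 0" for k
  proof -
    define r where "r = hardy_coeff f k"
    have r: "r \<in> R" using f by (simp add: r_def H2_iff_coeff[OF R])
    define x where "x = (VV ^^ k) (Ji r)"
    have x: "x \<in> pure_part" unfolding x_def using r by (intro VV_power_pure L_pure) simp
    have "hardy_coeff (model J x) j = (if j = k then r else 0)" for j
      unfolding hardy_coeff_model[OF x] unfolding x_def
      using r by (simp add: Q_ZZ_power_VV_power J_linear)
    then have "cinner (model J x) f = cinner r r"
      using cinner_hardy_single[of k "model J x" f] by (simp add: r_def)
    then show ?thesis using orth[OF x] by (simp add: r_def cinner_self_eq_0)
  qed
  then have "hardy_coeff f = hardy_coeff 0" by (simp add: fun_eq_iff hardy_coeff_linear)
  then show "f = 0" unfolding hardy_coeff_inject .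
qed

lemma model_ZZ: "x \<in> pure_part \<Longrightarrow> model J (ZZ x) = adj (H2 R) mult_z (model J x)"
proof -
  assume x: "x \<in> pure_part"
  then have "model J x \<in> H2 R" "ZZ x \<in> pure_part"
    using nil_subset(2) adjoint_pair_in1[OF ZZ_pure_pair]
    by (auto simp: H2_iff_coeff[OF R] hardy_coeff_model)
  then show ?thesis
    unfolding hardy_coeff_inject[symmetric]
    using x by (simp add: hardy_coeff_adj_mult_z[OF R] hardy_coeff_model funpow_swap1)
qed

end

theorem pure_part_shift:
  "\<exists>W. unitary_op pure_part (H2 L) W \<and> (\<forall>x\<in>pure_part. W (ZZ x) = adj (H2 L) mult_z (W x))"
proof -
  have "unitary_op L L (\<lambda>x. x)"
    using adjoint_pair_id by (intro unitary_op_adjoint_pairI[OF Ls Ls]) auto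
  from model_unitary[OF L_closed this] model_ZZ[OF L_closed this] show ?thesis by blast
qed

text \<open>
  The projections and unitaries on \<open>L\<close> found by Berger, Coburn and Lebow. The subspace \<open>L\<close>
  has the two decompositions \<open>ker Z\<^sub>i \<oplus> V\<^sub>i ker Z'\<^sub>i\<close> and \<open>ker Z'\<^sub>i \<oplus> V'\<^sub>i ker Z\<^sub>i\<close>;
  \<open>bcl_unitary i\<close> maps the first to the second by \<open>V'\<^sub>i\<close> and \<open>Z\<^sub>i\<close>.
\<close>

definition bcl_proj where "bcl_proj i l = l - V i (Z i l)"
definition bcl_unitary where "bcl_unitary i l = V' i (l - V i (Z i l)) + Z i l"
definition bcl_inverse where "bcl_inverse i l = V i (l - V' i (Z' i l)) + Z' i l"

lemma Z_L [simp]: "i \<in> {1..n} \<Longrightarrow> l \<in> L \<Longrightarrow> Z i l \<in> L"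
  and Z'_L [simp]: "i \<in> {1..n} \<Longrightarrow> l \<in> L \<Longrightarrow> Z' i l \<in> L"
  by (simp_all add: L_def ZZ_Z_commute ZZ_Z'_commute Z_linear Z'_linear)

lemma bcl_proj_in [simp]: "i \<in> {1..n} \<Longrightarrow> l \<in> L \<Longrightarrow> bcl_proj i l \<in> L"
  by (simp add: L_def bcl_proj_def ZZ_linear ZZ_V ZZ_eq)

lemma bcl_unitary_in [simp]: "i \<in> {1..n} \<Longrightarrow> l \<in> L \<Longrightarrow> bcl_unitary i l \<in> L"
  by (simp add: L_def bcl_unitary_def ZZ_linear ZZ_V' ZZ_Z_commute Z_linear ZV)

lemma bcl_inverse_in [simp]: "i \<in> {1..n} \<Longrightarrow> l \<in> L \<Longrightarrow> bcl_inverse i l \<in> L"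
  by (simp add: L_def bcl_inverse_def ZZ_linear ZZ_V ZZ_Z'_commute Z'_linear Z'V')

lemma bcl_unitary_inverse:
  assumes i: "i \<in> {1..n}" and l: "l \<in> L"
  shows "bcl_unitary i (bcl_inverse i l) = l"
proof -
  define e where "e = l - V' i (Z' i l)"
  have S: "l \<in> S" "e \<in> S" using i l by (simp_all add: e_def L_S)
  have "Z i (V i e + Z' i l) = e"
    using i S l by (simp add: Z_linear ZV ZZ_eq ZZ_L)
  then show ?thesis
    by (simp add: bcl_unitary_def bcl_inverse_def e_def[symmetric]) (simp add: e_def)
qed

lemma bcl_inverse_unitary:
  assumes i: "i \<in> {1..n}" and l: "l \<in> L"
  shows "bcl_inverse i (bcl_unitary i l) = l"
proof -
  define e where "e = l - V i (Z i l)"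
  have S: "l \<in> S" "e \<in> S" using i l by (simp_all add: e_def L_S)
  have "Z' i (V' i e + Z i l) = e"
    using i S l by (simp add: Z'_linear Z'V' ZZ_eq ZZ_L)
  then show ?thesis
    by (simp add: bcl_unitary_def bcl_inverse_def e_def[symmetric]) (simp add: e_def)
qed

lemma bcl_unitary_pair:
  assumes i: "i \<in> {1..n}"
  shows "adjoint_pair L L (bcl_unitary i) (bcl_inverse i)"
proof (rule adjoint_pairI)
  fix l m assume lm: "l \<in> L" "m \<in> L"
  then have S: "l \<in> S" "m \<in> S" by (simp_all add: L_S)
  \<comment> \<open>Both sides are \<open>\<langle>l, Z'\<^sub>i m + V\<^sub>i m\<rangle>\<close>: vectors of \<open>VV S\<close> are orthogonal to \<open>l\<close>.\<close>
  have ort: "cinner l (VV y) = 0" if "y \<in> S" for y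
    using adjoint_pair_eq[OF VV_pair S(1) that] lm by (simp add: ZZ_L cinner_zero_left)
  have "cinner (V i (Z i l)) (Z' i m) = cinner l (V i (Z i (Z' i m)))"
    using i S by (simp add: adjoint_pair_eq[OF pair] adjoint_pair_eq[OF adjoint_pair_sym[OF pair]])
  also have "\<dots> = 0" using i S lm by (simp add: ZZ_eq ZZ_L V_linear cinner_zero_right)
  finally have "cinner (bcl_unitary i l) m = cinner l (Z' i m) + cinner l (V i m)"
    using i S by (simp add: bcl_unitary_def cinner_add_left cinner_diff_left
        adjoint_pair_eq[OF adjoint_pair_sym[OF V'_pair]] adjoint_pair_eq[OF pair])
  moreover have "cinner l (bcl_inverse i m) = cinner l (V i m) + cinner l (Z' i m)"
    using i S ort[of "Z' i m"] by (simp add: bcl_inverse_def cinner_add_right V_linear VV_eq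
        cinner_diff_right)
  ultimately show "cinner (bcl_unitary i l) m = cinner l (bcl_inverse i m)" by simp
qed (use i in auto)

lemma bcl_proj_pair:
  assumes i: "i \<in> {1..n}"
  shows "adjoint_pair L L (bcl_proj i) (bcl_proj i)"
proof (rule adjoint_pair_subset)
  show "adjoint_pair S S (bcl_proj i) (bcl_proj i)"
    unfolding bcl_proj_def[abs_def]
    by (intro adjoint_pair_diff_maps Ss adjoint_pair_id
        adjoint_pair_comp[OF pair[OF i] adjoint_pair_sym[OF pair[OF i]]])
qed (use i L_S in auto)

lemma bcl_proj_idem: "i \<in> {1..n} \<Longrightarrow> l \<in> L \<Longrightarrow> bcl_proj i (bcl_proj i l) = bcl_proj i l"
  by (simp add: bcl_proj_def L_S Z_linear ZV V_linear)

lemma bcl_inverse_eq: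
  assumes "i \<in> {1..n}" "l \<in> L"
  shows "bcl_inverse i l = Q (V i l) + Z' i l"
  using assms by (simp add: bcl_inverse_def Q_def L_S V_linear VV_eq ZZ_V)

text \<open>
  With \<open>A\<^sub>i = Q V\<^sub>i\<close> and \<open>B\<^sub>i = Z'\<^sub>i\<close> on \<open>L\<close> one has \<open>V\<^sub>i l = A\<^sub>i l + VV (B\<^sub>i l)\<close>. As the \<open>V\<^sub>i\<close>
  commute, the coefficients \<open>A\<^sub>i A\<^sub>j\<close>, \<open>A\<^sub>i B\<^sub>j + B\<^sub>i A\<^sub>j\<close> and \<open>B\<^sub>i B\<^sub>j\<close> of \<open>V\<^sub>i V\<^sub>j\<close> are symmetric in
  \<open>i\<close> and \<open>j\<close>, and so is their sum.
\<close>

lemma bcl_inverse_product: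
  assumes i: "i \<in> {1..n}" and j: "j \<in> {1..n}" and l: "l \<in> L"
  shows "bcl_inverse i (bcl_inverse j l) =
    Q (V i (V j l)) + Q (ZZ (V i (V j l))) + Z' i (Z' j l)"
proof -
  have S: "l \<in> S" using l by (rule L_S)
  have Vj: "V j l = Q (V j l) + VV (Z' j l)"
    using j S by (simp add: Q_def ZZ_V)
  have AA: "Q (V i (V j l)) = Q (V i (Q (V j l)))"
    by (subst Vj) (use i j S in \<open>simp add: V_linear Q_linear VV_V_commute[symmetric] Q_VV\<close>)
  have "ZZ (V i (V j l)) = Z' i (Q (V j l)) + Z' i (VV (Z' j l))"
    by (subst Vj) (use i j S in \<open>simp add: ZZ_V Z'_linear\<close>)
  also have "Z' i (VV (Z' j l)) = V i (Z' j l)"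
    using i j S by (simp add: VV_eq(2)[of i, symmetric] Z'V')
  finally have AB: "Q (ZZ (V i (V j l))) = Z' i (Q (V j l)) + Q (V i (Z' j l))"
    using i j S by (simp add: Q_linear Q_L)
  have "bcl_inverse i (bcl_inverse j l) =
      Q (V i (Q (V j l) + Z' j l)) + Z' i (Q (V j l) + Z' j l)"
    using bcl_inverse_eq[OF i bcl_inverse_in[OF j l]] bcl_inverse_eq[OF j l] by simp
  then show ?thesis
    unfolding AA AB using i j S l by (simp add: V_linear Q_linear Z'_linear)
qed

lemma bcl_inverse_commute:
  assumes "i \<in> {1..n}" "j \<in> {1..n}" "l \<in> L"
  shows "bcl_inverse i (bcl_inverse j l) = bcl_inverse j (bcl_inverse i l)"
  using assms V_commute[of i j l] Z'_Z'_commute[of i j l]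
  by (simp add: bcl_inverse_product L_S)

lemma bcl_unitary_commute:
  assumes i: "i \<in> {1..n}" and j: "j \<in> {1..n}" and l: "l \<in> L"
  shows "bcl_unitary i (bcl_unitary j l) = bcl_unitary j (bcl_unitary i l)"
proof -
  have "bcl_inverse j (bcl_inverse i (bcl_unitary i (bcl_unitary j l))) = l"
    using assms by (simp add: bcl_inverse_unitary)
  moreover have "bcl_inverse j (bcl_inverse i (bcl_unitary j (bcl_unitary i l))) = l"
    using assms by (simp add: bcl_inverse_unitary bcl_inverse_commute[of j i])
  ultimately show ?thesis
    using assms by (metis bcl_unitary_inverse bcl_unitary_in bcl_inverse_in)
qed

lemma bcl_unitary_perp:
  "i \<in> {1..n} \<Longrightarrow> l \<in> L \<Longrightarrow> bcl_unitary i (l - bcl_proj i l) = Z i l"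
  by (simp add: bcl_unitary_def bcl_proj_def L_S ZV V'_linear)

lemma bcl_unitary_proj:
  "i \<in> {1..n} \<Longrightarrow> l \<in> L \<Longrightarrow> bcl_unitary i (bcl_proj i l) = V' i (bcl_proj i l)"
  by (simp add: bcl_unitary_def bcl_proj_def L_S Z_linear V_linear ZV)

text \<open>
  On \<open>L\<close>, \<open>bcl_unitary i\<close> agrees with \<open>Z i\<close> on the kernel and with \<open>V' i\<close> on the range of
  \<open>bcl_proj i\<close>. The formula results from applying \<open>Z i\<close> to \<open>y = Q y + VV (ZZ y)\<close>, and says that
  \<open>Z i\<close> is a Toeplitz operator in the model.
\<close>

lemma Q_Z:
  assumes i: "i \<in> {1..n}" and y: "y \<in> S"
  shows "Q (Z i y) = bcl_unitary i (Q y - bcl_proj i (Q y)) + bcl_unitary i (bcl_proj i (Q (ZZ y)))"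
proof -
  define z where "z = ZZ y"
  have z: "z \<in> S" using y by (simp add: z_def)
  have "V i (Z i (VV (ZZ z))) = VV (ZZ z)"
    using i z by (simp add: Z_VV VV_eq)
  then have "bcl_proj i (Q z) = z - V i (Z i z)"
    using i z by (simp add: bcl_proj_def Q_def Z_linear V_linear)
  then have "V' i (bcl_proj i (Q z)) = V' i z - VV (Z i z)"
    using i z by (simp add: V'_linear VV_eq)
  moreover have "Z i (Q y) = Z i y - V' i z"
    using i y by (simp add: Q_def z_def Z_linear Z_VV)
  moreover have "Q (Z i y) = Z i y - VV (Z i z)"
    using i y by (simp add: Q_def z_def ZZ_Z_commute)
  ultimately show ?thesis
    using i y z by (simp add: bcl_unitary_perp bcl_unitary_proj z_def[symmetric])
qed

theorem bcl_model:
  fixes R :: "'r::complex_hilbert set"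
  assumes R: "closed_csubspace R" and J: "unitary_op L R J"
  shows "\<exists>P U. (\<forall>i\<in>{1..n}. projection_op R (P i)) \<and> (\<forall>i\<in>{1..n}. unitary_op R R (U i)) \<and>
    commuting_tuple R n U \<and>
    unitarily_equivalent n pure_part Z (H2 R) (\<lambda>i. toeplitz R (U i \<circ> perp (P i)) (U i \<circ> P i))"
proof -
  note Rs = closed_csubspaceD(1)[OF R]
  note Jp = J_pair[OF R J] and Jinv = J_inv[OF R J] and Jin = J_in[OF R J] Ji_in[OF R J]
  define P where "P i r = J (bcl_proj i (adj L J r))" for i r
  define U where "U i r = J (bcl_unitary i (adj L J r))" for i r
  have P_pair: "adjoint_pair R R (P i) (P i)" if "i \<in> {1..n}" for i
    unfolding P_def[abs_def]
    using adjoint_pair_comp[OF adjoint_pair_comp[OF adjoint_pair_sym[OF Jp] bcl_proj_pair[OF that]] Jp] .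
  have P: "projection_op R (P i)" if "i \<in> {1..n}" for i
    using P_pair[OF that] that
    by (intro projection_op_adjoint_pairI[OF Rs]) (simp_all add: P_def Jinv Jin bcl_proj_idem)
  have U: "unitary_op R R (U i)" if i: "i \<in> {1..n}" for i
  proof (rule unitary_op_adjoint_pairI[OF Rs Rs])
    show "adjoint_pair R R (U i) (\<lambda>r. J (bcl_inverse i (adj L J r)))"
      unfolding U_def[abs_def]
      using adjoint_pair_comp[OF adjoint_pair_comp[OF adjoint_pair_sym[OF Jp] bcl_unitary_pair[OF i]] Jp] .
  qed (use i in \<open>simp_all add: U_def Jinv Jin bcl_unitary_inverse bcl_inverse_unitary\<close>)
  have "commuting_tuple R n U"
    by (auto simp: commuting_tuple_def U_def Jinv Jin bcl_unitary_commute)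
  moreover have "model J (Z i x) = toeplitz R (U i \<circ> perp (P i)) (U i \<circ> P i) (model J x)"
    if i: "i \<in> {1..n}" and x: "x \<in> pure_part" for i x
    unfolding hardy_coeff_inject[symmetric]
  proof
    fix k
    have Zx: "Z i x \<in> pure_part" using pure_part_invariant[OF i x] by simp
    have xS: "x \<in> S" using x nil_subset by blast
    define y where "y = (ZZ ^^ k) x"
    have y: "y \<in> S" using xS by (simp add: y_def)
    have bU: "bounded_op R R (U i)" and bP: "bounded_op R R (P i)"
      using U[OF i] P[OF i] by (simp_all add: unitary_op_def projection_op_def)
    have b1: "bounded_op R R (U i \<circ> P i)" by (rule bounded_op_comp[OF bP bU])
    have b2: "bounded_op R R (U i \<circ> perp (P i))"
      using projection_op_perp[OF R P[OF i]] bU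
      by (intro bounded_op_comp[of R R _ R]) (auto simp: projection_op_def)
    have m: "model J x \<in> H2 R"
      using x xS by (simp add: H2_iff_coeff[OF R] hardy_coeff_model[OF R J] Jin)
    have "hardy_coeff (model J (Z i x)) k = J (Q (Z i y))"
      using i xS by (simp add: hardy_coeff_model[OF R J Zx] ZZ_power_Z y_def)
    also have "\<dots> = J (bcl_unitary i (Q y - bcl_proj i (Q y))) + J (bcl_unitary i (bcl_proj i (Q (ZZ y))))"
      using i y by (simp add: Q_Z J_linear[OF R J] csubspace_diff[OF Ls])
    also have "\<dots> = U i (perp (P i) (J (Q y))) + U i (P i (J (Q (ZZ y))))"
    proof -
      have "perp (P i) (J (Q y)) = J (Q y - bcl_proj i (Q y))"
        using i y by (simp add: perp_def P_def Jinv J_linear[OF R J])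
      then show ?thesis
        using i y by (simp add: U_def P_def Jinv Jin csubspace_diff[OF Ls])
    qed
    also have "\<dots> = hardy_coeff (toeplitz R (U i \<circ> perp (P i)) (U i \<circ> P i) (model J x)) k"
      by (simp add: hardy_coeff_toeplitz[OF R b2 b1 m] hardy_coeff_model[OF R J x] y_def)
    finally show "hardy_coeff (model J (Z i x)) k = \<dots>" .
  qed
  then have "unitarily_equivalent n pure_part Z (H2 R) (\<lambda>i. toeplitz R (U i \<circ> perp (P i)) (U i \<circ> P i))"
    unfolding unitarily_equivalent_def using model_unitary[OF R J] by blast
  ultimately show ?thesis using P U by blast
qed

end

section \<open>The block operator matrices\<close>

text \<open>
  The adjoint of the block matrix: below the first row, each entry \<open>P U\<^sup>*\<close> stands left of
  \<open>(I - P) U\<^sup>*\<close>, and \<open>D h\<close> plays the part of the entry that precedes the sequence.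
\<close>

definition block_adj ::
  "('a::complex_hilbert \<Rightarrow> 'a) \<Rightarrow> ('a \<Rightarrow> 'a) \<Rightarrow> ('a \<Rightarrow> 'a) \<Rightarrow> ('a \<Rightarrow> 'a) \<Rightarrow>
   'a \<times> 'a ell2 \<Rightarrow> 'a \<times> 'a ell2" where
  "block_adj D Ta Ua P v = (Ta (fst v),
     Abs_ell2 (\<lambda>k. P (Ua (case_nat (D (fst v)) (seq (snd v)) k)) + perp P (Ua (seq (snd v) k))))"

text \<open>
  Here \<open>D\<close> and \<open>E\<close> play the parts of the defect operator and the defect space of the adjoint of
  \<open>T 1 \<circ> \<dots> \<circ> T n\<close>, and \<open>Ta i\<close> that of the adjoint of \<open>T i\<close>.
\<close>

locale dilation_data =
  fixes n :: nat and T Ta P U :: "nat \<Rightarrow> 'a::complex_hilbert \<Rightarrow> 'a" and D :: "'a \<Rightarrow> 'a" and E :: "'a set"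
  assumes closed_E: "closed_csubspace E"
    and D_pair: "adjoint_pair UNIV E D D"
    and D_injective: "x \<in> E \<Longrightarrow> D x = 0 \<Longrightarrow> x = 0"
    and T_pair: "i \<in> {1..n} \<Longrightarrow> adjoint_pair UNIV UNIV (T i) (Ta i)"
    and T_commuting: "commuting_tuple UNIV n T"
    and P_proj: "i \<in> {1..n} \<Longrightarrow> projection_op E (P i)"
    and U_unitary: "i \<in> {1..n} \<Longrightarrow> unitary_op E E (U i)"
    and U_commuting: "commuting_tuple E n U"
    and cond1: "i \<in> {1..n} \<Longrightarrow> D (Ta i h) =
      perp (P i) (adj E (U i) (D h)) + P i (adj E (U i) (D (op_prod Ta n h)))"
    and cond2: "i \<in> {1..n} \<Longrightarrow> j \<in> {1..n} \<Longrightarrow> x \<in> E \<Longrightarrow>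
      perp (P i) (adj E (U i) (perp (P j) (adj E (U j) x))) =
      perp (P j) (adj E (U j) (perp (P i) (adj E (U i) x)))"
    and cond3: "i \<in> {1..n} \<Longrightarrow> j \<in> {1..n} \<Longrightarrow> x \<in> E \<Longrightarrow>
      U i (P i (U j (P j x))) = U j (P j (U i (P i x)))"
    and cond4: "i \<in> {1..n} \<Longrightarrow> D (U i (P i (adj E (U i) (D h)))) = h - T i (Ta i h)"
begin

lemmas Es = closed_csubspaceD(1)[OF closed_E]

abbreviation Ua where "Ua i \<equiv> adj E (U i)"
abbreviation A where "A i x \<equiv> perp (P i) (Ua i x)"
abbreviation B where "B i x \<equiv> P i (Ua i x)"
abbreviation K :: "('a \<times> 'a ell2) set" where "K \<equiv> UNIV \<times> ell2_in E"
abbreviation Z where "Z i \<equiv> block_op D (T i) (U i) (P i)"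
abbreviation V where "V i \<equiv> block_adj D (Ta i) (Ua i) (P i)"

lemmas U_pair = unitary_opD(1)[OF closed_E U_unitary]
lemmas U_inverse [simp] = unitary_opD(2,3)[OF closed_E U_unitary]
lemmas P_pair = projection_opD(1)[OF closed_E P_proj]
lemmas P_idem [simp] = projection_opD(2)[OF closed_E P_proj]
lemmas perp_proj = projection_op_perp[OF closed_E P_proj]
lemmas perp_pair = projection_opD(1)[OF closed_E perp_proj]

lemma E_in [simp]: "0 \<in> E" "x \<in> E \<Longrightarrow> y \<in> E \<Longrightarrow> x + y \<in> E" "x \<in> E \<Longrightarrow> y \<in> E \<Longrightarrow> x - y \<in> E"
  using Es by (simp_all add: csubspace_zero csubspace_add csubspace_diff)

lemma op_in [simp]:
  assumes "i \<in> {1..n}" "x \<in> E"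
  shows "U i x \<in> E" "Ua i x \<in> E" "P i x \<in> E" "perp (P i) x \<in> E"
  using assms adjoint_pair_in1[OF U_pair] adjoint_pair_in2[OF U_pair] adjoint_pair_in1[OF P_pair]
    adjoint_pair_in1[OF perp_pair] by auto

lemma D_in [simp]: "D h \<in> E"
  using adjoint_pair_in1[OF D_pair] by simp

lemmas D_zero = adjoint_pair_zero[OF csubspace_UNIV Es adjoint_pair_sym[OF D_pair]]
lemmas U_linear = adjoint_pair_add[OF Es Es U_pair] adjoint_pair_diff[OF Es Es U_pair]
  adjoint_pair_zero[OF Es Es U_pair]
lemmas Ua_linear = adjoint_pair_add[OF Es Es adjoint_pair_sym[OF U_pair]]
  adjoint_pair_diff[OF Es Es adjoint_pair_sym[OF U_pair]]
  adjoint_pair_zero[OF Es Es adjoint_pair_sym[OF U_pair]]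
lemmas P_linear = adjoint_pair_add[OF Es Es P_pair] adjoint_pair_diff[OF Es Es P_pair]
  adjoint_pair_zero[OF Es Es P_pair]
lemmas perp_linear = adjoint_pair_add[OF Es Es perp_pair] adjoint_pair_diff[OF Es Es perp_pair]
  adjoint_pair_zero[OF Es Es perp_pair]

lemma P_perp [simp]:
  assumes "i \<in> {1..n}" "x \<in> E"
  shows "P i (perp (P i) x) = 0" "perp (P i) (P i x) = 0" "perp (P i) (perp (P i) x) = perp (P i) x"
  using assms P_linear(2)[OF assms(1), of x "P i x"] P_linear(2)[OF assms(1), of x "perp (P i) x"]
  by (auto simp: perp_def)

lemma Ua_eq: "A i x + B i x = Ua i x"
  by (simp add: perp_def)

lemma Ua_commute:
  assumes "i \<in> {1..n}" "j \<in> {1..n}" "x \<in> E"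
  shows "Ua i (Ua j x) = Ua j (Ua i x)"
proof (rule cinner_eqI[OF Es])
  fix y assume "y \<in> E"
  then show "cinner (Ua i (Ua j x)) y = cinner (Ua j (Ua i x)) y"
    using assms U_commuting
    by (simp add: adjoint_pair_eq[OF adjoint_pair_sym[OF U_pair]] commuting_tuple_def)
qed (use assms in auto)

lemma B_commute:
  assumes "i \<in> {1..n}" "j \<in> {1..n}" "x \<in> E"
  shows "B i (B j x) = B j (B i x)"
proof (rule cinner_eqI[OF Es])
  fix y assume "y \<in> E"
  then show "cinner (B i (B j x)) y = cinner (B j (B i x)) y"
    using assms cond3[of j i y]
    by (simp add: adjoint_pair_eq[OF adjoint_pair_sym[OF U_pair]] adjoint_pair_eq[OF P_pair])
qed (use assms in auto)

text \<open>Compare the two expansions of \<open>(A i + B i) (A j + B j)\<close>, which is \<open>Ua i Ua j\<close>.\<close>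

lemma AB_commute:
  assumes "i \<in> {1..n}" "j \<in> {1..n}" "x \<in> E"
  shows "A i (B j x) + B i (A j x) = A j (B i x) + B j (A i x)"
proof -
  have "Ua k (Ua l x) = A k (A l x) + (A k (B l x) + B k (A l x)) + B k (B l x)"
    if kl: "k \<in> {1..n}" "l \<in> {1..n}" for k l
  proof -
    have "Ua k (Ua l x) = Ua k (A l x + B l x)" by (simp only: Ua_eq)
    also have "\<dots> = Ua k (A l x) + Ua k (B l x)"
      using kl assms(3) by (intro Ua_linear) auto
    also have "\<dots> = (A k (A l x) + B k (A l x)) + (A k (B l x) + B k (B l x))"
      by (simp only: Ua_eq)
    finally show ?thesis by (simp only: add_ac)
  qed
  from this[OF assms(1,2)] this[OF assms(2,1)] show ?thesis
    unfolding Ua_commute[OF assms] cond2[OF assms] B_commute[OF assms]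
    by (simp only: add_left_cancel add_right_cancel)
qed

lemma Ta_commute: "i \<in> {1..n} \<Longrightarrow> j \<in> {1..n} \<Longrightarrow> Ta i (Ta j h) = Ta j (Ta i h)"
proof (rule cinner_eqI[OF csubspace_UNIV])
  fix g assume "i \<in> {1..n}" "j \<in> {1..n}"
  then show "cinner (Ta i (Ta j h)) g = cinner (Ta j (Ta i h)) g"
    using T_commuting by (simp add: adjoint_pair_eq[OF adjoint_pair_sym[OF T_pair]] commuting_tuple_def)
qed auto

lemma bounded_entries:
  assumes "i \<in> {1..n}"
  shows "bounded_op E E (\<lambda>x. U i (perp (P i) x))" "bounded_op E E (\<lambda>x. U i (P i x))"
    "bounded_op E E (A i)" "bounded_op E E (B i)"
proof -
  have b: "bounded_op E E (U i)" "bounded_op E E (P i)" "bounded_op E E (perp (P i))"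
    using assms U_unitary P_proj perp_proj by (auto simp: unitary_op_def projection_op_def)
  have "bounded_op E E (Ua i)"
    using assms by (intro bounded_op_if_adjoint_isometric[OF Es Es adjoint_pair_sym[OF U_pair]]) auto
  then show "bounded_op E E (\<lambda>x. U i (perp (P i) x))" "bounded_op E E (\<lambda>x. U i (P i x))"
    "bounded_op E E (A i)" "bounded_op E E (B i)"
    using b bounded_op_comp[of E E _ E] by (auto simp: o_def)
qed

lemma closed_K: "closed_csubspace K"
  by (intro closed_csubspace_Times closed_csubspace_UNIV closed_csubspace_ell2_in closed_E)

lemma seq_in: "v \<in> K \<Longrightarrow> seq (snd v) k \<in> E"
  by (auto simp: ell2_in_def)

lemma case_nat_in: "v \<in> K \<Longrightarrow> case_nat (D h) (seq (snd v)) k \<in> E"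
  by (cases k) (auto simp: seq_in)

lemma square_summable_entries:
  assumes i: "i \<in> {1..n}" and v: "v \<in> K"
  shows "square_summable (\<lambda>k. U i (perp (P i) (seq (snd v) k)))"
    "square_summable (\<lambda>k. U i (P i (seq (snd v) (Suc k))))"
    "square_summable (\<lambda>k. A i (seq (snd v) k))" "square_summable (\<lambda>k. B i (seq (snd v) k))"
    "square_summable (\<lambda>k. B i (case_nat (D (fst v)) (seq (snd v)) k))"
  using v square_summable_bounded_op[OF bounded_entries(1)[OF i], of "seq (snd v)"]
    square_summable_bounded_op[OF bounded_entries(2)[OF i], of "\<lambda>k. seq (snd v) (Suc k)"]
    square_summable_bounded_op[OF bounded_entries(3)[OF i], of "seq (snd v)"]
    square_summable_bounded_op[OF bounded_entries(4)[OF i], of "seq (snd v)"]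
    square_summable_bounded_op[OF bounded_entries(4)[OF i], of "case_nat (D (fst v)) (seq (snd v))"]
  by (auto simp: seq_in case_nat_in square_summable_seq square_summable_Suc square_summable_case_nat)

lemma fst_Z: "fst (Z i v) = T i (fst v) + D (U i (P i (seq (snd v) 0)))"
  by (simp add: block_op_def split: prod.split)

lemma seq_Z:
  assumes "i \<in> {1..n}" "v \<in> K"
  shows "seq (snd (Z i v)) k = U i (perp (P i) (seq (snd v) k)) + U i (P i (seq (snd v) (Suc k)))"
  using square_summable_add[OF square_summable_entries(1,2)[OF assms]]
  by (cases v) (simp add: block_op_def seq_Abs_ell2)

lemma fst_V: "fst (V i v) = Ta i (fst v)"
  by (simp add: block_adj_def)

lemma seq_V:
  assumes "i \<in> {1..n}" "v \<in> K"
  shows "seq (snd (V i v)) k = B i (case_nat (D (fst v)) (seq (snd v)) k) + A i (seq (snd v) k)"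
  using square_summable_add[OF square_summable_entries(5,3)[OF assms]]
  by (simp add: block_adj_def seq_Abs_ell2)

lemma Z_in_K: "i \<in> {1..n} \<Longrightarrow> v \<in> K \<Longrightarrow> Z i v \<in> K"
  by (cases "Z i v") (use seq_Z[of i v] in \<open>auto simp: ell2_in_def seq_in\<close>)

lemma V_in_K: "i \<in> {1..n} \<Longrightarrow> v \<in> K \<Longrightarrow> V i v \<in> K"
  by (cases "V i v") (use seq_V[of i v] in \<open>auto simp: ell2_in_def seq_in case_nat_in\<close>)

lemma K_eqI: "fst u = fst v \<Longrightarrow> (\<And>k. seq (snd u) k = seq (snd v) k) \<Longrightarrow> u = v"
  by (simp add: prod_eq_iff ell2_eqI)

lemma Z_pair:
  assumes i: "i \<in> {1..n}"
  shows "adjoint_pair K K (Z i) (V i)"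
proof (rule adjoint_pairI)
  fix u v assume u: "u \<in> K" and v: "v \<in> K"
  define h x g y where "h = fst u" "x = seq (snd u)" "g = fst v" "y = seq (snd v)"
  have E: "x k \<in> E" "y k \<in> E" for k using seq_in u v by (simp_all add: h_x_g_y_def)
  define a b where "a k = cinner (x k) (A i (y k))" and "b k = cinner (x (Suc k)) (B i (y k))" for k
  have "summable a" "summable b"
    unfolding a_def b_def h_x_g_y_def
    using square_summable_entries(3,4)[OF i v]
    by (auto intro!: summable_cinner square_summable_seq square_summable_Suc)
  then obtain sa sb where s: "a sums sa" "b sums sb" using summable_sums by blast
  have "cinner (seq (snd (Z i u)) k) (y k) = a k + b k" for k
    using i E by (simp add: seq_Z[OF i u] h_x_g_y_def(2)[symmetric] a_def b_def cinner_add_left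
        adjoint_pair_eq[OF U_pair] adjoint_pair_eq[OF P_pair] adjoint_pair_eq[OF perp_pair])
  then have Z: "cinner (snd (Z i u)) (snd v) = sa + sb"
    using sums_add[OF s] cinner_ell2_sums[of "snd (Z i u)" "snd v"] sums_unique2
    by (simp add: h_x_g_y_def) blast
  define c where "c k = cinner (x k) (B i (case_nat (D g) y k))" for k
  have "c sums (sb + c 0)"
    using s(2) unfolding b_def by (subst sums_Suc_iff[symmetric]) (simp add: c_def)
  from sums_add[OF this s(1)] have "(\<lambda>k. c k + a k) sums (sb + c 0 + sa)" .
  moreover have "cinner (x k) (seq (snd (V i v)) k) = c k + a k" for k
    unfolding c_def a_def seq_V[OF i v] h_x_g_y_def by (simp add: cinner_add_right)
  ultimately have V: "cinner (snd u) (snd (V i v)) = sb + c 0 + sa"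
    using cinner_ell2_sums[of "snd u" "snd (V i v)"] sums_unique2
    by (simp add: h_x_g_y_def) blast
  have "cinner (D (U i (P i (x 0)))) g = cinner (U i (P i (x 0))) (D g)"
    using adjoint_pair_eq[OF adjoint_pair_sym[OF D_pair]] i E by simp
  also have "\<dots> = c 0"
    using i E by (simp add: c_def adjoint_pair_eq[OF U_pair] adjoint_pair_eq[OF P_pair])
  finally have "cinner (fst (Z i u)) g = cinner h (Ta i g) + c 0"
    using adjoint_pair_eq[OF T_pair[OF i], of h g]
    by (simp add: fst_Z h_x_g_y_def(1,2)[symmetric] cinner_add_left)
  then show "cinner (Z i u) v = cinner u (V i v)"
    unfolding cinner_prod_def Z V by (simp add: fst_V h_x_g_y_def(1,3)[symmetric])
qed (use i Z_in_K V_in_K in auto)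

lemma Z_V:
  assumes i: "i \<in> {1..n}" and v: "v \<in> K"
  shows "Z i (V i v) = v"
proof (rule K_eqI)
  note in_E = seq_in[OF v] case_nat_in[OF v]
  have "P i (seq (snd (V i v)) 0) = B i (D (fst v))"
    using i in_E by (simp add: seq_V[OF i v] P_linear)
  then show "fst (Z i (V i v)) = fst v"
    by (simp add: fst_Z fst_V cond4[OF i])
  fix k
  have "seq (snd (Z i (V i v))) k = U i (A i (seq (snd v) k)) + U i (B i (seq (snd v) k))"
    using i in_E(1)[of k] in_E(1)[of "Suc k"] in_E(2)[where k=k]
    by (simp add: seq_Z[OF i V_in_K[OF i v]] seq_V[OF i v] P_linear perp_linear)
  also have "\<dots> = U i (A i (seq (snd v) k) + B i (seq (snd v) k))"
    using i in_E by (simp add: U_linear)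
  also have "\<dots> = seq (snd v) k"
    unfolding Ua_eq using i in_E by simp
  finally show "seq (snd (Z i (V i v))) k = seq (snd v) k" .
qed

text \<open>
  A vector \<open>(h, x)\<close> is extended to a two-sided sequence by \<open>D h, D T\<^sup>* h, D T\<^sup>*\<^sup>2 h, \<dots>\<close> to the
  left of \<open>x\<close>. By the formula for \<open>D (Ta i h)\<close>, \<open>V i\<close> then acts on two-sided sequences as the operator
  pencil \<open>A i + B i s\<close>, where \<open>s\<close> is the bilateral shift.
\<close>

definition extension where
  "extension v k = (if 0 \<le> k then seq (snd v) (nat k)
     else D ((op_prod Ta n ^^ nat (- k - 1)) (fst v)))"

definition pencil where "pencil i f k = A i (f k) + B i (f (k - 1))" for f :: "int \<Rightarrow> 'a" and k

lemma extension_in: "v \<in> K \<Longrightarrow> extension v k \<in> E"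
  by (simp add: extension_def seq_in)

lemma Ta_power_commute:
  "i \<in> {1..n} \<Longrightarrow> (op_prod Ta n ^^ m) (Ta i h) = Ta i ((op_prod Ta n ^^ m) h)"
proof (induction m)
  case (Suc m)
  have "Ta i (op_prod Ta n g) = op_prod Ta n (Ta i g)" for g
    by (rule op_prod_commutes[where S=UNIV]) (use Suc.prems Ta_commute in auto)
  then show ?case using Suc by simp
qed simp

lemma extension_V:
  assumes i: "i \<in> {1..n}" and v: "v \<in> K"
  shows "extension (V i v) = pencil i (extension v)"
proof
  fix k :: int
  consider "k < 0" | "k = 0" | "k > 0" by linarith
  then show "extension (V i v) k = pencil i (extension v) k"
  proof cases
    case 1
    define m where "m = nat (- k - 1)"
    have m: "nat (- (k - 1) - 1) = Suc m" using 1 by (simp add: m_def)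
    show ?thesis
      using 1 m cond1[OF i, of "(op_prod Ta n ^^ m) (fst v)"]
      by (simp add: extension_def pencil_def fst_V Ta_power_commute[OF i] m_def[symmetric])
  next
    case 2
    then show ?thesis by (simp add: extension_def pencil_def seq_V[OF i v])
  next
    case 3
    then obtain m where "nat k = Suc m" "nat (k - 1) = m" by (metis Suc_nat_eq_nat_zadd1 diff_add_cancel zle_diff1_eq add.commute)
    then show ?thesis using 3 by (simp add: extension_def pencil_def seq_V[OF i v])
  qed
qed

lemma pencil_in: "i \<in> {1..n} \<Longrightarrow> (\<And>k. f k \<in> E) \<Longrightarrow> pencil i f k \<in> E"
  by (simp add: pencil_def)

lemma pencil_commute:
  assumes ij: "i \<in> {1..n}" "j \<in> {1..n}" and f: "\<And>k. f k \<in> E"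
  shows "pencil i (pencil j f) = pencil j (pencil i f)"
proof
  fix k
  have "pencil i (pencil j f) k =
      A i (A j (f k)) + (A i (B j (f (k - 1))) + B i (A j (f (k - 1)))) + B i (B j (f (k - 2)))"
    if "i \<in> {1..n}" "j \<in> {1..n}" for i j
    using that f by (simp add: pencil_def P_linear perp_linear Ua_linear add_ac)
  then show "pencil i (pencil j f) k = pencil j (pencil i f) k"
    using ij cond2[OF ij f[of k]] AB_commute[OF ij f[of "k - 1"]] B_commute[OF ij f[of "k - 2"]]
    by simp
qed

lemma V_commute:
  assumes i: "i \<in> {1..n}" and j: "j \<in> {1..n}" and v: "v \<in> K"
  shows "V i (V j v) = V j (V i v)"
proof (rule K_eqI)
  show "fst (V i (V j v)) = fst (V j (V i v))" using i j by (simp add: fst_V Ta_commute[of i j])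
  fix k
  have "extension (V i (V j v)) = extension (V j (V i v))"
    using i j v by (simp add: extension_V V_in_K pencil_commute extension_in)
  then have "extension (V i (V j v)) (int k) = extension (V j (V i v)) (int k)" by simp
  then show "seq (snd (V i (V j v))) k = seq (snd (V j (V i v))) k" by (simp add: extension_def)
qed

sublocale commuting_isometries K n Z V
  by unfold_locales (use closed_K Z_pair Z_V V_commute in auto)

end

context dilation_data
begin

lemma Z_embedded: "i \<in> {1..n} \<Longrightarrow> Z i (h, 0) = (T i h, 0)"
proof (rule K_eqI)
  assume i: "i \<in> {1..n}"
  have K: "(h, 0) \<in> K" by (simp add: ell2_in_def zero_ell2.rep_eq)
  show "fst (Z i (h, 0)) = fst (T i h, 0 :: 'a ell2)"
    using i by (simp add: fst_Z zero_ell2.rep_eq P_linear U_linear D_zero)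
  show "seq (snd (Z i (h, 0))) k = seq (snd (T i h, 0)) k" for k
    using i by (simp add: seq_Z[OF i K] zero_ell2.rep_eq P_linear perp_linear U_linear)
qed

lemma ZZ_embedded: "ZZ (h, 0) = (op_prod T n h, 0)"
proof -
  have "m \<le> n \<Longrightarrow> op_prod Z m (h, 0) = (op_prod T m h, 0)" for m
    by (induction m arbitrary: h) (simp_all add: Z_embedded)
  then show ?thesis by simp
qed

section \<open>The product of the pencils\<close>

text \<open>The summands of the summation condition.\<close>

definition conj_proj where
  "conj_proj i x = op_prod Ua (i - 1) (P i (op_prod_rev U (i - 1) x))"

lemma prod_in [simp]: "m \<le> n \<Longrightarrow> x \<in> E \<Longrightarrow> op_prod Ua m x \<in> E"
  "m \<le> n \<Longrightarrow> x \<in> E \<Longrightarrow> op_prod_rev U m x \<in> E"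
  by (auto intro!: op_prod_in op_prod_rev_in)

lemma prod_pair: "m \<le> n \<Longrightarrow> adjoint_pair E E (op_prod Ua m) (op_prod_rev U m)"
  by (rule op_prod_adjoint_pair) (auto intro: adjoint_pair_sym[OF U_pair])

lemma prod_inverse:
  assumes m: "m \<le> n" and x: "x \<in> E"
  shows "op_prod_rev U m (op_prod Ua m x) = x"
proof -
  have c: "commuting_tuple E m U" "commuting_tuple E m Ua"
    using m U_commuting Ua_commute by (auto simp: commuting_tuple_def)
  have "op_prod_rev U m (op_prod Ua m x) = op_prod U m (op_prod Ua m x)"
    using m x c(1) by (intro op_prod_rev_eq_op_prod[where S=E]) auto
  moreover have "op_prod Ua m x = op_prod_rev Ua m x"
    using m x c(2) by (intro op_prod_rev_eq_op_prod[where S=E, symmetric]) auto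
  moreover have "op_prod U m (op_prod_rev Ua m x) = x"
    using m x by (intro op_prod_left_inverse[where S=E]) auto
  ultimately show ?thesis by simp
qed

lemma pred_index [simp]: "i \<in> {1..n} \<Longrightarrow> i - Suc 0 \<le> n"
  by auto

lemma conj_proj_in [simp]: "i \<in> {1..n} \<Longrightarrow> x \<in> E \<Longrightarrow> conj_proj i x \<in> E"
  by (simp add: conj_proj_def)

lemma conj_proj_pair:
  assumes "i \<in> {1..n}"
  shows "adjoint_pair E E (conj_proj i) (conj_proj i)"
proof -
  have p: "adjoint_pair E E (op_prod Ua (i - 1)) (op_prod_rev U (i - 1))"
    using assms by (intro prod_pair) auto
  from adjoint_pair_comp[OF adjoint_pair_comp[OF adjoint_pair_sym[OF p] P_pair[OF assms]] p]
  show ?thesis by (simp add: conj_proj_def[abs_def])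
qed

lemma conj_proj_idem: "i \<in> {1..n} \<Longrightarrow> x \<in> E \<Longrightarrow> conj_proj i (conj_proj i x) = conj_proj i x"
  by (simp add: conj_proj_def prod_inverse)

lemma prod_P: "Suc m \<le> n \<Longrightarrow> x \<in> E \<Longrightarrow> op_prod Ua m (P (Suc m) x) = conj_proj (Suc m) (op_prod Ua m x)"
  by (simp add: conj_proj_def prod_inverse)

context
  assumes sum_id: "x \<in> E \<Longrightarrow> (\<Sum>i=1..n. conj_proj i x) = x"
begin

text \<open>
  Moving the unitaries to the right turns the product of the pencils \<open>A i + B i s\<close> into that of
  the factors \<open>(I - Q\<^sub>i) + Q\<^sub>i s\<close>, for \<open>Q\<^sub>i\<close> the conjugated projections. As the \<open>Q\<^sub>i\<close> are
  mutually orthogonal, the product of the first \<open>m\<close> factors is \<open>(I - \<Sigma>) + \<Sigma> s\<close>, for \<open>\<Sigma>\<close> the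
  sum of the first \<open>m\<close> of them.
\<close>

lemma pencil_product:
  assumes f: "\<And>k. f k \<in> E" and m: "m \<le> n"
  shows "op_prod pencil m f k =
    op_prod Ua m (f k) - (\<Sum>i=1..m. conj_proj i (op_prod Ua m (f k)))
      + (\<Sum>i=1..m. conj_proj i (op_prod Ua m (f (k - 1))))"
  using f m
proof (induction m arbitrary: f k)
  case (Suc m)
  note f = Suc.prems(1)
  have i: "Suc m \<in> {1..n}" and m: "m \<le> n" using Suc.prems(2) by auto
  define W where "W = op_prod Ua (Suc m)"
  define q where "q = conj_proj (Suc m)"
  define \<Sigma> where "\<Sigma> x = (\<Sum>i=1..m. conj_proj i x)" for x
  have lin: "op_prod Ua m (x - y) = op_prod Ua m x - op_prod Ua m y"
      "op_prod Ua m (x + y) = op_prod Ua m x + op_prod Ua m y" if "x \<in> E" "y \<in> E" for x y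
    using adjoint_pair_diff[OF Es Es prod_pair[OF m] that]
      adjoint_pair_add[OF Es Es prod_pair[OF m] that] .
  have WE: "W x \<in> E" and qE: "q x \<in> E" if "x \<in> E" for x
    using that i Suc.prems(2) unfolding W_def q_def by (auto simp del: op_prod.simps)
  have \<Sigma>_lin: "\<Sigma> (x + y) = \<Sigma> x + \<Sigma> y" "\<Sigma> (x - y) = \<Sigma> x - \<Sigma> y" if "x \<in> E" "y \<in> E" for x y
    using that m
    by (auto simp: \<Sigma>_def sum.distrib[symmetric] sum_subtractf[symmetric] intro!: sum.cong
        adjoint_pair_add[OF Es Es conj_proj_pair] adjoint_pair_diff[OF Es Es conj_proj_pair])
  have \<Sigma>q: "\<Sigma> (q x) = 0" if "x \<in> E" for x
    unfolding \<Sigma>_def q_def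
  proof (rule sum.neutral, rule ballI)
    fix j assume j: "j \<in> {1..m}"
    show "conj_proj j (conj_proj (Suc m) x) = 0"
      by (rule projections_orthogonal_if_sum_id[OF Es, of "{1..n}"])
        (use j i m that conj_proj_pair conj_proj_idem sum_id in auto)
  qed
  have step: "op_prod Ua m (pencil (Suc m) f k) = (W (f k) - q (W (f k))) + q (W (f (k - 1)))" for k
  proof -
    have *: "op_prod Ua m (P (Suc m) (Ua (Suc m) x)) = q (W x)"
      "op_prod Ua m (Ua (Suc m) x) = W x" if "x \<in> E" for x
      using that i by (simp_all add: prod_P q_def W_def)
    have "op_prod Ua m (pencil (Suc m) f k) =
        (op_prod Ua m (Ua (Suc m) (f k)) - op_prod Ua m (P (Suc m) (Ua (Suc m) (f k)))) +
        op_prod Ua m (P (Suc m) (Ua (Suc m) (f (k - 1))))"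
      using i f by (simp add: pencil_def perp_def lin)
    then show ?thesis using * f by simp
  qed
  define u v w where "u = W (f k)" and "v = W (f (k - 1))" and "w = W (f (k - 2))"
  have E: "u \<in> E" "v \<in> E" "w \<in> E" "q u \<in> E" "q v \<in> E" "q w \<in> E"
    using f WE qE by (simp_all add: u_def v_def w_def)
  have "op_prod pencil (Suc m) f k = op_prod pencil m (pencil (Suc m) f) k" by simp
  also have "\<dots> = (u - q u + q v) - \<Sigma> (u - q u + q v) + \<Sigma> (v - q v + q w)"
    unfolding Suc.IH[OF pencil_in[OF i f] m] step u_def v_def w_def \<Sigma>_def by (simp add: algebra_simps)
  also have "\<dots> = u - (\<Sigma> u + q u) + (\<Sigma> v + q v)"
    using E by (simp add: \<Sigma>_lin \<Sigma>q)
  finally show ?case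
    by (simp add: \<Sigma>_def q_def W_def[symmetric] u_def v_def del: op_prod.simps)
qed simp

lemma extension_VV:
  assumes v: "v \<in> K"
  shows "extension (VV v) k = op_prod Ua n (extension v (k - 1))"
proof -
  have "extension (op_prod V m v) = op_prod pencil m (extension v)" if "m \<le> n" "v \<in> K" for m v
    using that by (induction m arbitrary: v) (simp_all add: extension_V V_in_K)
  then have "extension (VV v) k = op_prod pencil n (extension v) k" using v by simp
  also have "\<dots> = op_prod Ua n (extension v (k - 1))"
    unfolding pencil_product[OF extension_in[OF v] order_refl]
      sum_id[OF prod_in(1)[OF order_refl extension_in[OF v]]] by simp
  finally show ?thesis .
qed

lemma seq_VV_0: "v \<in> K \<Longrightarrow> seq (snd (VV v)) 0 = op_prod Ua n (D (fst v))"
  using extension_VV[of v 0] by (simp add: extension_def)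

lemma seq_VV_Suc: "v \<in> K \<Longrightarrow> seq (snd (VV v)) (Suc k) = op_prod Ua n (seq (snd v) k)"
proof -
  have "nat (1 + int k) = Suc k" by simp
  then show "v \<in> K \<Longrightarrow> seq (snd (VV v)) (Suc k) = op_prod Ua n (seq (snd v) k)"
    using extension_VV[of v "1 + int k"] by (simp add: extension_def)
qed

text \<open>
  A vector annihilated by \<open>ZZ\<close> is orthogonal to the range of \<open>VV\<close>. The sequence part of
  \<open>VV (h, y)\<close> is \<open>U\<^sup>* D h, U\<^sup>* y\<^sub>0, U\<^sup>* y\<^sub>1, \<dots>\<close>, for \<open>U\<close> the product of the \<open>U i\<close>. Taking \<open>y = 0\<close>
  shows that the first entry of \<open>x\<close> vanishes, taking \<open>h = 0\<close> and \<open>y\<^sub>k = U x\<^sub>k\<^sub>+\<^sub>1\<close> that the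
  others do.
\<close>

lemma ZZ_kernel_trivial:
  assumes x: "x \<in> ell2_in E" and "ZZ (0, x) = 0"
  shows "x = 0"
proof (rule ell2_eqI)
  define Y where "Y = op_prod_rev U n"
  have xE: "seq x k \<in> E" and xK: "(0, x) \<in> K" for k using x by (auto simp: ell2_in_def)
  have YE: "Y e \<in> E" if "e \<in> E" for e using that by (simp add: Y_def)
  have Y_pair: "cinner (Y a) b = cinner a (op_prod Ua n b)" if "a \<in> E" "b \<in> E" for a b
    using adjoint_pair_eq[OF adjoint_pair_sym[OF prod_pair[OF order_refl]] that] by (simp add: Y_def)
  have Y_injective: "e = 0" if "e \<in> E" "Y e = 0" for e
  proof (rule cinner_eqI[OF Es])
    fix d assume d: "d \<in> E"
    have "d = op_prod Ua n (Y d)"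
      unfolding Y_def using d
        op_prod_left_inverse[of n E U Ua d] by simp
    then show "cinner e d = cinner 0 d"
      using Y_pair[OF that(1) YE[OF d]] that(2) by (simp add: cinner_zero_left)
  qed (use that in auto)
  have orth: "(\<lambda>k. cinner (seq x k) (seq (snd (VV v)) k)) sums 0" if v: "v \<in> K" for v
  proof -
    have "cinner (0, x) (VV v) = 0"
      using adjoint_pair_eq[OF VV_pair xK v] assms(2) by (simp add: cinner_zero_left)
    then show ?thesis using cinner_ell2_sums[of x "snd (VV v)"] by (simp add: cinner_prod_def cinner_zero_left)
  qed
  have "D (Y (seq x 0)) = 0"
  proof (rule cinner_eqI[OF csubspace_UNIV])
    fix h
    have K: "(h, 0) \<in> K" by (simp add: ell2_in_def zero_ell2.rep_eq)
    have zero: "op_prod Ua n 0 = 0" using adjoint_pair_zero[OF Es Es prod_pair[OF order_refl]] .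
    have "seq (snd (VV (h, 0))) k = (if k = 0 then op_prod Ua n (D h) else 0)" for k
      using seq_VV_0[OF K] seq_VV_Suc[OF K] zero by (cases k) (simp_all add: zero_ell2.rep_eq)
    then have "cinner (seq x k) (seq (snd (VV (h, 0))) k) =
        (if k = 0 then cinner (seq x 0) (op_prod Ua n (D h)) else 0)" for k
      by (simp add: cinner_zero_right)
    from orth[OF K, unfolded this]
    have "cinner (seq x 0) (op_prod Ua n (D h)) = 0"
      using sums_unique2[OF sums_single[of 0 "\<lambda>_. cinner (seq x 0) (op_prod Ua n (D h))"]] by simp
    then show "cinner (D (Y (seq x 0))) h = cinner 0 h"
      using adjoint_pair_eq[OF adjoint_pair_sym[OF D_pair] YE[OF xE], of h 0] Y_pair[OF xE D_in]
      by (simp add: cinner_zero_left)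
  qed auto
  then have x0: "seq x 0 = 0" using Y_injective[OF xE] D_injective[OF YE[OF xE]] by blast
  define y where "y = Abs_ell2 (\<lambda>k. Y (seq x (Suc k)))"
  have isometric: "norm (Y e) \<le> 1 * norm e" if "e \<in> E" for e
    using contractive_if_adjoint_isometric[OF adjoint_pair_sym[OF prod_pair[OF order_refl]]
        prod_inverse[OF order_refl] that] by (simp add: Y_def)
  have "bounded_op E E Y"
    using bounded_op_adjoint_pairI[OF Es Es adjoint_pair_sym[OF prod_pair[OF order_refl]]] isometric
    unfolding Y_def by blast
  then have "square_summable (\<lambda>k. Y (seq x (Suc k)))"
    using xE square_summable_Suc[OF square_summable_seq] by (rule square_summable_bounded_op)
  then have y: "seq y k = Y (seq x (Suc k))" for k
    unfolding y_def by (simp add: seq_Abs_ell2)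
  have yK: "(0, y) \<in> K" using y xE YE by (simp add: ell2_in_def)
  have "(\<lambda>k. cinner (seq x (Suc k)) (seq (snd (VV (0, y))) (Suc k))) sums 0"
    using orth[OF yK] sums_Suc_iff[of "\<lambda>k. cinner (seq x k) (seq (snd (VV (0, y))) k)" 0]
    by (simp add: x0 cinner_zero_left)
  moreover have "cinner (seq x (Suc k)) (seq (snd (VV (0, y))) (Suc k)) =
      complex_of_real ((norm (Y (seq x (Suc k))))\<^sup>2)" for k
    using seq_VV_Suc[OF yK, of k] y Y_pair[OF xE YE[OF xE], of "Suc k" "Suc k"]
    by (simp add: cinner_self)
  ultimately have "(\<lambda>k. complex_of_real ((norm (Y (seq x (Suc k))))\<^sup>2)) sums complex_of_real 0" by simp
  then have s: "(\<lambda>k. (norm (Y (seq x (Suc k))))\<^sup>2) sums 0" unfolding sums_of_real_iff .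
  have "(norm (Y (seq x (Suc k))))\<^sup>2 = 0" for k
    using s suminf_eq_zero_iff[of "\<lambda>k. (norm (Y (seq x (Suc k))))\<^sup>2"] by (auto simp: sums_iff)
  then have "seq x (Suc k) = 0" for k using Y_injective[OF xE] by simp
  with x0 show "seq x k = seq 0 k" for k by (cases k) (simp_all add: zero_ell2.rep_eq)
qed

lemma embedded_in_K: "(h, 0) \<in> K"
  by (simp add: ell2_in_def zero_ell2.rep_eq)

text \<open>
  A vector of \<open>L\<close> that is orthogonal to all \<open>Q (h, 0)\<close> is orthogonal to all \<open>(h, 0)\<close>, so its first
  component vanishes, and \<open>ZZ_kernel_trivial\<close> applies.
\<close>

lemma Q_embedded_dense: "closure (range (\<lambda>h. Q (h, 0))) = L"
proof -
  define M where "M = closure (range (\<lambda>h. Q (h, 0)))"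
  have add: "Q (h + g, 0) = Q (h, 0) + Q (g, 0)" for h g
    using Q_linear(1)[OF embedded_in_K embedded_in_K, of h g] by simp
  have scale: "Q (a *\<^sub>C h, 0) = a *\<^sub>C Q (h, 0)" for a h
    using Q_linear(3)[OF embedded_in_K, of a h] by (simp add: scaleC_prod_def scaleC_zero_right)
  have M: "closed_csubspace M"
    unfolding M_def by (intro closed_csubspace_closure csubspace_image) (simp_all add: add scale)
  have "Q (h, 0) \<in> L" for h using Q_in_L[OF embedded_in_K] .
  then have M_L: "M \<subseteq> L"
    unfolding M_def using closed_csubspaceD(2)[OF L_closed] by (intro closure_minimal) auto
  have "l \<in> M" if l: "l \<in> L" for l
  proof -
    obtain p where p: "p \<in> M" "\<forall>m\<in>M. cinner (l - p) m = 0"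
      using ex_orthogonal_projection[OF M] by blast
    have lp: "l - p \<in> L" using l p(1) M_L by (intro csubspace_diff[OF Ls]) auto
    define h x where "h = fst (l - p)" and "x = snd (l - p)"
    then have eq: "l - p = (h, x)" by (simp only: prod.collapse)
    note hx = eq lp[unfolded eq] L_S[OF lp, unfolded eq]
    have "cinner (h, x) (g, 0) = 0" for g
    proof -
      have "Q (g, 0) \<in> M"
        unfolding M_def by (rule subsetD[OF closure_subset]) simp
      then have "cinner (h, x) (Q (g, 0)) = 0" using p(2) hx(1) by simp
      then show ?thesis
        using adjoint_pair_eq[OF Q_pair hx(3) embedded_in_K, of g] Q_L[OF hx(2)] by simp
    qed
    from this[of h] have "h = 0"
      by (simp add: cinner_prod_def cinner_zero_right cinner_self_eq_0)
    moreover have "x = 0"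
      using ZZ_kernel_trivial[of x] hx(2,3) ZZ_L[OF hx(2)] \<open>h = 0\<close> by simp
    ultimately show ?thesis using hx(1) p(1) by (simp add: zero_prod_def[symmetric])
  qed
  then show ?thesis using M_L unfolding M_def by blast
qed

text \<open>
  Since \<open>ZZ (h, 0) = (T h, 0)\<close>, the squared norm of \<open>Q (h, 0)\<close> is \<open>\<parallel>h\<parallel>\<^sup>2 - \<parallel>T h\<parallel>\<^sup>2\<close>, for \<open>T\<close> the
  product of the \<open>T i\<close>; this is also that of \<open>Dt h\<close>.
\<close>

theorem ex_unitary_L_defect_space:
  assumes Dt: "\<And>h. (norm (Dt h))\<^sup>2 = (norm h)\<^sup>2 - (norm (op_prod T n h))\<^sup>2"
    and lin: "\<And>h g. Dt (h + g) = Dt h + Dt g" "\<And>a h. Dt (a *\<^sub>C h) = a *\<^sub>C Dt h"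
  shows "\<exists>J. unitary_op L (closure (range Dt)) J"
proof -
  have "norm (Q (h, 0)) = norm (Dt h)" for h
  proof -
    have "(norm (Q (h, 0)))\<^sup>2 = (norm (Dt h))\<^sup>2"
      using norm_Q[OF embedded_in_K, of h] by (simp add: ZZ_embedded norm_Pair Dt)
    then show ?thesis by (simp add: power2_eq_iff_nonneg)
  qed
  moreover have "Q (h + g, 0) = Q (h, 0) + Q (g, 0)" for h g
    using Q_linear(1)[OF embedded_in_K embedded_in_K, of h g] by simp
  moreover have "Q (a *\<^sub>C h, 0) = a *\<^sub>C Q (h, 0)" for a h
    using Q_linear(3)[OF embedded_in_K, of a h] by (simp add: scaleC_prod_def scaleC_zero_right)
  ultimately show ?thesis
    using ex_unitary_if_norm_eq[OF csubspace_UNIV, of "\<lambda>h. Q (h, 0)" Dt] lin Q_embedded_dense by auto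
qed

end

end

section \<open>The co-isometric extension of a tuple of contractions\<close>

theorem theorem7p1:
  fixes n :: nat
    and T P U :: "nat \<Rightarrow> 'a::complex_hilbert \<Rightarrow> 'a"
    and TT Ds :: "'a \<Rightarrow> 'a"
    and DD :: "'a set"
    and K :: "('a \<times> 'a ell2) set"
    and Z :: "nat \<Rightarrow> 'a \<times> 'a ell2 \<Rightarrow> 'a \<times> 'a ell2"
    and ZZ :: "'a \<times> 'a ell2 \<Rightarrow> 'a \<times> 'a ell2"
  defines "TT \<equiv> op_prod T n"
    and "Ds \<equiv> defect_op UNIV (adj UNIV TT)"
    and "DD \<equiv> defect_space UNIV (adj UNIV TT)"
    and "K \<equiv> UNIV \<times> ell2_in DD"
    and "Z \<equiv> (\<lambda>i. block_op Ds (T i) (U i) (P i))"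
    and "ZZ \<equiv> op_prod Z n"
  assumes n: "n \<ge> 1"
    and T_contraction: "\<And>i. i \<in> {1..n} \<Longrightarrow> contraction_op UNIV (T i)"
    and T_commuting: "commuting_tuple UNIV n T"
    and P_projection: "\<And>i. i \<in> {1..n} \<Longrightarrow> projection_op DD (P i)"
    and U_unitary: "\<And>i. i \<in> {1..n} \<Longrightarrow> unitary_op DD DD (U i)"
    and U_commuting: "commuting_tuple DD n U"
    and cond1: "\<And>i h. i \<in> {1..n} \<Longrightarrow>
      Ds (adj UNIV (T i) h) =
        perp (P i) (adj DD (U i) (Ds h)) + P i (adj DD (U i) (Ds (adj UNIV TT h)))"
    and cond2: "\<And>i j x. i \<in> {1..n} \<Longrightarrow> j \<in> {1..n} \<Longrightarrow> x \<in> DD \<Longrightarrow>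
      perp (P i) (adj DD (U i) (perp (P j) (adj DD (U j) x))) =
      perp (P j) (adj DD (U j) (perp (P i) (adj DD (U i) x)))"
    and cond3: "\<And>i j x. i \<in> {1..n} \<Longrightarrow> j \<in> {1..n} \<Longrightarrow> x \<in> DD \<Longrightarrow>
      U i (P i (U j (P j x))) = U j (P j (U i (P i x)))"
    and cond4: "\<And>i h. i \<in> {1..n} \<Longrightarrow>
      Ds (U i (P i (adj DD (U i) (Ds h)))) =
      defect_op UNIV (adj UNIV (T i)) (defect_op UNIV (adj UNIV (T i)) h)"
  shows
    \<comment> \<open>(i)\<close>
    "coisometric_tuple K n Z \<and>
     (\<forall>i\<in>{1..n}. Z i ` (UNIV \<times> {0}) \<subseteq> UNIV \<times> {0} \<and> (\<forall>h. Z i (h, 0) = (T i h, 0))) \<and>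
     \<comment> \<open>(ii)\<close>
     (\<exists>K1 K2. orthogonal_decomposition K K1 K2 \<and>
        (\<forall>i\<in>{1..n}. reducing_subspace K K1 (Z i) \<and> reducing_subspace K K2 (Z i)) \<and>
        pure_coisometric_tuple K1 n Z \<and> unitary_tuple K2 n Z \<and>
        \<comment> \<open>(iii), under condition (5)\<close>
        ((\<forall>x\<in>DD. (\<Sum>i=1..n.
            op_prod (\<lambda>j. adj DD (U j)) (i - 1) (P i (op_prod_rev U (i - 1) x))) = x) \<longrightarrow>
          (\<exists>W. unitary_op K1 (H2 (defect_space K ZZ)) W \<and>
             (\<forall>x\<in>K1. W (ZZ x) = adj (H2 (defect_space K ZZ)) mult_z (W x))) \<and>
          same_hilbert_dim (defect_space K ZZ) (defect_space UNIV TT) \<and>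
          (\<exists>Ph Uh. (\<forall>i\<in>{1..n}. projection_op (defect_space UNIV TT) (Ph i)) \<and>
             (\<forall>i\<in>{1..n}. unitary_op (defect_space UNIV TT) (defect_space UNIV TT) (Uh i)) \<and>
             commuting_tuple (defect_space UNIV TT) n Uh \<and>
             unitarily_equivalent n K1 Z (H2 (defect_space UNIV TT))
               (\<lambda>i. toeplitz (defect_space UNIV TT) (Uh i \<circ> perp (Ph i)) (Uh i \<circ> Ph i)))))"
proof -
  define Ta where "Ta i = adj UNIV (T i)" for i
  have T_pair: "adjoint_pair UNIV UNIV (T i) (Ta i)" if "i \<in> {1..n}" for i
    unfolding Ta_def using T_contraction[OF that]
    by (intro adjoint_pair_adj) (auto simp: contraction_op_def)
  have Ta_commute: "Ta i (Ta j h) = Ta j (Ta i h)" if ij: "i \<in> {1..n}" "j \<in> {1..n}" for i j h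
  proof (rule cinner_eqI[OF csubspace_UNIV])
    show "cinner (Ta i (Ta j h)) g = cinner (Ta j (Ta i h)) g" for g
      using ij T_commuting
      by (simp add: adjoint_pair_eq[OF adjoint_pair_sym[OF T_pair]] commuting_tuple_def)
  qed auto
  have "op_prod_rev Ta n h = op_prod Ta n h" for h
    by (rule op_prod_rev_eq_op_prod[where S=UNIV]) (use Ta_commute in \<open>auto simp: commuting_tuple_def\<close>)
  then have TT_pair: "adjoint_pair UNIV UNIV TT (op_prod Ta n)"
    using op_prod_adjoint_pair[of n UNIV T Ta] T_pair unfolding TT_def by (simp add: adjoint_pair_def)
  then have TT_adj: "adj UNIV TT h = op_prod Ta n h" for h
    by (rule adj_adjoint_pair[OF csubspace_UNIV _ UNIV_I])
  have TT_adj_pair: "adjoint_pair UNIV UNIV TT (adj UNIV TT)"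
    using TT_pair by (simp add: adjoint_pair_def TT_adj)
  have "norm (op_prod T m h) \<le> norm h" if "m \<le> n" for m h
    using that
  proof (induction m arbitrary: h)
    case (Suc m)
    then have "norm (op_prod T m (T (Suc m) h)) \<le> norm (T (Suc m) h)" by simp
    also have "\<dots> \<le> norm h"
      using T_contraction[of "Suc m"] Suc.prems by (simp add: contraction_op_def)
    finally show ?case by simp
  qed simp
  then have TT_contr: "norm (TT h) \<le> norm h" for h by (simp add: TT_def)
  have TT_adj_contr: "norm (adj UNIV TT h) \<le> norm h" for h
    using adjoint_contractive[OF TT_adj_pair] TT_contr by blast

  have "positive_op UNIV Ds"
    unfolding Ds_def
    using defect_op_positive_sqrt[OF closed_csubspace_UNIV adjoint_pair_sym[OF TT_adj_pair]] TT_adj_contr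
    by blast
  then have Ds_pair: "adjoint_pair UNIV UNIV Ds Ds"
    by (rule positive_op_selfadjoint[OF csubspace_UNIV])
  note Ds_linear = adjoint_pair_add[OF csubspace_UNIV csubspace_UNIV Ds_pair]
    adjoint_pair_scaleC[OF csubspace_UNIV csubspace_UNIV Ds_pair]
  have DD: "DD = closure (range Ds)" by (simp add: DD_def Ds_def defect_space_def)
  have closed_DD: "closed_csubspace DD"
    unfolding DD by (intro closed_csubspace_closure csubspace_image) (simp_all add: Ds_linear)
  have Ds_in: "Ds h \<in> DD" for h
    unfolding DD by (rule subsetD[OF closure_subset]) simp
  have Ds_injective: "x = 0" if x: "x \<in> DD" "Ds x = 0" for x
  proof -
    have "closed_csubspace {y. cinner y x = 0}"
      using orthogonal_complement_closed[of UNIV "{x}"] by simp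
    moreover have "range Ds \<subseteq> {y. cinner y x = 0}"
      using adjoint_pair_eq[OF Ds_pair] x(2) by (auto simp: cinner_zero_right)
    ultimately have "DD \<subseteq> {y. cinner y x = 0}"
      unfolding DD by (intro closure_minimal) (auto simp: closed_csubspace_def)
    then have "cinner x x = 0" using x(1) by blast
    then show ?thesis by (simp add: cinner_self_eq_0)
  qed
  have Ti_defect: "defect_op UNIV (adj UNIV (T i)) (defect_op UNIV (adj UNIV (T i)) h) = h - T i (Ta i h)"
    if i: "i \<in> {1..n}" for i h
  proof -
    have "norm (Ta i h) \<le> norm h" for h
      using adjoint_contractive[OF T_pair[OF i]] T_contraction[OF i] by (auto simp: contraction_op_def)
    then show ?thesis
      using defect_op_positive_sqrt[OF closed_csubspace_UNIV adjoint_pair_sym[OF T_pair[OF i]]]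
      by (simp add: Ta_def)
  qed

  interpret dilation_data n T Ta P U Ds DD
  proof unfold_locales
    show "closed_csubspace DD" by (rule closed_DD)
    show "adjoint_pair UNIV DD Ds Ds"
      using Ds_pair Ds_in by (simp add: adjoint_pair_def)
    show "x = 0" if "x \<in> DD" "Ds x = 0" for x using Ds_injective that .
    show "adjoint_pair UNIV UNIV (T i) (Ta i)" if "i \<in> {1..n}" for i using T_pair that .
    show "commuting_tuple UNIV n T" by (rule T_commuting)
    show "projection_op DD (P i)" if "i \<in> {1..n}" for i using P_projection that .
    show "unitary_op DD DD (U i)" if "i \<in> {1..n}" for i using U_unitary that .
    show "commuting_tuple DD n U" by (rule U_commuting)
    show "Ds (Ta i h) = perp (P i) (adj DD (U i) (Ds h)) + P i (adj DD (U i) (Ds (op_prod Ta n h)))"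
      if "i \<in> {1..n}" for i h
      using cond1[OF that, of h] by (simp add: TT_adj Ta_def)
    show "Ds (U i (P i (adj DD (U i) (Ds h)))) = h - T i (Ta i h)" if "i \<in> {1..n}" for i h
      using cond4[OF that, of h] Ti_defect[OF that] by simp
  qed (use cond2 cond3 in blast)+

  have "Z i ` (UNIV \<times> {0}) \<subseteq> UNIV \<times> {0} \<and> (\<forall>h. Z i (h, 0) = (T i h, 0))" if "i \<in> {1..n}" for i
    using Z_embedded[OF that] unfolding Z_def by auto
  moreover have "(\<exists>W. unitary_op pure_part (H2 (defect_space K ZZ)) W \<and>
       (\<forall>x\<in>pure_part. W (ZZ x) = adj (H2 (defect_space K ZZ)) mult_z (W x))) \<and>
     same_hilbert_dim (defect_space K ZZ) (defect_space UNIV TT) \<and>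
     (\<exists>Ph Uh. (\<forall>i\<in>{1..n}. projection_op (defect_space UNIV TT) (Ph i)) \<and>
       (\<forall>i\<in>{1..n}. unitary_op (defect_space UNIV TT) (defect_space UNIV TT) (Uh i)) \<and>
       commuting_tuple (defect_space UNIV TT) n Uh \<and>
       unitarily_equivalent n pure_part Z (H2 (defect_space UNIV TT))
         (\<lambda>i. toeplitz (defect_space UNIV TT) (Uh i \<circ> perp (Ph i)) (Uh i \<circ> Ph i)))"
    if sum_id: "\<forall>x\<in>DD. (\<Sum>i=1..n.
      op_prod (\<lambda>j. adj DD (U j)) (i - 1) (P i (op_prod_rev U (i - 1) x))) = x"
  proof -
    define Dt where "Dt = defect_op UNIV TT"
    have Dt: "positive_op UNIV Dt" "Dt (Dt h) = h - adj UNIV TT (TT h)" for h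
      using defect_op_positive_sqrt[OF closed_csubspace_UNIV TT_adj_pair] TT_contr by (auto simp: Dt_def)
    have Dt_pair: "adjoint_pair UNIV UNIV Dt Dt"
      by (rule positive_op_selfadjoint[OF csubspace_UNIV Dt(1)])
    note Dt_linear = adjoint_pair_add[OF csubspace_UNIV csubspace_UNIV Dt_pair]
      adjoint_pair_scaleC[OF csubspace_UNIV csubspace_UNIV Dt_pair]
    have Dt_space: "defect_space UNIV TT = closure (range Dt)"
      by (simp add: defect_space_def Dt_def)
    have closed_Dt: "closed_csubspace (defect_space UNIV TT)"
      unfolding Dt_space by (intro closed_csubspace_closure csubspace_image) (simp_all add: Dt_linear)
    have Dt_norm: "(norm (Dt h))\<^sup>2 = (norm h)\<^sup>2 - (norm (op_prod T n h))\<^sup>2" for h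
    proof -
      have "cinner (Dt h) (Dt h) = cinner h h - cinner (TT h) (TT h)"
        using adjoint_pair_eq[OF Dt_pair, of h "Dt h"] adjoint_pair_eq[OF TT_adj_pair, of h "TT h"]
        by (simp add: Dt(2) cinner_diff_right)
      then have "complex_of_real ((norm (Dt h))\<^sup>2) = complex_of_real ((norm h)\<^sup>2 - (norm (TT h))\<^sup>2)"
        by (simp add: cinner_self)
      then show ?thesis unfolding of_real_eq_iff TT_def .
    qed
    have "\<exists>J. unitary_op L (closure (range Dt)) J"
    proof (rule ex_unitary_L_defect_space[OF _ Dt_norm])
      show "(\<Sum>i=1..n. conj_proj i x) = x" if "x \<in> DD" for x
        using sum_id that by (simp add: conj_proj_def)
    qed (simp_all add: Dt_linear)
    then obtain J where J: "unitary_op L (defect_space UNIV TT) J"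
      unfolding Dt_space by blast
    have L: "defect_space K ZZ = L"
      unfolding K_def ZZ_def Z_def by (rule defect_space_ZZ)
    show ?thesis
      unfolding L unfolding ZZ_def Z_def
      using pure_part_shift same_hilbert_dim_if_unitary[OF L_closed closed_Dt J]
        bcl_model[OF closed_Dt J] by blast
  qed
  ultimately show ?thesis
    using coisometric parts_decomposition parts_reducing pure_part_pure unitary_part_unitary
    unfolding K_def Z_def by blast
qed

end
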